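(* Let $\mathcal R_0$ be an admissible component of the root groupoid $\mathcal R$. Then the collections $\mathfrak g^{\mathtt U}=\{\tilde{\mathfrak g}(v)/\mathfrak s(v)\}_{v\in\mathcal R_0}$ and $\mathfrak g^{\mathtt C}=\{\tilde{\mathfrak g}(v)/\mathfrak r(v)\}_{v\in\mathcal R_0}$ are root Lie superalgebras supported on $\mathcal R_0$; $\mathfrak g^{\mathtt U}$ is the initial object and $\mathfrak g^{\mathtt C}$ is the terminal object in the category of root Lie superalgebras supported on $\mathcal R_0$. Here $\mathfrak r(v)$ is the maximal ideal of $\tilde{\mathfrak g}(v)$ having zero intersection with $\mathfrak h(v)$, and $\mathfrak s(v)$ is the ideal of $\tilde{\mathfrak g}(v)$ generated by all weight spaces $\tilde{\mathfrak g}(v)_{b_{v'}(x)-b_{v'}(y)}$, where $x\neq y$ in $X$ and $v'$ runs over all objects connected to $v$ by compositions of reflexions.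
   Context: Root groupoid. Fix a finite set $X$. A root datum is a quadruple $v=(\mathfrak h,a,b,p)$ with $\mathfrak h$ a finite-dimensional complex vector space, $a:X\to\mathfrak h$, $b:X\to\mathfrak h^*$ such that the families $(a(x))_{x\in X}$ and $(b(x))_{x\in X}$ are linearly independent, and $p:X\to\mathbb Z_2$; we write $\mathfrak h(v),a_v,b_v,p_v$. Its Cartan matrix is $a_{xy}=\langle a(x),b(y)\rangle$. An element $x\in X$ is reflectable at $v$ if: $a_{xx}=0$ implies $p(x)=1$; if $a_{xx}\ne 0$ and $p(x)=0$ then $2a_{xy}/a_{xx}\in\mathbb Z_{\le 0}$ for all $y\ne x$; if $a_{xx}\neq 0$ and $p(x)=1$ then $a_{xy}/a_{xx}\in\mathbb Z_{\le 0}$ for all $y\ne x$. For $x$ reflectable at $v$ the reflexion $r_x:v\to v'=(\mathfrak h,a',b',p')$ is defined as follows. Anisotropic case $a_{xx}\ne0$: $p'=p$, $a'(y)=a(y)-2\frac{a_{yx}}{a_{xx}}a(x)$, $b'(y)=b(y)-2\frac{a_{xy}}{a_{xx}}b(x)$. Isotropic case $a_{xx}=0$: $(a'(x),b'(x),p'(x))=(-a(x),-b(x),p(x))$; for $y\neq x$ with $a_{xy}=0$, $(a'(y),b'(y),p'(y))=(a(y),b(y),p(y))$; for $y$ with $a_{xy}\ne0$, $(a'(y),b'(y),p'(y))=(a(y)+\frac{a_{yx}}{a_{xy}}a(x),\,b(y)+b(x),\,1+p(y))$. The root groupoid $\mathcal R$ has the root data as objects; its arrows are generated by reflexions, tautological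 arrows $t_\theta:(\mathfrak h,a,b,p)\to(\mathfrak h',\theta\circ a,(\theta^* )^{-1}\circ b,p)$ for linear isomorphisms $\theta:\mathfrak h\to\mathfrak h'$, and homotheties $h_\lambda:(\mathfrak h,a,b,p)\to(\mathfrak h,\lambda a,b,p)$ for $\lambda:X\to\mathbb C^*$. Each generator induces a linear isomorphism of the spaces $\mathfrak h$ (the identity for reflexions and homotheties, $\theta$ for $t_\theta$), and two compositions of generators $v\to v'$ are identified iff they induce the same isomorphism $\mathfrak h(v)\to\mathfrak h(v')$. A component is a connected component of $\mathcal R$. Root algebras. The half-baked Lie superalgebra $\tilde{\mathfrak g}(v)$ is generated by $\mathfrak h(v)$ (even) and $\tilde e_x,\tilde f_x$ ($x\in X$, of parity $p(x)$) with relations $[\mathfrak h,\mathfrak h]=0$, $[h,\tilde e_x]=\langle b(x),h\rangle\tilde e_x$, $[h,\tilde f_x]=-\langle b(x),h\rangle\tilde f_x$, $[\tilde e_x,\tilde f_y]=0$ for $x\ne y$, $[\tilde e_x,\tilde f_x]=a(x)$. It is graded by $\mathfrak h$-weights in $\sum_x\mathbb Zb(x)$ and contains $\mathfrak h(v)$; $\tilde{\mathfrak g}(v)_\mu$ denotes the weight space. A root Lie superalgebra supported on a component $\mathcal R_0$ is a collection of quotients $\mathfrak g(v)=\tilde{\mathfrak g}(v)/I(v)$, $v\in\mathcal R_0$, with $I(v)\cap\mathfrak h(v)=0$, such that for each arrow $\alpha:v\to v'$ in $\mathcal R_0$ the induced isomorphism $\mathfrak h(v)\to\mathfrak h(v')$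 extends to an isomorphism $\mathfrak g(v)\to\mathfrak g(v')$. $\mathcal R_0$ is admissible if a root Lie superalgebra supported on it exists. Morphisms of root Lie superalgebras $\{\tilde{\mathfrak g}(v)/I(v)\}\to\{\tilde{\mathfrak g}(v)/I'(v)\}$ are collections of Lie superalgebra homomorphisms commuting with the projections from $\tilde{\mathfrak g}(v)$ (so one exists iff $I(v)\subset I'(v)$ for all $v$, and is then unique). *)

theory Defs
  imports
    Complex_Main
    "HOL-Library.Z2"
    "HOL-Library.Nonpos_Ints"
    "HOL-Library.FuncSet"
    "HOL-Algebra.AbelCoset"
    "Jordan_Normal_Form.VS_Connect"
begin

section \<open>Lie superalgebras over the complex numbers\<close>

text \<open>
  Vector spaces are carrier-based modules over \<^term>\<open>class_ring :: complex ring\<close>. The ring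
  fields \<open>mult\<close> and \<open>one\<close> that a module record inherits play no role.
\<close>

record 'a lie_super = "(complex, 'a) module" +
  brk :: "'a \<Rightarrow> 'a \<Rightarrow> 'a"
  part :: "bit \<Rightarrow> 'a set"

definition super_sign :: "bit \<Rightarrow> bit \<Rightarrow> complex" where
  "super_sign i j = (if i = 1 \<and> j = 1 then - 1 else 1)"

locale lie_superalgebra = vectorspace class_ring L
  for L :: "('a, 'm) lie_super_scheme" (structure) +
  assumes part_subspace: "subspace class_ring (part L i) L"
    and part_sum: "u \<in> carrier L \<Longrightarrow> \<exists>u0\<in>part L 0. \<exists>u1\<in>part L 1. u = u0 \<oplus> u1"
    and part_disjoint: "part L 0 \<inter> part L 1 = {\<zero>}"
    and brk_closed: "\<lbrakk>u \<in> carrier L; w \<in> carrier L\<rbrakk> \<Longrightarrow> brk L u w \<in> carrier L"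
    and brk_add_left: "\<lbrakk>u \<in> carrier L; u' \<in> carrier L; w \<in> carrier L\<rbrakk>
          \<Longrightarrow> brk L (u \<oplus> u') w = brk L u w \<oplus> brk L u' w"
    and brk_add_right: "\<lbrakk>u \<in> carrier L; w \<in> carrier L; w' \<in> carrier L\<rbrakk>
          \<Longrightarrow> brk L u (w \<oplus> w') = brk L u w \<oplus> brk L u w'"
    and brk_smult_left: "\<lbrakk>u \<in> carrier L; w \<in> carrier L\<rbrakk> \<Longrightarrow> brk L (c \<odot> u) w = c \<odot> brk L u w"
    and brk_smult_right: "\<lbrakk>u \<in> carrier L; w \<in> carrier L\<rbrakk> \<Longrightarrow> brk L u (c \<odot> w) = c \<odot> brk L u w"
    and brk_part: "\<lbrakk>u \<in> part L i; w \<in> part L j\<rbrakk> \<Longrightarrow> brk L u w \<in> part L (i + j)"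
    and brk_skew: "\<lbrakk>u \<in> part L i; w \<in> part L j\<rbrakk>
          \<Longrightarrow> brk L u w = (- super_sign i j) \<odot> brk L w u"
    and brk_jacobi: "\<lbrakk>u \<in> part L i; w \<in> part L j; z \<in> carrier L\<rbrakk>
          \<Longrightarrow> brk L u (brk L w z) = brk L (brk L u w) z \<oplus> super_sign i j \<odot> brk L w (brk L u z)"

definition lie_hom :: "'a lie_super \<Rightarrow> 'b lie_super \<Rightarrow> ('a \<Rightarrow> 'b) set" where
  "lie_hom L M = {f. lie_superalgebra L \<and> lie_superalgebra M \<and> linear_map class_ring L M f
     \<and> (\<forall>i. f ` part L i \<subseteq> part M i)
     \<and> (\<forall>u\<in>carrier L. \<forall>w\<in>carrier L. f (brk L u w) = brk M (f u) (f w))}"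

definition lie_iso :: "'a lie_super \<Rightarrow> 'b lie_super \<Rightarrow> ('a \<Rightarrow> 'b) set" where
  "lie_iso L M = {f \<in> lie_hom L M. bij_betw f (carrier L) (carrier M)}"

text \<open>
  Ideals are graded by parity, so that quotients are again Lie superalgebras. For the half-baked
  algebras below this is no restriction, since there the weight of a vector determines its parity.
\<close>

definition lie_ideal :: "'a set \<Rightarrow> 'a lie_super \<Rightarrow> bool" where
  "lie_ideal I L \<longleftrightarrow> subspace class_ring I L
     \<and> (\<forall>u\<in>carrier L. \<forall>w\<in>I. brk L u w \<in> I \<and> brk L w u \<in> I)
     \<and> (\<forall>w\<in>I. \<exists>w0\<in>I \<inter> part L 0. \<exists>w1\<in>I \<inter> part L 1. w = w0 \<oplus>\<^bsub>L\<^esub> w1)"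

definition lie_ideal_gen :: "'a lie_super \<Rightarrow> 'a set \<Rightarrow> 'a set" where
  "lie_ideal_gen L S = \<Inter> {I. lie_ideal I L \<and> S \<subseteq> I}"

definition lie_quot :: "'a lie_super \<Rightarrow> 'a set \<Rightarrow> 'a set lie_super" where
  "lie_quot L I =
     \<lparr>carrier = a_rcosets\<^bsub>L\<^esub> I, mult = undefined, one = undefined,
      zero = I, add = set_add L,
      smult = (\<lambda>c A. \<Union>u\<in>A. I +>\<^bsub>L\<^esub> (c \<odot>\<^bsub>L\<^esub> u)),
      brk = (\<lambda>A B. \<Union>u\<in>A. \<Union>w\<in>B. I +>\<^bsub>L\<^esub> (brk L u w)),
      part = (\<lambda>i. (\<lambda>u. I +>\<^bsub>L\<^esub> u) ` part L i)\<rparr>"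


section \<open>Lie superalgebras presented by generators and relations\<close>

datatype 'g lie_term =
    Gen 'g
  | Zero
  | Plus "'g lie_term" "'g lie_term"
  | Scale complex "'g lie_term"
  | Brk "'g lie_term" "'g lie_term"

definition lie_terms :: "'g set \<Rightarrow> 'g lie_term set" where
  "lie_terms G = {t. set_lie_term t \<subseteq> G}"

inductive homog :: "('g \<Rightarrow> bit) \<Rightarrow> 'g lie_term \<Rightarrow> bit \<Rightarrow> bool" for par where
  "homog par (Gen g) (par g)"
| "homog par Zero i"
| "\<lbrakk>homog par s i; homog par t i\<rbrakk> \<Longrightarrow> homog par (Plus s t) i"
| "homog par t i \<Longrightarrow> homog par (Scale c t) i"
| "\<lbrakk>homog par s i; homog par t j\<rbrakk> \<Longrightarrow> homog par (Brk s t) (i + j)"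

text \<open>
  The smallest congruence on the terms over \<open>G\<close> that contains the relations \<open>R\<close> and the
  identities of Lie superalgebras.
\<close>

inductive_set lie_cong :: "'g set \<Rightarrow> ('g \<Rightarrow> bit) \<Rightarrow> ('g lie_term \<times> 'g lie_term) set
    \<Rightarrow> ('g lie_term \<times> 'g lie_term) set"
  for G par R where
  rel: "\<lbrakk>(s, t) \<in> R; s \<in> lie_terms G; t \<in> lie_terms G\<rbrakk> \<Longrightarrow> (s, t) \<in> lie_cong G par R"
| refl: "t \<in> lie_terms G \<Longrightarrow> (t, t) \<in> lie_cong G par R"
| sym: "(s, t) \<in> lie_cong G par R \<Longrightarrow> (t, s) \<in> lie_cong G par R"
| trans: "\<lbrakk>(s, t) \<in> lie_cong G par R; (t, u) \<in> lie_cong G par R\<rbrakk> \<Longrightarrow> (s, u) \<in> lie_cong G par R"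
| cong_plus: "\<lbrakk>(s, s') \<in> lie_cong G par R; (t, t') \<in> lie_cong G par R\<rbrakk>
    \<Longrightarrow> (Plus s t, Plus s' t') \<in> lie_cong G par R"
| cong_scale: "(t, t') \<in> lie_cong G par R \<Longrightarrow> (Scale c t, Scale c t') \<in> lie_cong G par R"
| cong_brk: "\<lbrakk>(s, s') \<in> lie_cong G par R; (t, t') \<in> lie_cong G par R\<rbrakk>
    \<Longrightarrow> (Brk s t, Brk s' t') \<in> lie_cong G par R"
| plus_assoc: "\<lbrakk>s \<in> lie_terms G; t \<in> lie_terms G; u \<in> lie_terms G\<rbrakk>
    \<Longrightarrow> (Plus (Plus s t) u, Plus s (Plus t u)) \<in> lie_cong G par R"
| plus_comm: "\<lbrakk>s \<in> lie_terms G; t \<in> lie_terms G\<rbrakk>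
    \<Longrightarrow> (Plus s t, Plus t s) \<in> lie_cong G par R"
| plus_zero: "t \<in> lie_terms G \<Longrightarrow> (Plus Zero t, t) \<in> lie_cong G par R"
| scale_zero: "t \<in> lie_terms G \<Longrightarrow> (Scale 0 t, Zero) \<in> lie_cong G par R"
| scale_one: "t \<in> lie_terms G \<Longrightarrow> (Scale 1 t, t) \<in> lie_cong G par R"
| scale_scale: "t \<in> lie_terms G \<Longrightarrow> (Scale c (Scale d t), Scale (c * d) t) \<in> lie_cong G par R"
| scale_add: "t \<in> lie_terms G
    \<Longrightarrow> (Scale (c + d) t, Plus (Scale c t) (Scale d t)) \<in> lie_cong G par R"
| scale_plus: "\<lbrakk>s \<in> lie_terms G; t \<in> lie_terms G\<rbrakk>
    \<Longrightarrow> (Scale c (Plus s t), Plus (Scale c s) (Scale c t)) \<in> lie_cong G par R"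
| brk_plus_left: "\<lbrakk>s \<in> lie_terms G; t \<in> lie_terms G; u \<in> lie_terms G\<rbrakk>
    \<Longrightarrow> (Brk (Plus s t) u, Plus (Brk s u) (Brk t u)) \<in> lie_cong G par R"
| brk_plus_right: "\<lbrakk>s \<in> lie_terms G; t \<in> lie_terms G; u \<in> lie_terms G\<rbrakk>
    \<Longrightarrow> (Brk s (Plus t u), Plus (Brk s t) (Brk s u)) \<in> lie_cong G par R"
| brk_scale_left: "\<lbrakk>s \<in> lie_terms G; t \<in> lie_terms G\<rbrakk>
    \<Longrightarrow> (Brk (Scale c s) t, Scale c (Brk s t)) \<in> lie_cong G par R"
| brk_scale_right: "\<lbrakk>s \<in> lie_terms G; t \<in> lie_terms G\<rbrakk>
    \<Longrightarrow> (Brk s (Scale c t), Scale c (Brk s t)) \<in> lie_cong G par R"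
| skew: "\<lbrakk>s \<in> lie_terms G; t \<in> lie_terms G; homog par s i; homog par t j\<rbrakk>
    \<Longrightarrow> (Brk s t, Scale (- super_sign i j) (Brk t s)) \<in> lie_cong G par R"
| jacobi: "\<lbrakk>s \<in> lie_terms G; t \<in> lie_terms G; u \<in> lie_terms G; homog par s i; homog par t j\<rbrakk>
    \<Longrightarrow> (Brk s (Brk t u), Plus (Brk (Brk s t) u) (Scale (super_sign i j) (Brk t (Brk s u))))
         \<in> lie_cong G par R"

definition presented_lie :: "'g set \<Rightarrow> ('g \<Rightarrow> bit) \<Rightarrow> ('g lie_term \<times> 'g lie_term) set
    \<Rightarrow> 'g lie_term set lie_super" where
  "presented_lie G par R = (let E = lie_cong G par R in
     \<lparr>carrier = lie_terms G // E, mult = undefined, one = undefined,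
      zero = E `` {Zero},
      add = (\<lambda>A B. \<Union>s\<in>A. \<Union>t\<in>B. E `` {Plus s t}),
      smult = (\<lambda>c A. \<Union>t\<in>A. E `` {Scale c t}),
      brk = (\<lambda>A B. \<Union>s\<in>A. \<Union>t\<in>B. E `` {Brk s t}),
      part = (\<lambda>i. {E `` {t} | t. t \<in> lie_terms G \<and> homog par t i})\<rparr>)"


section \<open>Root data and the root groupoid\<close>

record ('x, 'h) root_datum =
  hsp :: "(complex, 'h) module"
  av :: "'x \<Rightarrow> 'h"
  bv :: "'x \<Rightarrow> 'h \<Rightarrow> complex"
  pv :: "'x \<Rightarrow> bit"

definition dual_space :: "(complex, 'h) module \<Rightarrow> ('h \<Rightarrow> complex) set" where
  "dual_space H = {f \<in> extensional (carrier H).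
     (\<forall>h\<in>carrier H. \<forall>k\<in>carrier H. f (h \<oplus>\<^bsub>H\<^esub> k) = f h + f k)
     \<and> (\<forall>c. \<forall>h\<in>carrier H. f (c \<odot>\<^bsub>H\<^esub> h) = c * f h)}"

definition is_root_datum :: "'x set \<Rightarrow> ('x, 'h) root_datum \<Rightarrow> bool" where
  "is_root_datum X v \<longleftrightarrow>
     vectorspace class_ring (hsp v) \<and> vectorspace.fin_dim class_ring (hsp v)
     \<and> av v \<in> X \<rightarrow>\<^sub>E carrier (hsp v)
     \<and> bv v \<in> X \<rightarrow>\<^sub>E dual_space (hsp v)
     \<and> pv v \<in> extensional X
     \<and> (\<forall>c. (\<Oplus>\<^bsub>hsp v\<^esub>x\<in>X. c x \<odot>\<^bsub>hsp v\<^esub> av v x) = \<zero>\<^bsub>hsp v\<^esub> \<longrightarrow> (\<forall>x\<in>X. c x = 0))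
     \<and> (\<forall>c. (\<forall>h\<in>carrier (hsp v). (\<Sum>x\<in>X. c x * bv v x h) = 0) \<longrightarrow> (\<forall>x\<in>X. c x = 0))"

definition cartan :: "('x, 'h) root_datum \<Rightarrow> 'x \<Rightarrow> 'x \<Rightarrow> complex" where
  "cartan v x y = bv v y (av v x)"

definition reflectable :: "'x set \<Rightarrow> ('x, 'h) root_datum \<Rightarrow> 'x \<Rightarrow> bool" where
  "reflectable X v x \<longleftrightarrow> x \<in> X
     \<and> (cartan v x x = 0 \<longrightarrow> pv v x = 1)
     \<and> (cartan v x x \<noteq> 0 \<and> pv v x = 0 \<longrightarrow>
          (\<forall>y\<in>X - {x}. 2 * cartan v x y / cartan v x x \<in> \<int>\<^sub>\<le>\<^sub>0))
     \<and> (cartan v x x \<noteq> 0 \<and> pv v x = 1 \<longrightarrow>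
          (\<forall>y\<in>X - {x}. cartan v x y / cartan v x x \<in> \<int>\<^sub>\<le>\<^sub>0))"

definition reflexion :: "'x set \<Rightarrow> 'x \<Rightarrow> ('x, 'h) root_datum \<Rightarrow> ('x, 'h) root_datum" where
  "reflexion X x v = (let H = hsp v; A = cartan v in
     if A x x \<noteq> 0 then
       \<lparr>hsp = H,
        av = (\<lambda>y\<in>X. av v y \<ominus>\<^bsub>H\<^esub> (2 * A y x / A x x) \<odot>\<^bsub>H\<^esub> av v x),
        bv = (\<lambda>y\<in>X. \<lambda>h\<in>carrier H. bv v y h - 2 * A x y / A x x * bv v x h),
        pv = pv v\<rparr>
     else
       \<lparr>hsp = H,
        av = (\<lambda>y\<in>X. if y = x then \<ominus>\<^bsub>H\<^esub> av v x
                    else if A x y = 0 then av v y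
                    else av v y \<oplus>\<^bsub>H\<^esub> (A y x / A x y) \<odot>\<^bsub>H\<^esub> av v x),
        bv = (\<lambda>y\<in>X. \<lambda>h\<in>carrier H. if y = x then - bv v x h
                    else if A x y = 0 then bv v y h
                    else bv v y h + bv v x h),
        pv = (\<lambda>y\<in>X. if y = x \<or> A x y = 0 then pv v y else 1 + pv v y)\<rparr>)"

definition linear_iso :: "(complex, 'h) module \<Rightarrow> (complex, 'h) module \<Rightarrow> ('h \<Rightarrow> 'h) set" where
  "linear_iso H H' = {\<theta> \<in> extensional (carrier H).
     linear_map class_ring H H' \<theta> \<and> bij_betw \<theta> (carrier H) (carrier H')}"

definition tautological :: "'x set \<Rightarrow> ('h \<Rightarrow> 'h) \<Rightarrow> (complex, 'h) module
    \<Rightarrow> ('x, 'h) root_datum \<Rightarrow> ('x, 'h) root_datum" where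
  "tautological X \<theta> H' v =
     \<lparr>hsp = H',
      av = (\<lambda>x\<in>X. \<theta> (av v x)),
      bv = (\<lambda>x\<in>X. \<lambda>k\<in>carrier H'. bv v x (inv_into (carrier (hsp v)) \<theta> k)),
      pv = pv v\<rparr>"

definition homothety :: "'x set \<Rightarrow> ('x \<Rightarrow> complex) \<Rightarrow> ('x, 'h) root_datum \<Rightarrow> ('x, 'h) root_datum" where
  "homothety X l v = v\<lparr>av := (\<lambda>x\<in>X. l x \<odot>\<^bsub>hsp v\<^esub> av v x)\<rparr>"

text \<open>
  An arrow \<open>v \<rightarrow> v'\<close> of the root groupoid is determined by the linear isomorphism that it
  induces, so it is represented by that isomorphism: \<open>root_arrow X v \<phi> v'\<close> says that \<open>\<phi>\<close> is
  induced by a composition of generators and their inverses.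
\<close>

inductive root_arrow :: "'x set \<Rightarrow> ('x, 'h) root_datum \<Rightarrow> ('h \<Rightarrow> 'h) \<Rightarrow> ('x, 'h) root_datum \<Rightarrow> bool"
  for X where
  reflexion: "\<lbrakk>is_root_datum X v; reflectable X v x\<rbrakk>
    \<Longrightarrow> root_arrow X v (\<lambda>h\<in>carrier (hsp v). h) (reflexion X x v)"
| tautological: "\<lbrakk>is_root_datum X v; vectorspace class_ring H'; \<theta> \<in> linear_iso (hsp v) H'\<rbrakk>
    \<Longrightarrow> root_arrow X v \<theta> (tautological X \<theta> H' v)"
| homothety: "\<lbrakk>is_root_datum X v; \<And>x. x \<in> X \<Longrightarrow> l x \<noteq> 0\<rbrakk>
    \<Longrightarrow> root_arrow X v (\<lambda>h\<in>carrier (hsp v). h) (homothety X l v)"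
| ident: "is_root_datum X v \<Longrightarrow> root_arrow X v (\<lambda>h\<in>carrier (hsp v). h) v"
| comp: "\<lbrakk>root_arrow X v \<phi> v'; root_arrow X v' \<psi> v''\<rbrakk>
    \<Longrightarrow> root_arrow X v (compose (carrier (hsp v)) \<psi> \<phi>) v''"
| inv: "root_arrow X v \<phi> v'
    \<Longrightarrow> root_arrow X v' (\<lambda>k\<in>carrier (hsp v'). inv_into (carrier (hsp v)) \<phi> k) v"

definition is_component :: "'x set \<Rightarrow> ('x, 'h) root_datum set \<Rightarrow> bool" where
  "is_component X R0 \<longleftrightarrow> (\<exists>v. is_root_datum X v \<and> R0 = {v'. \<exists>\<phi>. root_arrow X v \<phi> v'})"

definition reflexion_connected :: "'x set \<Rightarrow> ('x, 'h) root_datum \<Rightarrow> ('x, 'h) root_datum \<Rightarrow> bool" where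
  "reflexion_connected X = (\<lambda>v v'. \<exists>x. reflectable X v x \<and> v' = reflexion X x v)\<^sup>*\<^sup>*"


section \<open>The half-baked Lie superalgebra\<close>

datatype ('x, 'h) hb_gen = Cart 'h | E 'x | F 'x

definition hb_gens :: "'x set \<Rightarrow> ('x, 'h) root_datum \<Rightarrow> ('x, 'h) hb_gen set" where
  "hb_gens X v = Cart ` carrier (hsp v) \<union> E ` X \<union> F ` X"

definition hb_par :: "('x, 'h) root_datum \<Rightarrow> ('x, 'h) hb_gen \<Rightarrow> bit" where
  "hb_par v g = (case g of Cart h \<Rightarrow> 0 | E x \<Rightarrow> pv v x | F x \<Rightarrow> pv v x)"

text \<open>The first two relations make the generators \<open>Cart h\<close> depend linearly on \<open>h\<close>.\<close>

inductive_set hb_rels :: "'x set \<Rightarrow> ('x, 'h) root_datum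
    \<Rightarrow> (('x, 'h) hb_gen lie_term \<times> ('x, 'h) hb_gen lie_term) set"
  for X v where
  "\<lbrakk>h \<in> carrier (hsp v); k \<in> carrier (hsp v)\<rbrakk>
    \<Longrightarrow> (Gen (Cart (h \<oplus>\<^bsub>hsp v\<^esub> k)), Plus (Gen (Cart h)) (Gen (Cart k))) \<in> hb_rels X v"
| "h \<in> carrier (hsp v)
    \<Longrightarrow> (Gen (Cart (c \<odot>\<^bsub>hsp v\<^esub> h)), Scale c (Gen (Cart h))) \<in> hb_rels X v"
| "\<lbrakk>h \<in> carrier (hsp v); k \<in> carrier (hsp v)\<rbrakk>
    \<Longrightarrow> (Brk (Gen (Cart h)) (Gen (Cart k)), Zero) \<in> hb_rels X v"
| "\<lbrakk>h \<in> carrier (hsp v); x \<in> X\<rbrakk>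
    \<Longrightarrow> (Brk (Gen (Cart h)) (Gen (E x)), Scale (bv v x h) (Gen (E x))) \<in> hb_rels X v"
| "\<lbrakk>h \<in> carrier (hsp v); x \<in> X\<rbrakk>
    \<Longrightarrow> (Brk (Gen (Cart h)) (Gen (F x)), Scale (- bv v x h) (Gen (F x))) \<in> hb_rels X v"
| "\<lbrakk>x \<in> X; y \<in> X; x \<noteq> y\<rbrakk> \<Longrightarrow> (Brk (Gen (E x)) (Gen (F y)), Zero) \<in> hb_rels X v"
| "x \<in> X \<Longrightarrow> (Brk (Gen (E x)) (Gen (F x)), Gen (Cart (av v x))) \<in> hb_rels X v"

definition half_baked :: "'x set \<Rightarrow> ('x, 'h) root_datum \<Rightarrow> ('x, 'h) hb_gen lie_term set lie_super" where
  "half_baked X v = presented_lie (hb_gens X v) (hb_par v) (hb_rels X v)"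

definition hb_cart :: "'x set \<Rightarrow> ('x, 'h) root_datum \<Rightarrow> 'h \<Rightarrow> ('x, 'h) hb_gen lie_term set" where
  "hb_cart X v h = lie_cong (hb_gens X v) (hb_par v) (hb_rels X v) `` {Gen (Cart h)}"

definition hb_weight_space :: "'x set \<Rightarrow> ('x, 'h) root_datum \<Rightarrow> ('h \<Rightarrow> complex)
    \<Rightarrow> ('x, 'h) hb_gen lie_term set set" where
  "hb_weight_space X v \<mu> = {u \<in> carrier (half_baked X v).
     \<forall>h\<in>carrier (hsp v). brk (half_baked X v) (hb_cart X v h) u = \<mu> h \<odot>\<^bsub>half_baked X v\<^esub> u}"

definition cartan_free_ideal :: "'x set \<Rightarrow> ('x, 'h) root_datum
    \<Rightarrow> ('x, 'h) hb_gen lie_term set set \<Rightarrow> bool" where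
  "cartan_free_ideal X v I \<longleftrightarrow> lie_ideal I (half_baked X v)
     \<and> I \<inter> hb_cart X v ` carrier (hsp v) = {\<zero>\<^bsub>half_baked X v\<^esub>}"

definition r_ideal :: "'x set \<Rightarrow> ('x, 'h) root_datum \<Rightarrow> ('x, 'h) hb_gen lie_term set set" where
  "r_ideal X v = (GREATEST I. cartan_free_ideal X v I)"

definition s_ideal :: "'x set \<Rightarrow> ('x, 'h) root_datum \<Rightarrow> ('x, 'h) hb_gen lie_term set set" where
  "s_ideal X v = lie_ideal_gen (half_baked X v)
     (\<Union> {hb_weight_space X v (\<lambda>h. bv v' x h - bv v' y h) | v' x y.
          reflexion_connected X v v' \<and> x \<in> X \<and> y \<in> X \<and> x \<noteq> y})"


section \<open>Root Lie superalgebras\<close>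

text \<open>
  A collection of quotients of the half-baked algebras is given by the family \<open>I\<close> of its
  ideals; only the values of \<open>I\<close> on \<open>R0\<close> matter.
\<close>

definition root_lie :: "'x set \<Rightarrow> ('x, 'h) root_datum set
    \<Rightarrow> (('x, 'h) root_datum \<Rightarrow> ('x, 'h) hb_gen lie_term set set) \<Rightarrow> bool" where
  "root_lie X R0 I \<longleftrightarrow>
     (\<forall>v\<in>R0. cartan_free_ideal X v (I v))
     \<and> (\<forall>v\<in>R0. \<forall>v'\<in>R0. \<forall>\<phi>. root_arrow X v \<phi> v' \<longrightarrow>
          (\<exists>\<psi>\<in>lie_iso (lie_quot (half_baked X v) (I v)) (lie_quot (half_baked X v') (I v')).
             \<forall>h\<in>carrier (hsp v). \<psi> (I v +>\<^bsub>half_baked X v\<^esub> hb_cart X v h)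
                = I v' +>\<^bsub>half_baked X v'\<^esub> hb_cart X v' (\<phi> h)))"

definition admissible :: "'x set \<Rightarrow> ('x, 'h) root_datum set \<Rightarrow> bool" where
  "admissible X R0 \<longleftrightarrow> (\<exists>I. root_lie X R0 I)"

definition root_lie_mor :: "'x set \<Rightarrow> ('x, 'h) root_datum set
    \<Rightarrow> (('x, 'h) root_datum \<Rightarrow> ('x, 'h) hb_gen lie_term set set)
    \<Rightarrow> (('x, 'h) root_datum \<Rightarrow> ('x, 'h) hb_gen lie_term set set)
    \<Rightarrow> (('x, 'h) root_datum \<Rightarrow> ('x, 'h) hb_gen lie_term set set
          \<Rightarrow> ('x, 'h) hb_gen lie_term set set) set" where
  "root_lie_mor X R0 I J = {f \<in> extensional R0. \<forall>v\<in>R0.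
     f v \<in> extensional (carrier (lie_quot (half_baked X v) (I v)))
     \<and> f v \<in> lie_hom (lie_quot (half_baked X v) (I v)) (lie_quot (half_baked X v) (J v))
     \<and> (\<forall>u\<in>carrier (half_baked X v).
          f v (I v +>\<^bsub>half_baked X v\<^esub> u) = J v +>\<^bsub>half_baked X v\<^esub> u)}"

definition initial_root_lie :: "'x set \<Rightarrow> ('x, 'h) root_datum set
    \<Rightarrow> (('x, 'h) root_datum \<Rightarrow> ('x, 'h) hb_gen lie_term set set) \<Rightarrow> bool" where
  "initial_root_lie X R0 I \<longleftrightarrow> root_lie X R0 I
     \<and> (\<forall>J. root_lie X R0 J \<longrightarrow> (\<exists>!f. f \<in> root_lie_mor X R0 I J))"

definition terminal_root_lie :: "'x set \<Rightarrow> ('x, 'h) root_datum set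
    \<Rightarrow> (('x, 'h) root_datum \<Rightarrow> ('x, 'h) hb_gen lie_term set set) \<Rightarrow> bool" where
  "terminal_root_lie X R0 I \<longleftrightarrow> root_lie X R0 I
     \<and> (\<forall>J. root_lie X R0 J \<longrightarrow> (\<exists>!f. f \<in> root_lie_mor X R0 J I))"

end

theory Submission
  imports Defs
begin

text \<open>
  Let \<open>I\<close> be a root Lie superalgebra supported on the component. Ideals of the half-baked algebra
  that avoid the Cartan subalgebra are exactly those inside the sum of the nonzero weight spaces, so
  there is a largest one, \<open>r\<close>, and every isomorphism of the quotients by \<open>I\<close> descends to the quotients
  by \<open>r\<close>. The weight \<open>b x - b y\<close> does not occur in the half-baked algebra, so transporting along chains
  of reflexions gives \<open>s \<subseteq> I\<close>.

  For an arrow \<open>v \<rightarrow> w\<close> no computation with root strings is needed to compare the quotients by \<open>s\<close>: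
  lift the images of the generators of \<open>w\<close> in the quotient by \<open>I\<close> to weight vectors over \<open>v\<close>. Their
  brackets \<open>[e x, f y]\<close>, \<open>x \<noteq> y\<close>, lie in \<open>s\<close> for weight reasons, and \<open>[e x, f x]\<close> has weight zero, where
  nothing is lost modulo \<open>I\<close>. The two homomorphisms obtained for an arrow and its inverse are mutually
  inverse, because modulo \<open>I\<close> they are, the weight spaces of the generators are lines, and no generator
  lies in \<open>I\<close>; the last point uses that the Cartan subalgebra acts faithfully on Verma modules.
\<close>

section \<open>Lie superalgebras, ideals and quotients\<close>

text \<open>The algebras are terms modulo a congruence, so nothing about their size is known
  beforehand: that the even and odd parts meet in zero, or that \<open>a x\<close> does not
  collapse, has to be proved. Upper bounds on weight spaces come from a spanning set of iterated
  brackets, lower bounds from a single representation, and linear independence of the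
  \<open>b x\<close> makes the degree of a weight vector readable from its weight.

  Admissibility enters through one family \<open>I\<close>. Containment in \<open>I\<close> is what
  keeps \<open>s\<close> off the Cartan subalgebra. Moreover the quotient by \<open>I\<close> is a
  common target in which the maps to be compared are already known; the freedom left above it is one
  scalar for each generator, which must be 1 because the generator survives modulo \<open>I\<close>.

  The groupoid contributes the fact that every arrow matches the weights generating \<open>s\<close>
  at its two ends. Reflexions do so because each is undone by the reflexion at the same element,
  tautological arrows and homotheties because they commute with reflexions.\<close>

locale complex_vs = vectorspace class_ring L
  for L :: "(complex, 'a, 'm) module_scheme" (structure)
begin

lemma scale_closed [simp, intro]: "u \<in> carrier L \<Longrightarrow> c \<odot> u \<in> carrier L"
  by (rule smult_closed) simp_all

lemma scale_scale: "u \<in> carrier L \<Longrightarrow> c \<odot> (d \<odot> u) = (c * d) \<odot> u"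
  using smult_assoc1[of c d u] by simp

lemma scale_one [simp]: "u \<in> carrier L \<Longrightarrow> 1 \<odot> u = u"
  using smult_one[of u] by simp

lemma scale_zero [simp]: "u \<in> carrier L \<Longrightarrow> 0 \<odot> u = \<zero>"
  using lmult_0[of u] by simp

lemma scale_add_left: "u \<in> carrier L \<Longrightarrow> (c + d) \<odot> u = c \<odot> u \<oplus> d \<odot> u"
  using smult_l_distr[of c d u] by simp

lemma scale_add_right:
  "u \<in> carrier L \<Longrightarrow> w \<in> carrier L \<Longrightarrow> c \<odot> (u \<oplus> w) = c \<odot> u \<oplus> c \<odot> w"
  by (rule smult_r_distr) simp_all

lemma scale_zero_right [simp]: "c \<odot> \<zero> = \<zero>"
  by (rule rmult_0) simp

lemma neg_scale: "u \<in> carrier L \<Longrightarrow> \<ominus> u = (- 1) \<odot> u"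
  using smult_minus_1[of u] by (simp add: class_ring_simps)

lemma scale_minus_left: "u \<in> carrier L \<Longrightarrow> (c - d) \<odot> u = c \<odot> u \<ominus> d \<odot> u"
  using scale_add_left[of u c "- d"] scale_scale[of u "-1" d] by (simp add: minus_eq neg_scale)

lemma scale_minus_right:
  "u \<in> carrier L \<Longrightarrow> w \<in> carrier L \<Longrightarrow> c \<odot> (u \<ominus> w) = c \<odot> u \<ominus> c \<odot> w"
  by (simp add: minus_eq neg_scale scale_add_right scale_scale mult.commute)

lemma scale_eq_zero: "u \<in> carrier L \<Longrightarrow> c \<odot> u = \<zero> \<Longrightarrow> c \<noteq> 0 \<Longrightarrow> u = \<zero>"
  using scale_scale[of u "inverse c" c] by simp

declare minus_closed [simp, intro]

lemma minus_eq_iff: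
  assumes x: "x \<in> carrier L" and y: "y \<in> carrier L" and z: "z \<in> carrier L"
  shows "x \<ominus> y = z \<longleftrightarrow> x = z \<oplus> y"
proof
  have "(x \<ominus> y) \<oplus> y = x" using x y by (simp add: minus_eq a_assoc l_neg)
  then show "x \<ominus> y = z \<Longrightarrow> x = z \<oplus> y" by simp
  have "(z \<oplus> y) \<ominus> y = z" using y z by (simp add: minus_eq a_assoc r_neg)
  then show "x = z \<oplus> y \<Longrightarrow> x \<ominus> y = z" by simp
qed

lemma eq_minus_iff:
  assumes "x \<in> carrier L" "y \<in> carrier L" "z \<in> carrier L"
  shows "z = x \<ominus> y \<longleftrightarrow> z \<oplus> y = x"
  using minus_eq_iff[OF assms] by auto

lemma minus_add_eq:
  assumes "x \<in> carrier L" "y \<in> carrier L" "z \<in> carrier L"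
  shows "x \<ominus> y \<oplus> z = x \<oplus> z \<ominus> y" "x \<oplus> (y \<ominus> z) = x \<oplus> y \<ominus> z"
    "x \<ominus> y \<ominus> z = x \<ominus> (y \<oplus> z)" "x \<ominus> (y \<ominus> z) = x \<oplus> z \<ominus> y"
proof -
  show 1: "x \<ominus> y \<oplus> z = x \<oplus> z \<ominus> y" and 2: "x \<oplus> (y \<ominus> z) = x \<oplus> y \<ominus> z"
    and 3: "x \<ominus> y \<ominus> z = x \<ominus> (y \<oplus> z)"
    using assms by (simp_all add: minus_eq a_ac minus_add)
  show "x \<ominus> (y \<ominus> z) = x \<oplus> z \<ominus> y"
    using assms by (simp add: minus_eq a_ac minus_add)
qed

text \<open>As rewrite rules these push every subtraction to the root of a term and then across the
  equation, leaving an identity of sums that AC rewriting closes.\<close>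

lemmas diff_simps = minus_eq_iff eq_minus_iff minus_add_eq a_ac

lemma minus_eq_zero_iff: "u \<in> carrier L \<Longrightarrow> w \<in> carrier L \<Longrightarrow> u \<ominus> w = \<zero> \<longleftrightarrow> u = w"
  by (simp add: minus_eq_iff)

lemma minus_zero [simp]: "u \<in> carrier L \<Longrightarrow> u \<ominus> \<zero> = u"
  by (simp add: minus_eq)

lemma subspaceI:
  assumes "V \<subseteq> carrier L" "\<zero> \<in> V" "\<And>u w. u \<in> V \<Longrightarrow> w \<in> V \<Longrightarrow> u \<oplus> w \<in> V"
    and "\<And>c u. u \<in> V \<Longrightarrow> c \<odot> u \<in> V"
  shows "subspace class_ring V L"
  using assms vectorspace_axioms module_axioms by (simp add: subspace_def submodule_def)

lemma subspaceD:
  assumes "subspace class_ring V L"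
  shows "V \<subseteq> carrier L" "\<zero> \<in> V" "\<And>u w. u \<in> V \<Longrightarrow> w \<in> V \<Longrightarrow> u \<oplus> w \<in> V"
    and "\<And>c u. u \<in> V \<Longrightarrow> c \<odot> u \<in> V" "\<And>u w. u \<in> V \<Longrightarrow> w \<in> V \<Longrightarrow> u \<ominus> w \<in> V"
proof -
  show V: "V \<subseteq> carrier L" and "\<zero> \<in> V" and add: "\<And>u w. u \<in> V \<Longrightarrow> w \<in> V \<Longrightarrow> u \<oplus> w \<in> V"
    and scale: "\<And>c u. u \<in> V \<Longrightarrow> c \<odot> u \<in> V"
    using assms by (simp_all add: subspace_def submodule_def)
  fix u w assume "u \<in> V" "w \<in> V"
  then show "u \<ominus> w \<in> V" using add[OF _ scale[of w "- 1"]] V by (simp add: minus_eq neg_scale subset_iff)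
qed

end

locale lie_alg = lie_superalgebra L for L :: "'a lie_super" (structure)

sublocale lie_alg \<subseteq> complex_vs L ..

context lie_alg
begin

lemma part_carrier [simp, intro]: "u \<in> part L i \<Longrightarrow> u \<in> carrier L"
  using subspaceD(1)[OF part_subspace] by blast

lemmas part_zero [simp] = subspaceD(2)[OF part_subspace]
lemmas part_add [intro] = subspaceD(3)[OF part_subspace]
lemmas part_scale [intro] = subspaceD(4)[OF part_subspace]
lemmas part_minus [intro] = subspaceD(5)[OF part_subspace]

declare brk_closed [simp, intro]

lemma brk_zero_left [simp]: "w \<in> carrier L \<Longrightarrow> brk L \<zero> w = \<zero>"
  using brk_smult_left[of \<zero> w 0] by simp

lemma brk_zero_right [simp]: "u \<in> carrier L \<Longrightarrow> brk L u \<zero> = \<zero>"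
  using brk_smult_right[of u \<zero> 0] by simp

lemma brk_minus_left:
  "\<lbrakk>u \<in> carrier L; u' \<in> carrier L; w \<in> carrier L\<rbrakk> \<Longrightarrow> brk L (u \<ominus> u') w = brk L u w \<ominus> brk L u' w"
  by (simp add: minus_eq neg_scale brk_add_left brk_smult_left)

lemma brk_minus_right:
  "\<lbrakk>u \<in> carrier L; w \<in> carrier L; w' \<in> carrier L\<rbrakk> \<Longrightarrow> brk L u (w \<ominus> w') = brk L u w \<ominus> brk L u w'"
  by (simp add: minus_eq neg_scale brk_add_right brk_smult_right)

lemma part_zeroI: "u \<in> part L 0 \<Longrightarrow> u \<in> part L 1 \<Longrightarrow> u = \<zero>"
  using part_disjoint by blast

lemma part_unique:
  assumes "u0 \<in> part L 0" "w0 \<in> part L 0" "u1 \<in> part L 1" "w1 \<in> part L 1"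
    and "u0 \<oplus> u1 = w0 \<oplus> w1"
  shows "u0 = w0" "u1 = w1"
proof -
  have c: "u0 \<in> carrier L" "u1 \<in> carrier L" "w0 \<in> carrier L" "w1 \<in> carrier L"
    using assms by auto
  have eq: "u0 \<ominus> w0 = w1 \<ominus> u1" using c assms(5) by (simp add: diff_simps)
  have "u0 \<ominus> w0 \<in> part L 0" "w1 \<ominus> u1 \<in> part L 1" using assms by auto
  then have "u0 \<ominus> w0 = \<zero>" "w1 \<ominus> u1 = \<zero>" using eq part_zeroI by auto
  then show "u0 = w0" "u1 = w1" using c by (auto simp: minus_eq_zero_iff)
qed

lemma idealD:
  assumes "lie_ideal I L"
  shows "subspace class_ring I L" "I \<subseteq> carrier L" "\<zero> \<in> I"
    and "\<And>u w. u \<in> I \<Longrightarrow> w \<in> I \<Longrightarrow> u \<oplus> w \<in> I" "\<And>c u. u \<in> I \<Longrightarrow> c \<odot> u \<in> I"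
    and "\<And>u w. u \<in> I \<Longrightarrow> w \<in> I \<Longrightarrow> u \<ominus> w \<in> I"
    and "\<And>u w. u \<in> carrier L \<Longrightarrow> w \<in> I \<Longrightarrow> brk L u w \<in> I"
    and "\<And>u w. u \<in> carrier L \<Longrightarrow> w \<in> I \<Longrightarrow> brk L w u \<in> I"
    and "\<And>w. w \<in> I \<Longrightarrow> \<exists>w0\<in>I \<inter> part L 0. \<exists>w1\<in>I \<inter> part L 1. w = w0 \<oplus> w1"
proof -
  have 1: "subspace class_ring I L"
    and 2: "\<And>u w. u \<in> carrier L \<Longrightarrow> w \<in> I \<Longrightarrow> brk L u w \<in> I \<and> brk L w u \<in> I"
    and 3: "\<And>w. w \<in> I \<Longrightarrow> \<exists>w0\<in>I \<inter> part L 0. \<exists>w1\<in>I \<inter> part L 1. w = w0 \<oplus> w1"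
    using assms unfolding lie_ideal_def by auto
  note 4 = subspaceD[OF 1]
  show "subspace class_ring I L" "I \<subseteq> carrier L" "\<zero> \<in> I" by (fact 1 4)+
  show "\<And>u w. u \<in> I \<Longrightarrow> w \<in> I \<Longrightarrow> u \<oplus> w \<in> I" "\<And>c u. u \<in> I \<Longrightarrow> c \<odot> u \<in> I"
    and "\<And>u w. u \<in> I \<Longrightarrow> w \<in> I \<Longrightarrow> u \<ominus> w \<in> I"
    by (fact 4)+
  show "\<And>u w. u \<in> carrier L \<Longrightarrow> w \<in> I \<Longrightarrow> brk L u w \<in> I"
    and "\<And>u w. u \<in> carrier L \<Longrightarrow> w \<in> I \<Longrightarrow> brk L w u \<in> I"
    using 2 by auto
  show "\<And>w. w \<in> I \<Longrightarrow> \<exists>w0\<in>I \<inter> part L 0. \<exists>w1\<in>I \<inter> part L 1. w = w0 \<oplus> w1" by (fact 3)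
qed

lemma carrier_is_ideal: "lie_ideal (carrier L) L"
  unfolding lie_ideal_def
proof (intro conjI)
  show "subspace class_ring (carrier L) L" by (rule subspaceI) auto
qed (use part_sum in fastforce)+

text \<open>Parity decompositions are unique, so the components promised by \<open>lie_ideal\<close>
  are the given ones. This is what makes gradedness survive intersections and preimages: one and the
  same pair serves every ideal.\<close>

lemma ideal_component:
  assumes I: "lie_ideal I L" and w: "w0 \<in> part L 0" "w1 \<in> part L 1" "w0 \<oplus> w1 \<in> I"
  shows "w0 \<in> I" "w1 \<in> I"
proof -
  obtain a b where ab: "a \<in> I" "a \<in> part L 0" "b \<in> I" "b \<in> part L 1" "w0 \<oplus> w1 = a \<oplus> b"
    using idealD(9)[OF I w(3)] by blast
  have "w0 = a" "w1 = b" using part_unique[OF w(1) ab(2) w(2) ab(4) ab(5)] by auto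
  then show "w0 \<in> I" "w1 \<in> I" using ab by auto
qed

lemma Inter_ideal:
  assumes "\<I> \<noteq> {}" and I: "\<And>I. I \<in> \<I> \<Longrightarrow> lie_ideal I L"
  shows "lie_ideal (\<Inter>\<I>) L"
  unfolding lie_ideal_def
proof (intro conjI ballI)
  show "subspace class_ring (\<Inter>\<I>) L"
  proof (rule subspaceI)
    show "\<Inter>\<I> \<subseteq> carrier L" using assms(1) idealD(2)[OF I] by blast
  qed (auto intro: idealD(3-5)[OF I])
  fix w assume w: "w \<in> \<Inter>\<I>"
  then have wc: "w \<in> carrier L" using assms(1) idealD(2)[OF I] by blast
  then obtain w0 w1 where *: "w0 \<in> part L 0" "w1 \<in> part L 1" "w = w0 \<oplus> w1"
    using part_sum by blast
  then have "w0 \<in> \<Inter>\<I>" "w1 \<in> \<Inter>\<I>" using ideal_component[OF I] w by auto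
  with * show "\<exists>w0\<in>\<Inter>\<I> \<inter> part L 0. \<exists>w1\<in>\<Inter>\<I> \<inter> part L 1. w = w0 \<oplus> w1" by blast
next
  fix u w assume "u \<in> carrier L" "w \<in> \<Inter>\<I>"
  then show "brk L u w \<in> \<Inter>\<I>" "brk L w u \<in> \<Inter>\<I>"
    by (auto intro: idealD(7,8)[OF I])
qed

end

lemma (in lie_alg) lie_ideal_gen_props:
  assumes S: "S \<subseteq> carrier L"
  shows "lie_ideal (lie_ideal_gen L S) L" "S \<subseteq> lie_ideal_gen L S"
proof -
  have "carrier L \<in> {I. lie_ideal I L \<and> S \<subseteq> I}" using carrier_is_ideal S by simp
  then show "lie_ideal (lie_ideal_gen L S) L"
    unfolding lie_ideal_gen_def by (intro Inter_ideal) blast+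
qed (auto simp: lie_ideal_gen_def)

lemma lie_ideal_gen_least: "lie_ideal I L \<Longrightarrow> S \<subseteq> I \<Longrightarrow> lie_ideal_gen L S \<subseteq> I"
  unfolding lie_ideal_gen_def by auto


subsection \<open>Homomorphisms\<close>

lemma lie_homD:
  assumes "f \<in> lie_hom L M"
  shows "lie_superalgebra L" "lie_superalgebra M"
    and "\<And>u. u \<in> carrier L \<Longrightarrow> f u \<in> carrier M"
    and "\<And>u w. u \<in> carrier L \<Longrightarrow> w \<in> carrier L \<Longrightarrow> f (u \<oplus>\<^bsub>L\<^esub> w) = f u \<oplus>\<^bsub>M\<^esub> f w"
    and "\<And>c u. u \<in> carrier L \<Longrightarrow> f (c \<odot>\<^bsub>L\<^esub> u) = c \<odot>\<^bsub>M\<^esub> f u"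
    and "\<And>u w. u \<in> carrier L \<Longrightarrow> w \<in> carrier L \<Longrightarrow> f (brk L u w) = brk M (f u) (f w)"
    and "\<And>u i. u \<in> part L i \<Longrightarrow> f u \<in> part M i"
    and "f \<zero>\<^bsub>L\<^esub> = \<zero>\<^bsub>M\<^esub>"
    and "\<And>u w. u \<in> carrier L \<Longrightarrow> w \<in> carrier L \<Longrightarrow> f (u \<ominus>\<^bsub>L\<^esub> w) = f u \<ominus>\<^bsub>M\<^esub> f w"
proof -
  show L: "lie_superalgebra L" and M: "lie_superalgebra M"
    and "\<And>u w. u \<in> carrier L \<Longrightarrow> w \<in> carrier L \<Longrightarrow> f (brk L u w) = brk M (f u) (f w)"
    and "\<And>u i. u \<in> part L i \<Longrightarrow> f u \<in> part M i"
    using assms unfolding lie_hom_def by auto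
  interpret linear_map class_ring L M f using assms unfolding lie_hom_def by auto
  show "\<And>u. u \<in> carrier L \<Longrightarrow> f u \<in> carrier M"
    and "\<And>u w. u \<in> carrier L \<Longrightarrow> w \<in> carrier L \<Longrightarrow> f (u \<oplus>\<^bsub>L\<^esub> w) = f u \<oplus>\<^bsub>M\<^esub> f w"
    and "\<And>c u. u \<in> carrier L \<Longrightarrow> f (c \<odot>\<^bsub>L\<^esub> u) = c \<odot>\<^bsub>M\<^esub> f u"
    and "f \<zero>\<^bsub>L\<^esub> = \<zero>\<^bsub>M\<^esub>"
    and "\<And>u w. u \<in> carrier L \<Longrightarrow> w \<in> carrier L \<Longrightarrow> f (u \<ominus>\<^bsub>L\<^esub> w) = f u \<ominus>\<^bsub>M\<^esub> f w"
    by simp_all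
qed

lemma lie_homI:
  assumes "lie_superalgebra L" "lie_superalgebra M"
    and "\<And>u. u \<in> carrier L \<Longrightarrow> f u \<in> carrier M"
    and "\<And>u w. u \<in> carrier L \<Longrightarrow> w \<in> carrier L \<Longrightarrow> f (u \<oplus>\<^bsub>L\<^esub> w) = f u \<oplus>\<^bsub>M\<^esub> f w"
    and "\<And>c u. u \<in> carrier L \<Longrightarrow> f (c \<odot>\<^bsub>L\<^esub> u) = c \<odot>\<^bsub>M\<^esub> f u"
    and "\<And>u w. u \<in> carrier L \<Longrightarrow> w \<in> carrier L \<Longrightarrow> f (brk L u w) = brk M (f u) (f w)"
    and "\<And>u i. u \<in> part L i \<Longrightarrow> f u \<in> part M i"
  shows "f \<in> lie_hom L M"
proof -
  interpret L: lie_alg L by (rule lie_alg.intro) fact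
  interpret M: lie_alg M by (rule lie_alg.intro) fact
  show ?thesis unfolding lie_hom_def linear_map_def mod_hom_def mod_hom_axioms_def module_hom_def
    using assms L.vectorspace_axioms M.vectorspace_axioms L.module_axioms M.module_axioms by auto
qed

lemma lie_hom_comp:
  assumes f: "f \<in> lie_hom L M" and g: "g \<in> lie_hom M N"
  shows "g \<circ> f \<in> lie_hom L N"
  by (rule lie_homI) (use lie_homD[OF f] lie_homD[OF g] in auto)

text \<open>\<open>lie_iso\<close> only says that \<open>f\<close> maps parts into parts. For the
  inverse, split the preimage of a homogeneous element: the image of the component of wrong parity
  is zero by uniqueness of decompositions, and injectivity removes it.\<close>

lemma lie_iso_inv:
  assumes f: "f \<in> lie_iso L M"
  shows "inv_into (carrier L) f \<in> lie_iso M L"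
proof -
  have h: "f \<in> lie_hom L M" and bij: "bij_betw f (carrier L) (carrier M)"
    using f unfolding lie_iso_def by auto
  interpret L: lie_alg L by (rule lie_alg.intro[OF lie_homD(1)[OF h]])
  interpret M: lie_alg M by (rule lie_alg.intro[OF lie_homD(2)[OF h]])
  let ?g = "inv_into (carrier L) f"
  have inj: "inj_on f (carrier L)" using bij by (rule bij_betw_imp_inj_on)
  have gc: "?g u \<in> carrier L" if "u \<in> carrier M" for u
    using that bij by (metis bij_betw_def inv_into_into)
  have fg: "f (?g u) = u" if "u \<in> carrier M" for u
    using that bij by (metis bij_betw_inv_into_right)
  have eqI: "?g u = w" if "w \<in> carrier L" "f w = u" for u w
    using that inj by (metis inv_into_f_f)
  have "?g \<in> lie_hom M L"
  proof (rule lie_homI)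
    fix u i assume u: "u \<in> part M i"
    then have uc: "u \<in> carrier M" by auto
    obtain w0 w1 where w: "w0 \<in> part L 0" "w1 \<in> part L 1" "?g u = w0 \<oplus>\<^bsub>L\<^esub> w1"
      using L.part_sum[OF gc[OF uc]] by blast
    have fu: "u = f w0 \<oplus>\<^bsub>M\<^esub> f w1" using fg[OF uc] w lie_homD(4)[OF h] by auto
    have fw: "f w0 \<in> part M 0" "f w1 \<in> part M 1" using lie_homD(7)[OF h] w by auto
    show "?g u \<in> part L i"
    proof (cases "i = 0")
      case True
      have "f w1 = \<zero>\<^bsub>M\<^esub>" using M.part_unique(2)[of u "f w0" "\<zero>\<^bsub>M\<^esub>" "f w1"] fw fu u True uc by auto
      then have "w1 = \<zero>\<^bsub>L\<^esub>" using inj w lie_homD(8)[OF h]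
        by (metis L.part_carrier L.zero_closed inj_onD)
      then show ?thesis using w True by auto
    next
      case False
      then have i: "i = 1" by simp
      have "f w0 = \<zero>\<^bsub>M\<^esub>" using M.part_unique(1)[of "\<zero>\<^bsub>M\<^esub>" "f w0" u "f w1"] fw fu u i uc by auto
      then have "w0 = \<zero>\<^bsub>L\<^esub>" using inj w lie_homD(8)[OF h]
        by (metis L.part_carrier L.zero_closed inj_onD)
      then show ?thesis using w i by auto
    qed
  qed (use gc fg eqI lie_homD[OF h] L.lie_superalgebra_axioms M.lie_superalgebra_axioms in \<open>auto intro!: eqI\<close>)
  then show ?thesis unfolding lie_iso_def using bij_betw_inv_into[OF bij] by auto
qed

lemma lie_hom_kernel_ideal:
  assumes f: "f \<in> lie_hom L M" and J: "lie_ideal J M"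
  shows "lie_ideal {u \<in> carrier L. f u \<in> J} L"
proof -
  interpret L: lie_alg L by (rule lie_alg.intro[OF lie_homD(1)[OF f]])
  interpret M: lie_alg M by (rule lie_alg.intro[OF lie_homD(2)[OF f]])
  note fD = lie_homD[OF f] and JD = M.idealD[OF J]
  show ?thesis
    unfolding lie_ideal_def
  proof (intro conjI)
    show "subspace class_ring {u \<in> carrier L. f u \<in> J} L"
      by (rule L.subspaceI) (use fD JD in auto)
    show "\<forall>u\<in>carrier L. \<forall>w\<in>{u \<in> carrier L. f u \<in> J}. brk L u w \<in> {u \<in> carrier L. f u \<in> J}
        \<and> brk L w u \<in> {u \<in> carrier L. f u \<in> J}"
      using fD JD by auto
    show "\<forall>w\<in>{u \<in> carrier L. f u \<in> J}. \<exists>w0\<in>{u \<in> carrier L. f u \<in> J} \<inter> part L 0.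
       \<exists>w1\<in>{u \<in> carrier L. f u \<in> J} \<inter> part L 1. w = w0 \<oplus>\<^bsub>L\<^esub> w1"
    proof
      fix w assume w: "w \<in> {u \<in> carrier L. f u \<in> J}"
      then obtain w0 w1 where *: "w0 \<in> part L 0" "w1 \<in> part L 1" "w = w0 \<oplus>\<^bsub>L\<^esub> w1"
        using L.part_sum by blast
      then have "f w0 \<oplus>\<^bsub>M\<^esub> f w1 \<in> J" using w fD by auto
      then have "f w0 \<in> J" "f w1 \<in> J"
        using M.ideal_component[OF J fD(7)[OF *(1)] fD(7)[OF *(2)]] by auto
      then show "\<exists>w0\<in>{u \<in> carrier L. f u \<in> J} \<inter> part L 0.
       \<exists>w1\<in>{u \<in> carrier L. f u \<in> J} \<inter> part L 1. w = w0 \<oplus>\<^bsub>L\<^esub> w1"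
        using * by (intro bexI[of _ w0] bexI[of _ w1]) auto
    qed
  qed
qed

lemma (in lie_alg) zero_is_ideal: "lie_ideal {\<zero>} L"
  unfolding lie_ideal_def
proof (intro conjI)
  show "subspace class_ring {\<zero>} L" by (rule subspaceI) auto
qed auto


subsection \<open>Quotients\<close>

text \<open>Every identity of \<open>Q\<close> is the image of one in \<open>L\<close>. Trivial
  intersection of the two parts is not an identity and does not pass to images, hence the separate
  hypothesis \<open>disj\<close>.\<close>

lemma surjective_image_lie_superalgebra:
  fixes L :: "'a lie_super" and Q :: "'b lie_super"
  assumes L: "lie_superalgebra L"
    and carr: "carrier Q = pr ` carrier L" and part: "\<And>i. part Q i = pr ` part L i"
    and zero: "\<zero>\<^bsub>Q\<^esub> = pr \<zero>\<^bsub>L\<^esub>"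
    and add: "\<And>u w. u \<in> carrier L \<Longrightarrow> w \<in> carrier L \<Longrightarrow> pr u \<oplus>\<^bsub>Q\<^esub> pr w = pr (u \<oplus>\<^bsub>L\<^esub> w)"
    and scale: "\<And>c u. u \<in> carrier L \<Longrightarrow> c \<odot>\<^bsub>Q\<^esub> pr u = pr (c \<odot>\<^bsub>L\<^esub> u)"
    and brk: "\<And>u w. u \<in> carrier L \<Longrightarrow> w \<in> carrier L \<Longrightarrow> brk Q (pr u) (pr w) = pr (brk L u w)"
    and disj: "\<And>u w. u \<in> part L 0 \<Longrightarrow> w \<in> part L 1 \<Longrightarrow> pr u = pr w \<Longrightarrow> pr u = pr \<zero>\<^bsub>L\<^esub>"
  shows "lie_superalgebra Q" "pr \<in> lie_hom L Q"
proof -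
  interpret L: lie_alg L by (rule lie_alg.intro) fact
  have vs: "vectorspace class_ring Q"
  proof (rule vs_criteria)
    show "field (class_ring :: complex ring)" by (rule class_field)
    show "\<forall>v\<in>carrier Q. \<exists>neg_v\<in>carrier Q. v \<oplus>\<^bsub>Q\<^esub> neg_v = \<zero>\<^bsub>Q\<^esub>"
    proof
      fix v assume "v \<in> carrier Q"
      then obtain u where u: "u \<in> carrier L" "v = pr u" using carr by auto
      have "v \<oplus>\<^bsub>Q\<^esub> pr (\<ominus>\<^bsub>L\<^esub> u) = \<zero>\<^bsub>Q\<^esub>" using u add zero L.r_neg by auto
      then show "\<exists>neg_v\<in>carrier Q. v \<oplus>\<^bsub>Q\<^esub> neg_v = \<zero>\<^bsub>Q\<^esub>" using u carr by auto
    qed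
  qed (auto simp: carr zero add scale L.a_ac L.scale_scale L.scale_add_left L.scale_add_right)
  then interpret Q: vectorspace class_ring Q .
  show Q: "lie_superalgebra Q"
  proof (intro lie_superalgebra.intro lie_superalgebra_axioms.intro vs)
    fix i
    have "module class_ring Q" by (rule Q.module_axioms)
    then show "subspace class_ring (part Q i) Q"
      using vs L.subspaceD[OF L.part_subspace[of i]]
      unfolding subspace_def submodule_def part
      by (auto simp: carr zero add scale intro!: imageI)
  next
    fix u assume "u \<in> carrier Q"
    then obtain w where w: "w \<in> carrier L" "u = pr w" using carr by auto
    obtain w0 w1 where "w0 \<in> part L 0" "w1 \<in> part L 1" "w = w0 \<oplus>\<^bsub>L\<^esub> w1"
      using L.part_sum[OF w(1)] by blast
    then show "\<exists>u0\<in>part Q 0. \<exists>u1\<in>part Q 1. u = u0 \<oplus>\<^bsub>Q\<^esub> u1"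
      using w by (auto simp: part add)
  next
    show "part Q 0 \<inter> part Q 1 = {\<zero>\<^bsub>Q\<^esub>}"
      using disj by (force simp: part zero)
  next
    fix u w i j assume "u \<in> part Q i" "w \<in> part Q j"
    then obtain a b where ab: "a \<in> part L i" "b \<in> part L j" "u = pr a" "w = pr b" by (auto simp: part)
    then show "brk Q u w \<in> part Q (i + j)" using L.brk_part by (auto simp: part brk)
    show "brk Q u w = (- super_sign i j) \<odot>\<^bsub>Q\<^esub> brk Q w u"
      using ab L.brk_skew[of a i b j] by (auto simp: brk scale)
    fix z assume "z \<in> carrier Q"
    then obtain c where c: "c \<in> carrier L" "z = pr c" by (auto simp: carr)
    show "brk Q u (brk Q w z)
        = brk Q (brk Q u w) z \<oplus>\<^bsub>Q\<^esub> super_sign i j \<odot>\<^bsub>Q\<^esub> brk Q w (brk Q u z)"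
      using ab c L.brk_jacobi[of a i b j c] by (auto simp: brk scale add)
  qed (auto simp: carr brk add scale L.brk_add_left L.brk_add_right L.brk_smult_left L.brk_smult_right)
  show "pr \<in> lie_hom L Q"
    by (rule lie_homI) (use L Q in \<open>auto simp: carr part add scale brk\<close>)
qed

context lie_alg
begin

lemma coset_self: "lie_ideal I L \<Longrightarrow> u \<in> carrier L \<Longrightarrow> u \<in> I +> u"
  using idealD(3)[of I] by (force simp: a_r_coset_def r_coset_def)

lemma coset_mem_iff:
  assumes I: "lie_ideal I L" and "u \<in> carrier L"
  shows "w \<in> I +> u \<longleftrightarrow> w \<in> carrier L \<and> w \<ominus> u \<in> I"
proof
  assume "w \<in> I +> u"
  then obtain i where i: "i \<in> I" "w = i \<oplus> u" by (auto simp: a_r_coset_def r_coset_def)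
  moreover have "i \<in> carrier L" using idealD(2)[OF I] i by auto
  moreover have "i \<oplus> u \<ominus> u = i" using \<open>i \<in> carrier L\<close> assms(2) by (simp add: diff_simps)
  ultimately show "w \<in> carrier L \<and> w \<ominus> u \<in> I" using assms(2) by auto
next
  assume w: "w \<in> carrier L \<and> w \<ominus> u \<in> I"
  then have "w = (w \<ominus> u) \<oplus> u" using assms by (simp add: diff_simps)
  then show "w \<in> I +> u" using w by (auto simp: a_r_coset_def r_coset_def)
qed

lemma coset_eq_iff:
  assumes I: "lie_ideal I L" and u: "u \<in> carrier L" and w: "w \<in> carrier L"
  shows "I +> u = I +> w \<longleftrightarrow> u \<ominus> w \<in> I"
proof
  assume "I +> u = I +> w"
  then show "u \<ominus> w \<in> I" using coset_mem_iff[OF I w, of u] coset_self[OF I u] by auto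
next
  assume d: "u \<ominus> w \<in> I"
  have "z \<ominus> u \<in> I \<longleftrightarrow> z \<ominus> w \<in> I" if z: "z \<in> carrier L" for z
  proof -
    have 1: "z \<ominus> w = (z \<ominus> u) \<oplus> (u \<ominus> w)" "z \<ominus> u = (z \<ominus> w) \<ominus> (u \<ominus> w)"
      using u w z by (simp_all add: diff_simps)
    then show ?thesis using idealD(4,6)[OF I] d by metis
  qed
  then show "I +> u = I +> w" using coset_mem_iff[OF I] u w by blast
qed

lemma quot_carrier: "carrier (lie_quot L I) = (\<lambda>u. I +> u) ` carrier L"
  by (auto simp: lie_quot_def A_RCOSETS_def RCOSETS_def a_r_coset_def)

lemma quot_add:
  assumes I: "lie_ideal I L" and u: "u \<in> carrier L" and w: "w \<in> carrier L"
  shows "(I +> u) \<oplus>\<^bsub>lie_quot L I\<^esub> (I +> w) = I +> (u \<oplus> w)"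
proof -
  have "set_add L (I +> u) (I +> w) = (\<Union>a\<in>I +> u. \<Union>b\<in>I +> w. {a \<oplus> b})"
    by (auto simp: set_add_def set_mult_def)
  also have "\<dots> = I +> (u \<oplus> w)"
  proof (intro subset_antisym subsetI)
    fix z assume "z \<in> (\<Union>a\<in>I +> u. \<Union>b\<in>I +> w. {a \<oplus> b})"
    then obtain a b where ab: "a \<in> carrier L" "a \<ominus> u \<in> I" "b \<in> carrier L" "b \<ominus> w \<in> I" "z = a \<oplus> b"
      using coset_mem_iff[OF I] u w by auto
    have "z \<ominus> (u \<oplus> w) = (a \<ominus> u) \<oplus> (b \<ominus> w)" using ab u w by (simp add: diff_simps)
    then show "z \<in> I +> (u \<oplus> w)" using ab u w idealD(4)[OF I] coset_mem_iff[OF I] by simp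
  next
    fix z assume z: "z \<in> I +> (u \<oplus> w)"
    then have z: "z \<in> carrier L" "z \<ominus> (u \<oplus> w) \<in> I" using coset_mem_iff[OF I] u w by auto
    have "z = (z \<ominus> w) \<oplus> w" using z w by (simp add: diff_simps)
    moreover have "(z \<ominus> w) \<ominus> u = z \<ominus> (u \<oplus> w)" using z u w by (simp add: diff_simps)
    ultimately show "z \<in> (\<Union>a\<in>I +> u. \<Union>b\<in>I +> w. {a \<oplus> b})"
      using coset_mem_iff[OF I u, of "z \<ominus> w"] coset_self[OF I w] z w by auto
  qed
  finally show ?thesis by (simp add: lie_quot_def)
qed

lemma quot_smult:
  assumes I: "lie_ideal I L" and u: "u \<in> carrier L"
  shows "c \<odot>\<^bsub>lie_quot L I\<^esub> (I +> u) = I +> (c \<odot> u)"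
proof -
  have eq: "I +> (c \<odot> a) = I +> (c \<odot> u)" if "a \<in> I +> u" for a
  proof -
    have a: "a \<in> carrier L" "a \<ominus> u \<in> I" using that coset_mem_iff[OF I u] by auto
    have "c \<odot> a \<ominus> c \<odot> u \<in> I"
      using idealD(5)[OF I a(2), of c] a u scale_minus_right by simp
    then show ?thesis using coset_eq_iff[OF I] a u by auto
  qed
  have "(\<Union>a\<in>I +> u. I +> (c \<odot> a)) = I +> (c \<odot> u)"
    by (rule SUP_eq_const) (use coset_self[OF I u] eq in blast)+
  then show ?thesis by (simp add: lie_quot_def)
qed

lemma quot_brk:
  assumes I: "lie_ideal I L" and u: "u \<in> carrier L" and w: "w \<in> carrier L"
  shows "brk (lie_quot L I) (I +> u) (I +> w) = I +> brk L u w"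
proof -
  have eq: "I +> brk L a b = I +> brk L u w" if "a \<in> I +> u" "b \<in> I +> w" for a b
  proof -
    have a: "a \<in> carrier L" "a \<ominus> u \<in> I" using that coset_mem_iff[OF I u] by auto
    have b: "b \<in> carrier L" "b \<ominus> w \<in> I" using that coset_mem_iff[OF I w] by auto
    have "brk L a b \<ominus> brk L u w = brk L (a \<ominus> u) b \<oplus> brk L u (b \<ominus> w)"
      using a b u w by (simp add: brk_minus_left brk_minus_right diff_simps)
    then have "brk L a b \<ominus> brk L u w \<in> I" using idealD(4,7,8)[OF I] a b u w by auto
    then show ?thesis using coset_eq_iff[OF I] a b u w by auto
  qed
  have "(\<Union>a\<in>I +> u. \<Union>b\<in>I +> w. I +> brk L a b) = I +> brk L u w"
  proof (rule SUP_eq_const)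
    show "(\<Union>b\<in>I +> w. I +> brk L a b) = I +> brk L u w" if "a \<in> I +> u" for a
      by (rule SUP_eq_const) (use coset_self[OF I w] eq[OF that] in blast)+
  qed (use coset_self[OF I u] in blast)
  then show ?thesis by (simp add: lie_quot_def)
qed

lemma coset_zero: "lie_ideal I L \<Longrightarrow> I +> \<zero> = I"
  using idealD(2)[of I] by (force simp: a_r_coset_def r_coset_def)

lemma coset_eq_self_iff: "lie_ideal I L \<Longrightarrow> u \<in> carrier L \<Longrightarrow> I +> u = I \<longleftrightarrow> u \<in> I"
  using coset_eq_iff[of I u \<zero>] coset_zero[of I] by simp

end

lemma lie_quot_zero: "\<zero>\<^bsub>lie_quot L I\<^esub> = I"
  by (simp add: lie_quot_def)

lemma lie_quot:
  fixes L :: "'a lie_super"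
  assumes L: "lie_superalgebra L" and I: "lie_ideal I L"
  shows "lie_superalgebra (lie_quot L I)" "(\<lambda>u. I +>\<^bsub>L\<^esub> u) \<in> lie_hom L (lie_quot L I)"
proof -
  interpret L: lie_alg L by (rule lie_alg.intro) fact
  \<comment> \<open>If an even and an odd element are congruent, their difference lies in
    \<open>I\<close>, and gradedness of \<open>I\<close> puts the even one into \<open>I\<close> by
    itself.\<close>
  have disj: "I +>\<^bsub>L\<^esub> u = I +>\<^bsub>L\<^esub> \<zero>\<^bsub>L\<^esub>"
    if u: "u \<in> part L 0" and w: "w \<in> part L 1" and eq: "I +>\<^bsub>L\<^esub> u = I +>\<^bsub>L\<^esub> w" for u w
  proof -
    have "u \<oplus>\<^bsub>L\<^esub> ((- 1) \<odot>\<^bsub>L\<^esub> w) \<in> I"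
      using L.coset_eq_iff[OF I, of u w] u w eq by (auto simp: L.minus_eq L.neg_scale)
    then have "u \<in> I" using L.ideal_component(1)[OF I u] w by auto
    then show ?thesis using L.coset_eq_self_iff[OF I] u L.coset_zero[OF I] by auto
  qed
  note * = surjective_image_lie_superalgebra[where Q = "lie_quot L I" and pr = "\<lambda>u. I +>\<^bsub>L\<^esub> u",
      OF L L.quot_carrier _ _ _ _ _ disj]
  show "lie_superalgebra (lie_quot L I)"
    by (rule *(1)) (auto simp: L.quot_add[OF I] L.quot_smult[OF I] L.quot_brk[OF I] L.coset_zero[OF I] lie_quot_zero, simp_all add: lie_quot_def)
  show "(\<lambda>u. I +>\<^bsub>L\<^esub> u) \<in> lie_hom L (lie_quot L I)"
    by (rule *(2)) (auto simp: L.quot_add[OF I] L.quot_smult[OF I] L.quot_brk[OF I] L.coset_zero[OF I] lie_quot_zero, simp_all add: lie_quot_def)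
qed

lemma lie_quot_part: "part (lie_quot L I) i = (\<lambda>u. I +>\<^bsub>L\<^esub> u) ` part L i"
  by (simp add: lie_quot_def)

text \<open>The choice of representative is harmless once \<open>f\<close> kills \<open>I\<close>.
  The restriction to the carrier supplies the extensionality that \<open>root_lie_mor\<close>
  demands.\<close>

definition quot_lift :: "'a lie_super \<Rightarrow> ('a \<Rightarrow> 'b) \<Rightarrow> 'a set \<Rightarrow> 'a set \<Rightarrow> 'b" where
  "quot_lift L f I = (\<lambda>A\<in>carrier (lie_quot L I). f (SOME u. u \<in> A))"

lemma quot_lift:
  fixes L :: "'a lie_super"
  assumes I: "lie_ideal I L" and f: "f \<in> lie_hom L M" and ker: "\<And>u. u \<in> I \<Longrightarrow> f u = \<zero>\<^bsub>M\<^esub>"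
  shows "u \<in> carrier L \<Longrightarrow> quot_lift L f I (I +>\<^bsub>L\<^esub> u) = f u"
    and "quot_lift L f I \<in> lie_hom (lie_quot L I) M"
proof -
  interpret L: lie_alg L by (rule lie_alg.intro[OF lie_homD(1)[OF f]])
  interpret M: lie_alg M by (rule lie_alg.intro[OF lie_homD(2)[OF f]])
  note Q = lie_quot[OF L.lie_superalgebra_axioms I]
  interpret Q: lie_alg "lie_quot L I" by (rule lie_alg.intro[OF Q(1)])
  note fD = lie_homD[OF f] and qD = lie_homD[OF Q(2)]
  have *: "quot_lift L f I (I +>\<^bsub>L\<^esub> u) = f u" if u: "u \<in> carrier L" for u
  proof -
    define w where "w = (SOME w. w \<in> I +>\<^bsub>L\<^esub> u)"
    have "w \<in> I +>\<^bsub>L\<^esub> u" unfolding w_def using L.coset_self[OF I u] by (rule someI)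
    then have w: "w \<in> carrier L" "w \<ominus>\<^bsub>L\<^esub> u \<in> I" using L.coset_mem_iff[OF I u] by auto
    then have "f w \<ominus>\<^bsub>M\<^esub> f u = \<zero>\<^bsub>M\<^esub>" using fD(9)[OF w(1) u] ker by simp
    then have "f w = f u" using M.minus_eq_zero_iff fD(3) w u by simp
    then show ?thesis unfolding quot_lift_def w_def using u L.quot_carrier by auto
  qed
  then show "u \<in> carrier L \<Longrightarrow> quot_lift L f I (I +>\<^bsub>L\<^esub> u) = f u" .
  show "quot_lift L f I \<in> lie_hom (lie_quot L I) M"
    by (rule lie_homI)
      (use fD in \<open>auto simp: Q(1) L.quot_carrier L.quot_add[OF I] L.quot_smult[OF I] L.quot_brk[OF I]
         lie_quot_part *\<close>)
qed


section \<open>Presented Lie superalgebras\<close>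

primrec lie_eval :: "'a lie_super \<Rightarrow> ('g \<Rightarrow> 'a) \<Rightarrow> 'g lie_term \<Rightarrow> 'a" where
  "lie_eval M f (Gen g) = f g"
| "lie_eval M f Zero = \<zero>\<^bsub>M\<^esub>"
| "lie_eval M f (Plus s t) = lie_eval M f s \<oplus>\<^bsub>M\<^esub> lie_eval M f t"
| "lie_eval M f (Scale c t) = c \<odot>\<^bsub>M\<^esub> lie_eval M f t"
| "lie_eval M f (Brk s t) = brk M (lie_eval M f s) (lie_eval M f t)"

section \<open>The parity automorphism of a presented superalgebra\<close>

definition par_sign :: "bit \<Rightarrow> complex" where
  "par_sign i = (if i = 1 then - 1 else 1)"

lemma par_sign_add: "par_sign (i + j) = par_sign i * par_sign j"
  by (cases i; cases j) (auto simp: par_sign_def)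

text \<open>The automorphism acting by \<open>1\<close> on even and by \<open>-1\<close> on odd
  elements, written on terms. It is the tool for separating even from odd classes, since a
  congruence class may contain terms of very different shape.\<close>

primrec parity_twist :: "('g \<Rightarrow> bit) \<Rightarrow> 'g lie_term \<Rightarrow> 'g lie_term" where
  "parity_twist par (Gen g) = Scale (par_sign (par g)) (Gen g)"
| "parity_twist par Zero = Zero"
| "parity_twist par (Plus s t) = Plus (parity_twist par s) (parity_twist par t)"
| "parity_twist par (Scale c t) = Scale c (parity_twist par t)"
| "parity_twist par (Brk s t) = Brk (parity_twist par s) (parity_twist par t)"

lemma lie_terms_simps [simp]:
  "Gen g \<in> lie_terms G \<longleftrightarrow> g \<in> G" "Zero \<in> lie_terms G"
  "Plus s t \<in> lie_terms G \<longleftrightarrow> s \<in> lie_terms G \<and> t \<in> lie_terms G"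
  "Scale c t \<in> lie_terms G \<longleftrightarrow> t \<in> lie_terms G"
  "Brk s t \<in> lie_terms G \<longleftrightarrow> s \<in> lie_terms G \<and> t \<in> lie_terms G"
  by (auto simp: lie_terms_def)

lemma parity_twist_terms [simp]: "parity_twist par t \<in> lie_terms G \<longleftrightarrow> t \<in> lie_terms G"
  by (induction t) auto

lemma parity_twist_homog: "homog par t i \<Longrightarrow> homog par (parity_twist par t) i"
proof (induction rule: homog.induct)
  case (5 s i t j)
  show ?case using homog.intros(5)[OF 5(3,4)] by (simp only: parity_twist.simps)
qed (simp_all add: homog.intros(1-4))

lemma lie_cong_terms: "(s, t) \<in> lie_cong G par R \<Longrightarrow> s \<in> lie_terms G \<and> t \<in> lie_terms G"
  by (induction rule: lie_cong.induct) auto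

lemma lie_cong_equiv: "equiv (lie_terms G) (lie_cong G par R)"
  using lie_cong_terms[of _ _ G par R]
  by (intro equivI refl_onI symI transI) (auto intro: lie_cong.intros)

text \<open>A relation between an even and an odd term would destroy the grading of the quotient;
  homogeneity is exactly what lets the parity automorphism respect the congruence.\<close>

locale presentation =
  fixes G :: "'g set" and par :: "'g \<Rightarrow> bit" and R :: "('g lie_term \<times> 'g lie_term) set"
  assumes homogeneous: "\<lbrakk>(s, t) \<in> R; s \<in> lie_terms G; t \<in> lie_terms G\<rbrakk>
      \<Longrightarrow> \<exists>i. homog par s i \<and> homog par t i"
begin

definition cls :: "'g lie_term \<Rightarrow> 'g lie_term set" where
  "cls t = lie_cong G par R `` {t}"

abbreviation P :: "'g lie_term set lie_super" where
  "P \<equiv> presented_lie G par R"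

lemma cls_eq_iff: "s \<in> lie_terms G \<Longrightarrow> t \<in> lie_terms G \<Longrightarrow> cls s = cls t \<longleftrightarrow> (s, t) \<in> lie_cong G par R"
  unfolding cls_def by (rule eq_equiv_class_iff[OF lie_cong_equiv])

lemma cls_eqI: "(s, t) \<in> lie_cong G par R \<Longrightarrow> cls s = cls t"
  using cls_eq_iff lie_cong_terms by blast

lemma cls_self: "t \<in> lie_terms G \<Longrightarrow> t \<in> cls t"
  unfolding cls_def by (auto intro: lie_cong.refl)

lemma in_cls: "s \<in> cls t \<Longrightarrow> s \<in> lie_terms G \<and> cls s = cls t"
  unfolding cls_def using lie_cong_terms equiv_class_eq[OF lie_cong_equiv] by blast

lemma cls_rep: "t \<in> lie_terms G \<Longrightarrow> s \<in> cls t \<Longrightarrow> (s, t) \<in> lie_cong G par R"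
  using in_cls cls_eq_iff by blast

lemma P_carrier: "carrier P = cls ` lie_terms G"
  by (auto simp: presented_lie_def Let_def quotient_def cls_def)

lemma P_part: "part P i = cls ` {t \<in> lie_terms G. homog par t i}"
  by (auto simp: presented_lie_def Let_def cls_def)

lemma P_zero: "\<zero>\<^bsub>P\<^esub> = cls Zero"
  by (simp add: presented_lie_def Let_def cls_def)

lemma P_add:
  assumes "s \<in> lie_terms G" "t \<in> lie_terms G"
  shows "cls s \<oplus>\<^bsub>P\<^esub> cls t = cls (Plus s t)"
proof -
  have "(\<Union>a\<in>cls s. \<Union>b\<in>cls t. cls (Plus a b)) = cls (Plus s t)"
  proof (rule SUP_eq_const)
    fix a assume a: "a \<in> cls s"
    show "(\<Union>b\<in>cls t. cls (Plus a b)) = cls (Plus s t)"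
      by (rule SUP_eq_const)
        (use cls_self assms cls_rep a in \<open>auto intro!: cls_eqI lie_cong.cong_plus\<close>)
  qed (use cls_self assms in blast)
  then show ?thesis by (simp add: presented_lie_def Let_def cls_def)
qed

lemma P_brk:
  assumes "s \<in> lie_terms G" "t \<in> lie_terms G"
  shows "brk P (cls s) (cls t) = cls (Brk s t)"
proof -
  have "(\<Union>a\<in>cls s. \<Union>b\<in>cls t. cls (Brk a b)) = cls (Brk s t)"
  proof (rule SUP_eq_const)
    fix a assume a: "a \<in> cls s"
    show "(\<Union>b\<in>cls t. cls (Brk a b)) = cls (Brk s t)"
      by (rule SUP_eq_const)
        (use cls_self assms cls_rep a in \<open>auto intro!: cls_eqI lie_cong.cong_brk\<close>)
  qed (use cls_self assms in blast)
  then show ?thesis by (simp add: presented_lie_def Let_def cls_def)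
qed

lemma P_smult:
  assumes "t \<in> lie_terms G"
  shows "c \<odot>\<^bsub>P\<^esub> cls t = cls (Scale c t)"
proof -
  have "(\<Union>b\<in>cls t. cls (Scale c b)) = cls (Scale c t)"
    by (rule SUP_eq_const)
      (use cls_self assms cls_rep in \<open>auto intro!: cls_eqI lie_cong.cong_scale\<close>)
  then show ?thesis by (simp add: presented_lie_def Let_def cls_def)
qed

lemma P_vectorspace: "vectorspace class_ring P"
proof (rule vs_criteria)
  show "field (class_ring :: complex ring)" by (rule class_field)
  show "\<forall>v\<in>carrier P. \<exists>neg_v\<in>carrier P. v \<oplus>\<^bsub>P\<^esub> neg_v = \<zero>\<^bsub>P\<^esub>"
  proof
    fix v assume "v \<in> carrier P"
    then obtain t where t: "t \<in> lie_terms G" "v = cls t" by (auto simp: P_carrier)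
    have "cls (Plus (Scale 1 t) (Scale (- 1) t)) = cls (Scale (1 + - 1) t)"
      using t by (intro cls_eqI[symmetric] lie_cong.scale_add)
    moreover have "cls (Scale (1 + - 1) t) = cls Zero"
      using lie_cong.scale_zero[OF t(1)] by (intro cls_eqI) simp
    moreover have "cls (Scale 1 t) = cls t" using t by (intro cls_eqI lie_cong.scale_one)
    ultimately have "v \<oplus>\<^bsub>P\<^esub> cls (Scale (- 1) t) = \<zero>\<^bsub>P\<^esub>"
      using t by (simp add: P_zero flip: P_add)
    then show "\<exists>neg_v\<in>carrier P. v \<oplus>\<^bsub>P\<^esub> neg_v = \<zero>\<^bsub>P\<^esub>" using t by (auto simp: P_carrier)
  qed
  show "\<forall>v\<in>carrier P. v \<oplus>\<^bsub>P\<^esub> \<zero>\<^bsub>P\<^esub> = v"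
  proof
    fix v assume "v \<in> carrier P"
    then obtain t where t: "t \<in> lie_terms G" "v = cls t" by (auto simp: P_carrier)
    have "cls (Plus t Zero) = cls (Plus Zero t)" using t by (intro cls_eqI lie_cong.plus_comm) auto
    also have "\<dots> = cls t" using t by (intro cls_eqI lie_cong.plus_zero)
    finally show "v \<oplus>\<^bsub>P\<^esub> \<zero>\<^bsub>P\<^esub> = v" using t by (simp add: P_zero P_add)
  qed
qed (auto simp: P_carrier P_zero P_add P_smult cls_eq_iff
      lie_cong.plus_comm lie_cong.plus_assoc lie_cong.scale_one
      lie_cong.scale_add lie_cong.scale_plus lie_cong.scale_scale[THEN lie_cong.sym]
      del: equalityI)

sublocale P: vectorspace class_ring P
  by (rule P_vectorspace)

lemma cls_parity_twist:
  "homog par t i \<Longrightarrow> t \<in> lie_terms G \<Longrightarrow> cls (parity_twist par t) = par_sign i \<odot>\<^bsub>P\<^esub> cls t"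
proof (induction rule: homog.induct)
  case (1 g)
  then show ?case by (simp add: P_smult)
next
  case (2 i)
  have "cls (Scale (par_sign i) Zero) = cls (Scale (par_sign i) (Scale 0 Zero))"
    by (intro cls_eqI lie_cong.cong_scale lie_cong.scale_zero[THEN lie_cong.sym]) auto
  also have "\<dots> = cls (Scale (par_sign i * 0) Zero)" by (intro cls_eqI lie_cong.scale_scale) auto
  also have "\<dots> = cls (Scale 0 Zero)" by simp
  also have "\<dots> = cls Zero" by (intro cls_eqI lie_cong.scale_zero) auto
  finally show ?case by (simp add: P_smult)
next
  case (3 s i t)
  then have "cls (parity_twist par (Plus s t)) = cls (Plus (Scale (par_sign i) s) (Scale (par_sign i) t))"
    by (simp add: P_smult flip: P_add)
  also have "\<dots> = cls (Scale (par_sign i) (Plus s t))"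
    using 3 by (intro cls_eqI[symmetric] lie_cong.scale_plus) auto
  finally show ?case using 3 by (simp add: P_smult)
next
  case (4 t i c)
  then have "cls (parity_twist par (Scale c t)) = cls (Scale c (Scale (par_sign i) t))"
    by (simp add: P_smult flip: P_smult[of "parity_twist par t"])
  also have "\<dots> = cls (Scale (c * par_sign i) t)"
    using 4 by (intro cls_eqI lie_cong.scale_scale) auto
  also have "\<dots> = cls (Scale (par_sign i) (Scale c t))"
    using 4 by (subst mult.commute, intro cls_eqI[symmetric] lie_cong.scale_scale) auto
  finally show ?case using 4 by (simp add: P_smult)
next
  case (5 s i t j)
  then have "cls (parity_twist par (Brk s t)) = cls (Brk (Scale (par_sign i) s) (Scale (par_sign j) t))"
    by (simp add: P_smult flip: P_brk)
  also have "\<dots> = cls (Scale (par_sign i) (Brk s (Scale (par_sign j) t)))"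
    using 5 by (intro cls_eqI lie_cong.brk_scale_left) auto
  also have "\<dots> = cls (Scale (par_sign i) (Scale (par_sign j) (Brk s t)))"
    using 5 by (intro cls_eqI lie_cong.cong_scale lie_cong.brk_scale_right) auto
  also have "\<dots> = cls (Scale (par_sign i * par_sign j) (Brk s t))"
    using 5 by (intro cls_eqI lie_cong.scale_scale) auto
  finally show ?case using 5 by (simp only: par_sign_add P_smult lie_terms_simps)
qed

text \<open>Both sides of a homogeneous relation are multiplied by the same sign. The skew and
  Jacobi rules are preserved because twisting a term keeps its parity.\<close>

lemma parity_twist_cong:
  "(s, t) \<in> lie_cong G par R \<Longrightarrow> (parity_twist par s, parity_twist par t) \<in> lie_cong G par R"
proof (induction rule: lie_cong.induct)
  case (rel s t)
  then obtain i where "homog par s i" "homog par t i" using homogeneous by blast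
  then have "cls (parity_twist par s) = par_sign i \<odot>\<^bsub>P\<^esub> cls s"
    "cls (parity_twist par t) = par_sign i \<odot>\<^bsub>P\<^esub> cls t"
    using cls_parity_twist rel by auto
  moreover have "cls s = cls t" using rel by (intro cls_eqI lie_cong.rel)
  ultimately show ?case using rel by (simp flip: cls_eq_iff)
next
  case (skew s t i j)
  then show ?case using lie_cong.skew[of "parity_twist par s" G "parity_twist par t" par i j R]
    by (auto intro: parity_twist_homog)
next
  case (jacobi s t u i j)
  then show ?case
    using lie_cong.jacobi[of "parity_twist par s" G "parity_twist par t" "parity_twist par u" par i j R]
    by (auto intro: parity_twist_homog)
qed (auto intro: lie_cong.intros)

text \<open>Twisting an even and an odd representative of the same class gives
  \<open>u = - u\<close>, and 2 is invertible.\<close>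

lemma P_part_disjoint: "part P 0 \<inter> part P 1 = {\<zero>\<^bsub>P\<^esub>}"
proof -
  have "u = \<zero>\<^bsub>P\<^esub>" if u: "u \<in> part P 0" "u \<in> part P 1" for u
  proof -
    obtain s t where s: "s \<in> lie_terms G" "homog par s 0" "u = cls s"
      and t: "t \<in> lie_terms G" "homog par t 1" "u = cls t"
      using u by (auto simp: P_part)
    have "cls (parity_twist par s) = cls (parity_twist par t)"
      using s t by (intro cls_eqI parity_twist_cong) (simp flip: cls_eq_iff)
    then have "1 \<odot>\<^bsub>P\<^esub> u = (- 1) \<odot>\<^bsub>P\<^esub> u"
      using cls_parity_twist[OF s(2,1)] cls_parity_twist[OF t(2,1)] s t
      by (simp add: par_sign_def)
    moreover have uc: "u \<in> carrier P" using s by (auto simp: P_carrier)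
    ultimately have "1 \<odot>\<^bsub>P\<^esub> u \<oplus>\<^bsub>P\<^esub> 1 \<odot>\<^bsub>P\<^esub> u = (- 1) \<odot>\<^bsub>P\<^esub> u \<oplus>\<^bsub>P\<^esub> 1 \<odot>\<^bsub>P\<^esub> u"
      by simp
    then have "(1 + 1) \<odot>\<^bsub>P\<^esub> u = (- 1 + 1) \<odot>\<^bsub>P\<^esub> u"
      using P.smult_l_distr[of 1 1 u] P.smult_l_distr[of "- 1" 1 u] uc by simp
    then have "2 \<odot>\<^bsub>P\<^esub> u = \<zero>\<^bsub>P\<^esub>" using P.lmult_0[OF uc] by simp
    then have "(1/2) \<odot>\<^bsub>P\<^esub> (2 \<odot>\<^bsub>P\<^esub> u) = \<zero>\<^bsub>P\<^esub>" using P.rmult_0 by simp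
    moreover have "(1/2) \<odot>\<^bsub>P\<^esub> (2 \<odot>\<^bsub>P\<^esub> u) = ((1/2) * 2) \<odot>\<^bsub>P\<^esub> u"
      using P.smult_assoc1[of "1/2" 2 u] uc by simp
    moreover have "1 \<odot>\<^bsub>P\<^esub> u = u" using P.smult_one[OF uc] by simp
    ultimately show ?thesis by simp
  qed
  moreover have "\<zero>\<^bsub>P\<^esub> \<in> part P i" for i by (auto simp: P_part P_zero intro: homog.intros)
  ultimately show ?thesis by blast
qed

lemma homogeneous_decomposition:
  "t \<in> lie_terms G \<Longrightarrow> \<exists>s0\<in>lie_terms G. \<exists>s1\<in>lie_terms G.
     homog par s0 0 \<and> homog par s1 1 \<and> cls t = cls s0 \<oplus>\<^bsub>P\<^esub> cls s1"
proof (induction t)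
  case (Gen g)
  have c: "cls (Gen g) \<in> carrier P" using Gen by (auto simp: P_carrier)
  show ?case
  proof (cases "par g = 0")
    case True
    have "homog par (Gen g) 0" using homog.intros(1)[of par g] by (simp only: True)
    moreover have "cls (Gen g) = cls (Gen g) \<oplus>\<^bsub>P\<^esub> cls Zero"
      by (simp only: P_zero[symmetric] P.r_zero[OF c])
    moreover have "homog par Zero 1" by (rule homog.intros)
    moreover have "Gen g \<in> lie_terms G" "Zero \<in> lie_terms G" using Gen by simp_all
    ultimately show ?thesis by blast
  next
    case False
    then have "par g = 1" by simp
    then have "homog par (Gen g) 1" using homog.intros(1)[of par g] by (simp only:)
    moreover have "cls (Gen g) = cls Zero \<oplus>\<^bsub>P\<^esub> cls (Gen g)"
      by (simp only: P_zero[symmetric] P.l_zero[OF c])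
    moreover have "homog par Zero 0" by (rule homog.intros)
    moreover have "Gen g \<in> lie_terms G" "Zero \<in> lie_terms G" using Gen by simp_all
    ultimately show ?thesis by blast
  qed
next
  case Zero
  have "cls Zero = cls Zero \<oplus>\<^bsub>P\<^esub> cls Zero" by (simp only: P_zero[symmetric] P.l_zero P.zero_closed)
  moreover have "homog par Zero i" for i by (rule homog.intros)
  moreover have "Zero \<in> lie_terms G" by simp
  ultimately show ?case by blast
next
  case (Plus s t)
  then obtain s0 s1 t0 t1 where *: "s0 \<in> lie_terms G" "s1 \<in> lie_terms G" "t0 \<in> lie_terms G" "t1 \<in> lie_terms G"
    "homog par s0 0" "homog par s1 1" "homog par t0 0" "homog par t1 1"
    "cls s = cls s0 \<oplus>\<^bsub>P\<^esub> cls s1" "cls t = cls t0 \<oplus>\<^bsub>P\<^esub> cls t1" by auto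
  have c: "cls s0 \<in> carrier P" "cls s1 \<in> carrier P" "cls t0 \<in> carrier P" "cls t1 \<in> carrier P"
    using * by (auto simp: P_carrier)
  have "cls (Plus s t) = cls s \<oplus>\<^bsub>P\<^esub> cls t" using Plus by (simp add: P_add)
  also have "\<dots> = (cls s0 \<oplus>\<^bsub>P\<^esub> cls t0) \<oplus>\<^bsub>P\<^esub> (cls s1 \<oplus>\<^bsub>P\<^esub> cls t1)"
    using c * by (simp add: P.a_ac)
  also have "\<dots> = cls (Plus s0 t0) \<oplus>\<^bsub>P\<^esub> cls (Plus s1 t1)" using * by (simp add: P_add)
  finally have "cls (Plus s t) = cls (Plus s0 t0) \<oplus>\<^bsub>P\<^esub> cls (Plus s1 t1)" .
  moreover have "homog par (Plus s0 t0) 0" "homog par (Plus s1 t1) 1"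
    using * by (auto intro: homog.intros(3))
  moreover have "Plus s0 t0 \<in> lie_terms G" "Plus s1 t1 \<in> lie_terms G" using * by simp_all
  ultimately show ?case by blast
next
  case (Scale c t)
  then obtain t0 t1 where *: "t0 \<in> lie_terms G" "t1 \<in> lie_terms G"
    "homog par t0 0" "homog par t1 1" "cls t = cls t0 \<oplus>\<^bsub>P\<^esub> cls t1" by auto
  have c: "cls t0 \<in> carrier P" "cls t1 \<in> carrier P" using * by (auto simp: P_carrier)
  have "cls (Scale c t) = c \<odot>\<^bsub>P\<^esub> cls t" using Scale by (simp add: P_smult)
  also have "\<dots> = c \<odot>\<^bsub>P\<^esub> cls t0 \<oplus>\<^bsub>P\<^esub> c \<odot>\<^bsub>P\<^esub> cls t1" using c * P.smult_r_distr by simp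
  also have "\<dots> = cls (Scale c t0) \<oplus>\<^bsub>P\<^esub> cls (Scale c t1)" using * by (simp add: P_smult)
  finally have "cls (Scale c t) = cls (Scale c t0) \<oplus>\<^bsub>P\<^esub> cls (Scale c t1)" .
  moreover have "homog par (Scale c t0) 0" "homog par (Scale c t1) 1"
    using * by (auto intro: homog.intros(4))
  moreover have "Scale c t0 \<in> lie_terms G" "Scale c t1 \<in> lie_terms G" using * by simp_all
  ultimately show ?case by blast
next
  case (Brk s t)
  then obtain s0 s1 t0 t1 where *: "s0 \<in> lie_terms G" "s1 \<in> lie_terms G" "t0 \<in> lie_terms G" "t1 \<in> lie_terms G"
    "homog par s0 0" "homog par s1 1" "homog par t0 0" "homog par t1 1"
    "cls s = cls s0 \<oplus>\<^bsub>P\<^esub> cls s1" "cls t = cls t0 \<oplus>\<^bsub>P\<^esub> cls t1" by auto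
  have c: "cls (Brk a b) \<in> carrier P" if "a \<in> {s0, s1}" "b \<in> {t0, t1}" for a b
    using * that by (auto simp: P_carrier)
  have "cls (Brk s t) = brk P (cls (Plus s0 s1)) (cls (Plus t0 t1))"
    using Brk * by (simp add: P_add flip: P_brk)
  also have "\<dots> = cls (Brk (Plus s0 s1) (Plus t0 t1))" using * by (simp add: P_brk)
  also have "\<dots> = cls (Plus (Brk s0 (Plus t0 t1)) (Brk s1 (Plus t0 t1)))"
    using * by (intro cls_eqI lie_cong.brk_plus_left) auto
  also have "\<dots> = cls (Plus (Plus (Brk s0 t0) (Brk s0 t1)) (Plus (Brk s1 t0) (Brk s1 t1)))"
    using * by (intro cls_eqI lie_cong.cong_plus lie_cong.brk_plus_right) auto
  also have "\<dots> = (cls (Brk s0 t0) \<oplus>\<^bsub>P\<^esub> cls (Brk s1 t1)) \<oplus>\<^bsub>P\<^esub> (cls (Brk s0 t1) \<oplus>\<^bsub>P\<^esub> cls (Brk s1 t0))"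
    using * c by (simp add: P.a_ac flip: P_add)
  also have "\<dots> = cls (Plus (Brk s0 t0) (Brk s1 t1)) \<oplus>\<^bsub>P\<^esub> cls (Plus (Brk s0 t1) (Brk s1 t0))"
    using * by (simp add: P_add)
  finally have "cls (Brk s t)
      = cls (Plus (Brk s0 t0) (Brk s1 t1)) \<oplus>\<^bsub>P\<^esub> cls (Plus (Brk s0 t1) (Brk s1 t0))" .
  moreover have "homog par (Plus (Brk s0 t0) (Brk s1 t1)) 0"
    using homog.intros(5)[OF *(5,7)] homog.intros(5)[OF *(6,8)] by (auto intro: homog.intros(3))
  moreover have "homog par (Plus (Brk s0 t1) (Brk s1 t0)) 1"
    using homog.intros(5)[OF *(5,8)] homog.intros(5)[OF *(6,7)] by (auto intro: homog.intros(3))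
  moreover have "Plus (Brk s0 t0) (Brk s1 t1) \<in> lie_terms G"
    "Plus (Brk s0 t1) (Brk s1 t0) \<in> lie_terms G" using * by simp_all
  ultimately show ?case by blast
qed

lemma P_lie_superalgebra: "lie_superalgebra P"
proof (intro lie_superalgebra.intro lie_superalgebra_axioms.intro P_vectorspace)
  fix i
  have "submodule class_ring (part P i) P"
    using P.module_axioms unfolding submodule_def
    by (auto simp: P_part P_carrier P_add P_zero P_smult intro: homog.intros)
  then show "subspace class_ring (part P i) P"
    using P_vectorspace unfolding subspace_def by simp
next
  fix u assume "u \<in> carrier P"
  then obtain t where t: "t \<in> lie_terms G" "u = cls t" by (auto simp: P_carrier)
  then show "\<exists>u0\<in>part P 0. \<exists>u1\<in>part P 1. u = u0 \<oplus>\<^bsub>P\<^esub> u1"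
    using homogeneous_decomposition[OF t(1)] by (auto simp: P_part)
next
  show "part P 0 \<inter> part P 1 = {\<zero>\<^bsub>P\<^esub>}" by (rule P_part_disjoint)
next
  fix u w i j assume "u \<in> part P i" "w \<in> part P j"
  then obtain s t where st: "s \<in> lie_terms G" "t \<in> lie_terms G" "homog par s i" "homog par t j"
    "u = cls s" "w = cls t" by (auto simp: P_part)
  have "homog par (Brk s t) (i + j)" using st by (intro homog.intros)
  then show "brk P u w \<in> part P (i + j)" using st unfolding P_part by (simp add: P_brk)
  show "brk P u w = (- super_sign i j) \<odot>\<^bsub>P\<^esub> brk P w u"
    using st lie_cong.skew[of s G t par i j R] by (simp add: P_brk P_smult cls_eq_iff)
  fix z assume "z \<in> carrier P"
  then obtain r where "r \<in> lie_terms G" "z = cls r" by (auto simp: P_carrier)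
  then show "brk P u (brk P w z)
      = brk P (brk P u w) z \<oplus>\<^bsub>P\<^esub> super_sign i j \<odot>\<^bsub>P\<^esub> brk P w (brk P u z)"
    using st lie_cong.jacobi[of s G t r par i j R] by (simp add: P_brk P_smult P_add cls_eq_iff)
qed (auto simp: P_carrier P_brk P_smult P_add cls_eq_iff lie_cong.brk_plus_left
      lie_cong.brk_plus_right lie_cong.brk_scale_left lie_cong.brk_scale_right
      del: equalityI)

lemma P_induct [consumes 1, case_names gen zero add scale brk]:
  assumes "u \<in> carrier P"
    and gen: "\<And>g. g \<in> G \<Longrightarrow> Q (cls (Gen g))" and zero: "Q \<zero>\<^bsub>P\<^esub>"
    and add: "\<And>u w. \<lbrakk>u \<in> carrier P; w \<in> carrier P; Q u; Q w\<rbrakk> \<Longrightarrow> Q (u \<oplus>\<^bsub>P\<^esub> w)"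
    and scale: "\<And>c u. \<lbrakk>u \<in> carrier P; Q u\<rbrakk> \<Longrightarrow> Q (c \<odot>\<^bsub>P\<^esub> u)"
    and brk: "\<And>u w. \<lbrakk>u \<in> carrier P; w \<in> carrier P; Q u; Q w\<rbrakk> \<Longrightarrow> Q (brk P u w)"
  shows "Q u"
proof -
  have c: "t \<in> lie_terms G \<Longrightarrow> cls t \<in> carrier P" for t by (auto simp: P_carrier)
  have "t \<in> lie_terms G \<Longrightarrow> Q (cls t)" for t
  proof (induction t)
    case Zero then show ?case using zero by (simp add: P_zero)
  next
    case (Plus s t) then show ?case using add[OF c c] by (simp flip: P_add)
  next
    case (Scale a t) then show ?case using scale[OF c] by (simp flip: P_smult)
  next
    case (Brk s t) then show ?case using brk[OF c c] by (simp flip: P_brk)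
  qed (use gen in auto)
  then show ?thesis using assms(1) by (auto simp: P_carrier)
qed

theorem universal_property:
  fixes M :: "'a lie_super"
  assumes M: "lie_superalgebra M"
    and f: "\<And>g. g \<in> G \<Longrightarrow> f g \<in> part M (par g)"
    and rels: "\<And>s t. \<lbrakk>(s, t) \<in> R; s \<in> lie_terms G; t \<in> lie_terms G\<rbrakk>
        \<Longrightarrow> lie_eval M f s = lie_eval M f t"
  obtains \<Phi> where "\<Phi> \<in> lie_hom P M" "\<And>t. t \<in> lie_terms G \<Longrightarrow> \<Phi> (cls t) = lie_eval M f t"
proof -
  interpret M: lie_alg M by (rule lie_alg.intro) fact
  have closed: "t \<in> lie_terms G \<Longrightarrow> lie_eval M f t \<in> carrier M" for t
    by (induction t) (use f in auto)
  have parity: "homog par t i \<Longrightarrow> t \<in> lie_terms G \<Longrightarrow> lie_eval M f t \<in> part M i" for t i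
  proof (induction rule: homog.induct)
    case (5 s i t j)
    then show ?case using M.brk_part[of "lie_eval M f s" i "lie_eval M f t" j] by simp
  qed (auto simp: f)
  have "(s, t) \<in> lie_cong G par R \<Longrightarrow> lie_eval M f s = lie_eval M f t" for s t
  proof (induction rule: lie_cong.induct)
    case (skew s t i j)
    then show ?case using M.brk_skew parity by auto
  next
    case (jacobi s t u i j)
    then show ?case using M.brk_jacobi parity closed by auto
  qed (auto simp: rels closed M.a_ac M.scale_scale M.scale_add_left M.scale_add_right
      M.brk_add_left M.brk_add_right M.brk_smult_left M.brk_smult_right)
  then have eval_eq: "lie_eval M f s = lie_eval M f t" if "s \<in> cls t" for s t
    using that unfolding cls_def by auto
  define \<Phi> where "\<Phi> A = lie_eval M f (SOME t. t \<in> A)" for A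
  have \<Phi>: "\<Phi> (cls t) = lie_eval M f t" if t: "t \<in> lie_terms G" for t
    unfolding \<Phi>_def by (rule eval_eq, rule someI[of "\<lambda>x. x \<in> cls t", OF cls_self[OF t]])
  moreover have "\<Phi> \<in> lie_hom P M"
    by (rule lie_homI)
      (auto simp: P_lie_superalgebra M P_carrier P_part P_add P_smult P_brk \<Phi> closed parity)
  ultimately show ?thesis using that by blast
qed

end


section \<open>Weights\<close>

context lie_alg
begin

text \<open>The sign in \<open>brk_jacobi\<close> is 1 as soon as one of its two homogeneous
  arguments is even, so the other one may be split into parity components and reassembled.\<close>

lemma even_derivation:
  assumes h: "h \<in> part L 0" and u: "u \<in> carrier L" and w: "w \<in> carrier L"
  shows "brk L h (brk L u w) = brk L (brk L h u) w \<oplus> brk L u (brk L h w)"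
proof -
  obtain u0 u1 where *: "u0 \<in> part L 0" "u1 \<in> part L 1" "u = u0 \<oplus> u1"
    using part_sum[OF u] by blast
  have c: "u0 \<in> carrier L" "u1 \<in> carrier L" "h \<in> carrier L" using * h by auto
  have 1: "brk L h (brk L u0 w) = brk L (brk L h u0) w \<oplus> brk L u0 (brk L h w)"
    using brk_jacobi[OF h *(1) w] c w by (simp add: super_sign_def)
  have 2: "brk L h (brk L u1 w) = brk L (brk L h u1) w \<oplus> brk L u1 (brk L h w)"
    using brk_jacobi[OF h *(2) w] c w by (simp add: super_sign_def)
  show ?thesis unfolding *(3) using c w 1 2
    by (simp add: brk_add_left brk_add_right a_ac)
qed

text \<open>The linear span in inductive form: bracket computations then go by rule induction
  instead of by handling coefficient families.\<close>

inductive_set lspan :: "'a set \<Rightarrow> 'a set" for S where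
  base: "u \<in> S \<Longrightarrow> u \<in> lspan S"
| zero: "\<zero> \<in> lspan S"
| add: "u \<in> lspan S \<Longrightarrow> w \<in> lspan S \<Longrightarrow> u \<oplus> w \<in> lspan S"
| scale: "u \<in> lspan S \<Longrightarrow> c \<odot> u \<in> lspan S"

lemma lspan_carrier: "S \<subseteq> carrier L \<Longrightarrow> u \<in> lspan S \<Longrightarrow> u \<in> carrier L"
  by (rotate_tac 1, induction rule: lspan.induct) auto

lemma lspan_subspace: "S \<subseteq> carrier L \<Longrightarrow> subspace class_ring (lspan S) L"
  using lspan_carrier by (intro subspaceI) (auto intro: lspan.intros)

lemma lspan_least: "subspace class_ring V L \<Longrightarrow> S \<subseteq> V \<Longrightarrow> lspan S \<subseteq> V"
proof
  fix u assume V: "subspace class_ring V L" "S \<subseteq> V" and "u \<in> lspan S"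
  from this(3) show "u \<in> V"
    by (induction rule: lspan.induct) (use V subspaceD(2-4)[OF V(1)] in auto)
qed

lemma lspan_mono: "S \<subseteq> S' \<Longrightarrow> u \<in> lspan S \<Longrightarrow> u \<in> lspan S'"
  by (rotate_tac 1, induction rule: lspan.induct) (auto intro: lspan.intros)

lemma brk_lspan:
  assumes S: "S \<subseteq> carrier L" and V: "subspace class_ring V L" and x: "x \<in> carrier L"
    and base: "\<And>w. w \<in> S \<Longrightarrow> brk L x w \<in> V" and u: "u \<in> lspan S"
  shows "brk L x u \<in> V"
  using u
proof (induction rule: lspan.induct)
  case (add u w)
  then show ?case using lspan_carrier[OF S] x subspaceD(3)[OF V] by (simp add: brk_add_right)
next
  case (scale u c)
  then show ?case using lspan_carrier[OF S] x subspaceD(4)[OF V] by (simp add: brk_smult_right)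
qed (use base x subspaceD(2)[OF V] in auto)

lemma finsum_linear:
  assumes T: "\<And>u. u \<in> carrier L \<Longrightarrow> T u \<in> carrier L" "T \<zero> = \<zero>"
    and add: "\<And>u w. u \<in> carrier L \<Longrightarrow> w \<in> carrier L \<Longrightarrow> T (u \<oplus> w) = T u \<oplus> T w"
    and fin: "finite N" and c: "c \<in> N \<rightarrow> carrier L"
  shows "T (\<Oplus>k\<in>N. c k) = (\<Oplus>k\<in>N. T (c k))"
  using fin c
proof (induction rule: finite_induct)
  case (insert k N)
  have "T (finsum L c N) = (\<Oplus>k\<in>N. T (c k))" using insert by auto
  moreover have "(\<lambda>k. T (c k)) \<in> N \<rightarrow> carrier L" using T(1) insert(4) by auto
  moreover have "c k \<in> carrier L" "c \<in> N \<rightarrow> carrier L" using insert(4) by auto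
  ultimately show ?case using insert(1,2) by (simp add: T add)
qed (simp add: T)

lemma finsum_in_subspace:
  assumes V: "subspace class_ring V L" and fin: "finite N" and c: "\<And>k. k \<in> N \<Longrightarrow> c k \<in> V"
  shows "(\<Oplus>k\<in>N. c k) \<in> V"
  using fin c
proof (induction rule: finite_induct)
  case (insert k N)
  have "c \<in> N \<rightarrow> carrier L" "c k \<in> carrier L" using insert(4) subspaceD(1)[OF V] by auto
  then show ?case using insert subspaceD(3)[OF V] by simp
qed (simp add: subspaceD(2)[OF V])

text \<open>Induction on the number of summands. To isolate \<open>c l\<close>, choose
  \<open>h\<close> separating the weights of \<open>k0\<close> and \<open>l\<close> and apply
  \<open>T = ad (t h) - \<omega> k0 h\<close>: it keeps the sum in \<open>V\<close>, kills
  \<open>c k0\<close>, and multiplies \<open>c l\<close> by a nonzero scalar. The choice of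
  \<open>h\<close> depends on \<open>l\<close>, so the induction hypothesis is used once for each
  \<open>l\<close>; the other \<open>T (c k)\<close> may well vanish.\<close>

lemma weight_components:
  assumes fin: "finite N" and c: "\<And>k. k \<in> N \<Longrightarrow> c k \<in> carrier L"
    and t: "\<And>h. h \<in> C \<Longrightarrow> t h \<in> carrier L"
    and wt: "\<And>k h. k \<in> N \<Longrightarrow> h \<in> C \<Longrightarrow> brk L (t h) (c k) = \<omega> k h \<odot> c k"
    and distinct: "\<And>k l. k \<in> N \<Longrightarrow> l \<in> N \<Longrightarrow> k \<noteq> l \<Longrightarrow> \<exists>h\<in>C. \<omega> k h \<noteq> \<omega> l h"
    and V: "subspace class_ring V L" and stable: "\<And>h u. h \<in> C \<Longrightarrow> u \<in> V \<Longrightarrow> brk L (t h) u \<in> V"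
    and sum: "(\<Oplus>k\<in>N. c k) \<in> V" and k: "k \<in> N"
  shows "c k \<in> V"
  using fin c wt distinct sum k
proof (induction N arbitrary: c k rule: finite_induct)
  case (insert k0 N)
  note VD = subspaceD[OF V]
  define s where "s = (\<Oplus>k\<in>N. c k)"
  have cN: "c \<in> N \<rightarrow> carrier L" "c k0 \<in> carrier L" using insert.prems(1) by auto
  then have sc: "s \<in> carrier L" by (auto simp: s_def)
  have sum': "c k0 \<oplus> s \<in> V" using insert.hyps insert.prems(4) cN by (simp add: s_def)
  have l: "c l \<in> V" if l: "l \<in> N" for l
  proof -
    have "k0 \<noteq> l" using l insert.hyps by auto
    then obtain h where h: "h \<in> C" "\<omega> k0 h \<noteq> \<omega> l h" using insert.prems(3)[of k0 l] l by blast
    define T where "T u = brk L (t h) u \<ominus> \<omega> k0 h \<odot> u" for u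
    have Tc: "T (c k) = (\<omega> k h - \<omega> k0 h) \<odot> c k" if "k \<in> insert k0 N" for k
      using insert.prems(1,2)[OF that] h(1) by (simp add: T_def scale_minus_left)
    have Tadd: "T (u \<oplus> w) = T u \<oplus> T w" if "u \<in> carrier L" "w \<in> carrier L" for u w
      using that t[OF h(1)] by (simp add: T_def brk_add_right scale_add_right diff_simps)
    have Tcl: "T u \<in> carrier L" if "u \<in> carrier L" for u using that t[OF h(1)] by (simp add: T_def)
    have T0: "T \<zero> = \<zero>" using t[OF h(1)] by (simp add: T_def)
    have "T (c k0 \<oplus> s) \<in> V"
      using VD(5)[OF stable[OF h(1) sum'] VD(4)[OF sum']] by (simp add: T_def)
    moreover have "T (c k0 \<oplus> s) = T (c k0) \<oplus> T s" using Tadd cN sc by auto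
    moreover have "T (c k0) = \<zero>" using Tc[of k0] cN by simp
    ultimately have "T s \<in> V" using Tcl[OF sc] by simp
    moreover have "T s = (\<Oplus>k\<in>N. T (c k))"
      unfolding s_def by (rule finsum_linear) (use Tcl T0 Tadd insert.hyps cN in auto)
    ultimately have "(\<Oplus>k\<in>N. T (c k)) \<in> V" by simp
    then have "T (c l) \<in> V"
    proof (rule insert.IH[rotated 3])
      show "T (c k) \<in> carrier L" if "k \<in> N" for k using that Tcl cN by auto
      show "brk L (t h') (T (c k)) = \<omega> k h' \<odot> T (c k)" if "k \<in> N" "h' \<in> C" for k h'
        using that insert.prems(1,2) Tc[of k] t
        by (simp add: brk_smult_right scale_scale mult.commute)
    qed (use insert.prems(3) l in auto)
    then have "inverse (\<omega> l h - \<omega> k0 h) \<odot> ((\<omega> l h - \<omega> k0 h) \<odot> c l) \<in> V"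
      using VD(4) Tc[of l] l by simp
    moreover have "c l \<in> carrier L" "\<omega> l h - \<omega> k0 h \<noteq> 0" using cN l h(2) by auto
    ultimately show "c l \<in> V" by (simp add: scale_scale)
  qed
  then have "s \<in> V" unfolding s_def using V insert.hyps by (intro finsum_in_subspace) auto
  then have "c k0 \<oplus> s \<ominus> s \<in> V" using VD(5) sum' by blast
  moreover have "c k0 \<oplus> s \<ominus> s = c k0" using cN sc by (simp add: diff_simps)
  ultimately have "c k0 \<in> V" by simp
  then show ?case using l insert.prems(5) by auto
qed simp

end

text \<open>In contrast to \<open>P_induct\<close>, the bracket step receives homogeneous arguments,
  for which the super Jacobi identity is available.\<close>

lemma (in presentation) P_homog_induct:
  assumes "u \<in> part P i"
    and gen: "\<And>g. g \<in> G \<Longrightarrow> Q (cls (Gen g))" and zero: "Q \<zero>\<^bsub>P\<^esub>"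
    and add: "\<And>u w. \<lbrakk>u \<in> carrier P; w \<in> carrier P; Q u; Q w\<rbrakk> \<Longrightarrow> Q (u \<oplus>\<^bsub>P\<^esub> w)"
    and scale: "\<And>c u. \<lbrakk>u \<in> carrier P; Q u\<rbrakk> \<Longrightarrow> Q (c \<odot>\<^bsub>P\<^esub> u)"
    and brk: "\<And>u w i j. \<lbrakk>u \<in> part P i; w \<in> part P j; Q u; Q w\<rbrakk> \<Longrightarrow> Q (brk P u w)"
  shows "Q u"
proof -
  have c: "t \<in> lie_terms G \<Longrightarrow> cls t \<in> carrier P" for t by (auto simp: P_carrier)
  have p: "t \<in> lie_terms G \<Longrightarrow> homog par t i \<Longrightarrow> cls t \<in> part P i" for t i by (auto simp: P_part)
  have "homog par t i \<Longrightarrow> t \<in> lie_terms G \<Longrightarrow> Q (cls t)" for t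
  proof (induction rule: homog.induct)
    case 2 then show ?case using zero by (simp add: P_zero)
  next
    case (3 s i t) then show ?case using add[OF c c] by (simp flip: P_add)
  next
    case (4 t i a) then show ?case using scale[OF c] by (simp flip: P_smult)
  next
    case (5 s i t j) then show ?case using brk[OF p p] by (simp flip: P_brk)
  qed (use gen in auto)
  then show ?thesis using assms(1) by (auto simp: P_part)
qed


section \<open>Root data\<close>

locale fixed_root_datum =
  fixes X :: "'x set" and v :: "('x, 'h) root_datum"
  assumes fin: "finite X" and root_datum: "is_root_datum X v"
begin

abbreviation "Hv \<equiv> hsp v"

sublocale H: complex_vs Hv
  using root_datum by (simp add: is_root_datum_def complex_vs_def)

lemma av_closed [simp]: "x \<in> X \<Longrightarrow> av v x \<in> carrier Hv"
  using root_datum by (auto simp: is_root_datum_def)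

lemma av_extensional: "av v \<in> extensional X" and bv_extensional: "bv v \<in> extensional X"
  and pv_extensional: "pv v \<in> extensional X"
  using root_datum by (auto simp: is_root_datum_def PiE_def)

lemma bv_dual: "x \<in> X \<Longrightarrow> bv v x \<in> dual_space Hv"
  using root_datum by (auto simp: is_root_datum_def)

lemma bv_add: "\<lbrakk>x \<in> X; h \<in> carrier Hv; k \<in> carrier Hv\<rbrakk> \<Longrightarrow> bv v x (h \<oplus>\<^bsub>Hv\<^esub> k) = bv v x h + bv v x k"
  and bv_scale: "\<lbrakk>x \<in> X; h \<in> carrier Hv\<rbrakk> \<Longrightarrow> bv v x (c \<odot>\<^bsub>Hv\<^esub> h) = c * bv v x h"
  and bv_ext: "x \<in> X \<Longrightarrow> bv v x \<in> extensional (carrier Hv)"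
  using bv_dual unfolding dual_space_def by blast+

lemma a_independent:
  assumes "(\<Oplus>\<^bsub>Hv\<^esub>x\<in>X. c x \<odot>\<^bsub>Hv\<^esub> av v x) = \<zero>\<^bsub>Hv\<^esub>" "x \<in> X" shows "c x = 0"
proof -
  have "\<forall>c. (\<Oplus>\<^bsub>Hv\<^esub>y\<in>X. c y \<odot>\<^bsub>Hv\<^esub> av v y) = \<zero>\<^bsub>Hv\<^esub> \<longrightarrow> (\<forall>y\<in>X. c y = 0)"
    using root_datum unfolding is_root_datum_def by (elim conjE)
  from spec[OF this, of c] assms show ?thesis by blast
qed

lemma b_independent:
  assumes "\<And>h. h \<in> carrier Hv \<Longrightarrow> (\<Sum>x\<in>X. c x * bv v x h) = 0" "x \<in> X" shows "c x = 0"
proof -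
  have "\<forall>c. (\<forall>h\<in>carrier Hv. (\<Sum>x\<in>X. c x * bv v x h) = 0) \<longrightarrow> (\<forall>x\<in>X. c x = 0)"
    using root_datum unfolding is_root_datum_def by (elim conjE)
  from spec[OF this, of c] assms show ?thesis by blast
qed

end


section \<open>The half-baked algebra\<close>

definition hb_e :: "'x set \<Rightarrow> ('x, 'h) root_datum \<Rightarrow> 'x \<Rightarrow> ('x, 'h) hb_gen lie_term set" where
  "hb_e X v x = lie_cong (hb_gens X v) (hb_par v) (hb_rels X v) `` {Gen (E x)}"

definition hb_f :: "'x set \<Rightarrow> ('x, 'h) root_datum \<Rightarrow> 'x \<Rightarrow> ('x, 'h) hb_gen lie_term set" where
  "hb_f X v x = lie_cong (hb_gens X v) (hb_par v) (hb_rels X v) `` {Gen (F x)}"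

locale half_baked_alg = fixed_root_datum X v
  for X :: "'x set" and v :: "('x, 'h) root_datum"
begin

abbreviation "H \<equiv> carrier (hsp v)"
abbreviation "A \<equiv> half_baked X v"
abbreviation "ct \<equiv> hb_cart X v"
abbreviation "e \<equiv> hb_e X v"
abbreviation "f \<equiv> hb_f X v"

lemma hb_par_simps [simp]: "hb_par v (Cart h) = 0" "hb_par v (E x) = pv v x" "hb_par v (F x) = pv v x"
  by (simp_all add: hb_par_def)

lemma bit_double: "i + i = (0 :: bit)"
  by (cases i) simp_all

lemma hb_rels_homogeneous:
  assumes "(s, t) \<in> hb_rels X v"
  shows "\<exists>i. homog (hb_par v) s i \<and> homog (hb_par v) t i"
proof -
  have g: "homog (hb_par v) (Gen (Cart h)) 0" "homog (hb_par v) (Gen (E x)) (pv v x)"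
    "homog (hb_par v) (Gen (F x)) (pv v x)" for h x
    using homog.intros(1)[of "hb_par v" "Cart h"] homog.intros(1)[of "hb_par v" "E x"]
      homog.intros(1)[of "hb_par v" "F x"] by (simp_all only: hb_par_simps)
  have b: "homog (hb_par v) (Brk (Gen (Cart h)) (Gen (Cart k))) 0"
    "homog (hb_par v) (Brk (Gen (Cart h)) (Gen (E x))) (pv v x)"
    "homog (hb_par v) (Brk (Gen (Cart h)) (Gen (F x))) (pv v x)"
    "homog (hb_par v) (Brk (Gen (E x)) (Gen (F y))) (pv v x + pv v y)"
    "homog (hb_par v) (Brk (Gen (E x)) (Gen (F x))) 0" for h k x y
    using homog.intros(5)[OF g(1)[of h] g(1)[of k]] homog.intros(5)[OF g(1)[of h] g(2)[of x]]
      homog.intros(5)[OF g(1)[of h] g(3)[of x]] homog.intros(5)[OF g(2)[of x] g(3)[of y]]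
      homog.intros(5)[OF g(2)[of x] g(3)[of x]] by (simp_all only: add_0 bit_double)
  from assms show ?thesis
  proof cases
    case (1 h k)
    then show ?thesis using homog.intros(3)[OF g(1) g(1)] g(1) by blast
  next
    case (2 h c)
    then show ?thesis using homog.intros(4)[OF g(1)] g(1) by blast
  next
    case (3 h k)
    then show ?thesis using b(1) homog.intros(2) by blast
  next
    case (4 h x)
    then show ?thesis using b(2) homog.intros(4)[OF g(2)] by blast
  next
    case (5 h x)
    then show ?thesis using b(3) homog.intros(4)[OF g(3)] by blast
  next
    case (6 x y)
    then show ?thesis using b(4) homog.intros(2) by blast
  next
    case (7 x)
    then show ?thesis using b(5) g(1) by blast
  qed
qed

sublocale presentation "hb_gens X v" "hb_par v" "hb_rels X v"
  by standard (rule hb_rels_homogeneous)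

sublocale A: lie_alg A
  unfolding half_baked_def by (rule lie_alg.intro[OF P_lie_superalgebra])

lemma cls_gen: "cls (Gen (Cart h)) = ct h" "cls (Gen (E x)) = e x" "cls (Gen (F x)) = f x"
  by (simp_all add: cls_def hb_cart_def hb_e_def hb_f_def)

lemma gens_simps [simp]:
  "Cart h \<in> hb_gens X v \<longleftrightarrow> h \<in> H" "E x \<in> hb_gens X v \<longleftrightarrow> x \<in> X" "F x \<in> hb_gens X v \<longleftrightarrow> x \<in> X"
  by (auto simp: hb_gens_def)

lemma cls_Gen_part: "g \<in> hb_gens X v \<Longrightarrow> cls (Gen g) \<in> part A (hb_par v g)"
  unfolding half_baked_def P_part by (auto intro: homog.intros(1))

lemma ct_part: "h \<in> H \<Longrightarrow> ct h \<in> part A 0"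
  and e_part: "x \<in> X \<Longrightarrow> e x \<in> part A (pv v x)"
  and f_part: "x \<in> X \<Longrightarrow> f x \<in> part A (pv v x)"
  using cls_Gen_part[of "Cart h"] cls_Gen_part[of "E x"] cls_Gen_part[of "F x"]
  by (simp_all add: cls_gen)

lemma ct_carrier [simp]: "h \<in> H \<Longrightarrow> ct h \<in> carrier A"
  and e_carrier [simp]: "x \<in> X \<Longrightarrow> e x \<in> carrier A"
  and f_carrier [simp]: "x \<in> X \<Longrightarrow> f x \<in> carrier A"
  using ct_part e_part f_part A.part_carrier by blast+

lemma rel_eq:
  assumes "(s, t) \<in> hb_rels X v" "s \<in> lie_terms (hb_gens X v)" "t \<in> lie_terms (hb_gens X v)"
  shows "cls s = cls t"
  using assms by (intro cls_eqI lie_cong.rel)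

lemma cls_ops:
  assumes "s \<in> lie_terms (hb_gens X v)"
  shows "t \<in> lie_terms (hb_gens X v) \<Longrightarrow> cls (Plus s t) = cls s \<oplus>\<^bsub>A\<^esub> cls t"
    "t \<in> lie_terms (hb_gens X v) \<Longrightarrow> cls (Brk s t) = brk A (cls s) (cls t)"
    "cls (Scale c s) = c \<odot>\<^bsub>A\<^esub> cls s" "cls Zero = \<zero>\<^bsub>A\<^esub>"
  using assms by (simp_all add: half_baked_def P_add P_brk P_smult P_zero)

lemma ct_add: "\<lbrakk>h \<in> H; k \<in> H\<rbrakk> \<Longrightarrow> ct (h \<oplus>\<^bsub>hsp v\<^esub> k) = ct h \<oplus>\<^bsub>A\<^esub> ct k"
  using rel_eq[OF hb_rels.intros(1)[of h v k X]] by (simp add: cls_gen cls_ops)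

lemma ct_scale: "h \<in> H \<Longrightarrow> ct (c \<odot>\<^bsub>hsp v\<^esub> h) = c \<odot>\<^bsub>A\<^esub> ct h"
  using rel_eq[OF hb_rels.intros(2)[of h v c X]] by (simp add: cls_gen cls_ops)

lemma ct_ct: "\<lbrakk>h \<in> H; k \<in> H\<rbrakk> \<Longrightarrow> brk A (ct h) (ct k) = \<zero>\<^bsub>A\<^esub>"
  using rel_eq[OF hb_rels.intros(3)[of h v k X]] by (simp add: cls_gen cls_ops(2) cls_ops(4)[of Zero])

lemma ct_e: "\<lbrakk>h \<in> H; x \<in> X\<rbrakk> \<Longrightarrow> brk A (ct h) (e x) = bv v x h \<odot>\<^bsub>A\<^esub> e x"
  using rel_eq[OF hb_rels.intros(4)[of h v x X]] by (simp add: cls_gen cls_ops)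

lemma ct_f: "\<lbrakk>h \<in> H; x \<in> X\<rbrakk> \<Longrightarrow> brk A (ct h) (f x) = (- bv v x h) \<odot>\<^bsub>A\<^esub> f x"
  using rel_eq[OF hb_rels.intros(5)[of h v x X]] by (simp add: cls_gen cls_ops)

lemma e_f: "\<lbrakk>x \<in> X; y \<in> X\<rbrakk> \<Longrightarrow> brk A (e x) (f y) = (if x = y then ct (av v x) else \<zero>\<^bsub>A\<^esub>)"
  using rel_eq[OF hb_rels.intros(6)[of x X y v]] rel_eq[OF hb_rels.intros(7)[of x X v]]
  by (auto simp: cls_gen cls_ops(2) cls_ops(4)[of Zero])

lemma ct_zero: "ct \<zero>\<^bsub>hsp v\<^esub> = \<zero>\<^bsub>A\<^esub>"
  using ct_scale[of "\<zero>\<^bsub>hsp v\<^esub>" 0] H.lmult_0[OF H.zero_closed] by simp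

lemma ct_image_subspace: "subspace class_ring (ct ` H) A"
proof (rule A.subspaceI)
  show "\<zero>\<^bsub>A\<^esub> \<in> ct ` H" using ct_zero H.zero_closed by (metis imageI)
  show "u \<oplus>\<^bsub>A\<^esub> w \<in> ct ` H" if "u \<in> ct ` H" "w \<in> ct ` H" for u w
    using that by (auto simp flip: ct_add)
  show "c \<odot>\<^bsub>A\<^esub> u \<in> ct ` H" if "u \<in> ct ` H" for c u
    using that by (auto simp flip: ct_scale)
qed auto

lemma A_induct [consumes 1, case_names cart e f zero add scale brk]:
  assumes "u \<in> carrier A" "\<And>h. h \<in> H \<Longrightarrow> Q (ct h)" "\<And>x. x \<in> X \<Longrightarrow> Q (e x)" "\<And>x. x \<in> X \<Longrightarrow> Q (f x)"
    "Q \<zero>\<^bsub>A\<^esub>" "\<And>u w. \<lbrakk>u \<in> carrier A; w \<in> carrier A; Q u; Q w\<rbrakk> \<Longrightarrow> Q (u \<oplus>\<^bsub>A\<^esub> w)"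
    "\<And>c u. \<lbrakk>u \<in> carrier A; Q u\<rbrakk> \<Longrightarrow> Q (c \<odot>\<^bsub>A\<^esub> u)"
    "\<And>u w. \<lbrakk>u \<in> carrier A; w \<in> carrier A; Q u; Q w\<rbrakk> \<Longrightarrow> Q (brk A u w)"
  shows "Q u"
proof (rule P_induct[of u Q])
  fix g assume "g \<in> hb_gens X v"
  then show "Q (cls (Gen g))" using assms(2-4) by (cases g) (auto simp: cls_gen)
qed (use assms in \<open>simp_all add: half_baked_def\<close>)

lemma A_homog_induct:
  assumes "u \<in> part A i" "\<And>h. h \<in> H \<Longrightarrow> Q (ct h)" "\<And>x. x \<in> X \<Longrightarrow> Q (e x)" "\<And>x. x \<in> X \<Longrightarrow> Q (f x)"
    "Q \<zero>\<^bsub>A\<^esub>" "\<And>u w. \<lbrakk>u \<in> carrier A; w \<in> carrier A; Q u; Q w\<rbrakk> \<Longrightarrow> Q (u \<oplus>\<^bsub>A\<^esub> w)"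
    "\<And>c u. \<lbrakk>u \<in> carrier A; Q u\<rbrakk> \<Longrightarrow> Q (c \<odot>\<^bsub>A\<^esub> u)"
    "\<And>u w i j. \<lbrakk>u \<in> part A i; w \<in> part A j; Q u; Q w\<rbrakk> \<Longrightarrow> Q (brk A u w)"
  shows "Q u"
proof (rule P_homog_induct[of u i Q])
  fix g assume "g \<in> hb_gens X v"
  then show "Q (cls (Gen g))" using assms(2-4) by (cases g) (auto simp: cls_gen)
next
  show "\<And>u w i j. \<lbrakk>u \<in> part P i; w \<in> part P j; Q u; Q w\<rbrakk> \<Longrightarrow> Q (brk P u w)"
    using assms(8) unfolding half_baked_def .
qed (use assms in \<open>simp_all add: half_baked_def\<close>)

end


context half_baked_alg
begin

subsection \<open>Triangular decomposition\<close>

definition \<delta> :: "'x \<Rightarrow> 'x \<Rightarrow> int" where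
  "\<delta> x = (\<lambda>y. if y = x then 1 else 0)"

definition wt :: "('x \<Rightarrow> int) \<Rightarrow> 'h \<Rightarrow> complex" where
  "wt k h = (\<Sum>x\<in>X. of_int (k x) * bv v x h)"

text \<open>Degrees are total functions on the type, while \<open>wt\<close> reads only their values
  on \<open>X\<close>; it is injective on those that vanish elsewhere.\<close>

definition supported :: "('x \<Rightarrow> int) \<Rightarrow> bool" where
  "supported k \<longleftrightarrow> (\<forall>y. y \<notin> X \<longrightarrow> k y = 0)"

text \<open>Right-nested brackets \<open>[g x1, [g x2, ...]]\<close> together with their
  multidegree. Other bracketings reduce to these by the Jacobi identity, so they span the subalgebra
  generated by the \<open>g x\<close>.\<close>

inductive monomial :: "('x \<Rightarrow> ('x, 'h) hb_gen lie_term set) \<Rightarrow> ('x, 'h) hb_gen lie_term set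
    \<Rightarrow> ('x \<Rightarrow> int) \<Rightarrow> bool" for g where
  single: "x \<in> X \<Longrightarrow> monomial g (g x) (\<delta> x)"
| step: "x \<in> X \<Longrightarrow> monomial g u k \<Longrightarrow> monomial g (brk A (g x) u) (\<lambda>y. \<delta> x y + k y)"

lemma wt_add: "wt (\<lambda>y. k y + l y) h = wt k h + wt l h"
  by (simp add: wt_def sum.distrib algebra_simps)

lemma wt_minus: "wt (\<lambda>y. - k y) h = - wt k h"
  by (simp add: wt_def sum_negf)

lemma wt_delta: "x \<in> X \<Longrightarrow> wt (\<delta> x) h = bv v x h"
proof -
  assume x: "x \<in> X"
  have "wt (\<delta> x) h = (\<Sum>y\<in>X. if y = x then bv v y h else 0)"
    unfolding wt_def \<delta>_def by (intro sum.cong) auto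
  then show ?thesis using fin x by simp
qed

lemma wt_zero [simp]: "wt (\<lambda>_. 0) h = 0"
  by (simp add: wt_def)

lemma wt_inj:
  assumes "supported k" "supported l" and eq: "\<And>h. h \<in> H \<Longrightarrow> wt k h = wt l h"
  shows "k = l"
proof
  fix y
  have "(\<Sum>x\<in>X. of_int (k x - l x) * bv v x h) = 0" if "h \<in> H" for h
    using eq[OF that] by (simp add: wt_def sum_subtractf algebra_simps)
  then have "\<forall>x\<in>X. (of_int (k x - l x) :: complex) = 0"
    using b_independent[of "\<lambda>x. of_int (k x - l x)"] by blast
  then have "y \<in> X \<Longrightarrow> k y = l y" by (metis eq_iff_diff_eq_0 of_int_eq_0_iff)
  then show "k y = l y" using assms(1,2) by (cases "y \<in> X") (auto simp: supported_def)
qed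

text \<open>The sum of the degree is the length of the monomial, and length one leaves only a
  generator. This is the source of the one-dimensional weight spaces of \<open>e x\<close> and
  \<open>f x\<close>.\<close>

lemma monomial_support:
  assumes "monomial g u k"
  shows "supported k \<and> (\<forall>y. 0 \<le> k y) \<and> 1 \<le> sum k X \<and> (sum k X = 1 \<longrightarrow> (\<exists>x\<in>X. u = g x \<and> k = \<delta> x))"
  using assms
proof (induction rule: monomial.induct)
  case (single x)
  then show ?case using fin by (auto simp: \<delta>_def supported_def)
next
  case (step x u k)
  have "sum (\<lambda>y. \<delta> x y + k y) X = sum (\<delta> x) X + sum k X" by (rule sum.distrib)
  moreover have "sum (\<delta> x) X = 1" using fin step(1) by (simp add: \<delta>_def)
  ultimately show ?case using step by (auto simp: \<delta>_def supported_def)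
qed

lemma monomial_carrier:
  assumes g: "\<And>x. x \<in> X \<Longrightarrow> g x \<in> carrier A" and "monomial g u k"
  shows "u \<in> carrier A"
  using assms(2) by (induction rule: monomial.induct) (use g in auto)

text \<open>The factor \<open>s\<close> is \<open>1\<close> for the family \<open>e\<close> and
  \<open>-1\<close> for \<open>f\<close>; brackets with a Cartan element act as a derivation, so
  weights add along a monomial.\<close>

lemma monomial_weight:
  assumes g: "\<And>x. x \<in> X \<Longrightarrow> g x \<in> carrier A"
    and ad: "\<And>x. x \<in> X \<Longrightarrow> brk A (ct h) (g x) = (s * bv v x h) \<odot>\<^bsub>A\<^esub> g x"
    and h: "h \<in> H" and m: "monomial g u k"
  shows "brk A (ct h) u = (s * wt k h) \<odot>\<^bsub>A\<^esub> u"
  using m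
proof (induction rule: monomial.induct)
  case (single x)
  then show ?case using ad by (simp add: wt_delta)
next
  case (step x u k)
  have c: "u \<in> carrier A" "g x \<in> carrier A" using monomial_carrier[OF g step(2)] g step(1) by auto
  have "brk A (ct h) (brk A (g x) u) = brk A (brk A (ct h) (g x)) u \<oplus>\<^bsub>A\<^esub> brk A (g x) (brk A (ct h) u)"
    using A.even_derivation[OF ct_part[OF h]] c by simp
  also have "\<dots> = (s * bv v x h) \<odot>\<^bsub>A\<^esub> brk A (g x) u \<oplus>\<^bsub>A\<^esub> (s * wt k h) \<odot>\<^bsub>A\<^esub> brk A (g x) u"
    using step ad c by (simp add: A.brk_smult_left A.brk_smult_right)
  also have "\<dots> = (s * bv v x h + s * wt k h) \<odot>\<^bsub>A\<^esub> brk A (g x) u"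
    using c by (simp add: A.scale_add_left)
  also have "s * bv v x h + s * wt k h = s * wt (\<lambda>y. \<delta> x y + k y) h"
    using step(1) by (simp add: wt_add wt_delta distrib_left)
  finally show ?case .
qed

definition monomials :: "('x \<Rightarrow> ('x, 'h) hb_gen lie_term set) \<Rightarrow> ('x, 'h) hb_gen lie_term set set" where
  "monomials g = {u. \<exists>k. monomial g u k}"

lemma monomials_carrier: "(\<And>x. x \<in> X \<Longrightarrow> g x \<in> carrier A) \<Longrightarrow> monomials g \<subseteq> carrier A"
  using monomial_carrier unfolding monomials_def by blast

lemma brk_ct_right:
  assumes "u \<in> part A i" "h \<in> H"
  shows "brk A u (ct h) = (- 1) \<odot>\<^bsub>A\<^esub> brk A (ct h) u"
  using A.brk_skew[OF assms(1) ct_part[OF assms(2)]] by (simp add: super_sign_def)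

text \<open>
  The two halves of the triangular decomposition are symmetric, so \<open>g\<close>, \<open>g'\<close> stand for the
  families of generators \<open>e\<close>, \<open>f\<close> in either order.
\<close>

lemma brk_opposite_monomial:
  assumes g: "\<And>x. x \<in> X \<Longrightarrow> g x \<in> part A (pv v x)" and g': "\<And>x. x \<in> X \<Longrightarrow> g' x \<in> part A (pv v x)"
    and ad: "\<And>x h. x \<in> X \<Longrightarrow> h \<in> H \<Longrightarrow> brk A (ct h) (g' x) = (s * bv v x h) \<odot>\<^bsub>A\<^esub> g' x"
    and gg': "\<And>x y. x \<in> X \<Longrightarrow> y \<in> X \<Longrightarrow> brk A (g x) (g' y) \<in> ct ` H"
    and x: "x \<in> X" and m: "monomial g' u k"
  shows "brk A (g x) u \<in> A.lspan (ct ` H \<union> monomials g')"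
  using m
proof (induction rule: monomial.induct)
  case (single y)
  then show ?case using gg' x by (auto intro: A.lspan.base)
next
  case (step y u k)
  have gc: "\<And>x. x \<in> X \<Longrightarrow> g' x \<in> carrier A" using g' A.part_carrier by blast
  have c: "u \<in> carrier A" "g x \<in> carrier A" "g' y \<in> carrier A"
    using monomial_carrier[OF gc step(2)] g[OF x] g'[OF step(1)] by auto
  obtain h where h: "h \<in> H" "brk A (g x) (g' y) = ct h" using gg'[OF x step(1)] by blast
  have S: "ct ` H \<union> monomials g' \<subseteq> carrier A" using monomials_carrier[OF gc] by auto
  have u: "u \<in> ct ` H \<union> monomials g'" using step(2) unfolding monomials_def by blast
  \<comment> \<open>By Jacobi, \<open>[g x, [g' y, u]]\<close> is a Cartan element acting on the
    weight vector \<open>u\<close>, up to a multiple of \<open>[g' y, [g x, u]]\<close>. The first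
    is a multiple of \<open>u\<close>; in the second, \<open>[g x, u]\<close> is in the span by
    induction, and bracketing with \<open>g' y\<close> stays there.\<close>
  have "brk A (ct h) u = (s * wt k h) \<odot>\<^bsub>A\<^esub> u"
    by (rule monomial_weight[OF gc ad[OF _ h(1)] h(1) step(2)])
  then have 1: "brk A (brk A (g x) (g' y)) u \<in> A.lspan (ct ` H \<union> monomials g')"
    using h A.lspan.scale[OF A.lspan.base[OF u]] by simp
  have 2: "brk A (g' y) (brk A (g x) u) \<in> A.lspan (ct ` H \<union> monomials g')"
  proof (rule A.brk_lspan[OF S A.lspan_subspace[OF S] c(3) _ step.IH])
    fix w assume "w \<in> ct ` H \<union> monomials g'"
    then consider h' where "h' \<in> H" "w = ct h'" | l where "monomial g' w l"
      by (auto simp: monomials_def)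
    then show "brk A (g' y) w \<in> A.lspan (ct ` H \<union> monomials g')"
    proof cases
      case 1
      have "brk A (g' y) w = (- 1) \<odot>\<^bsub>A\<^esub> ((s * bv v y h') \<odot>\<^bsub>A\<^esub> g' y)"
        using brk_ct_right[OF g'[OF step(1)] 1(1)] ad[OF step(1) 1(1)] 1 by simp
      moreover have "g' y \<in> A.lspan (ct ` H \<union> monomials g')"
        using monomial.single[OF step(1), of g'] by (auto intro!: A.lspan.base simp: monomials_def)
      ultimately show ?thesis by (simp add: A.lspan.scale)
    next
      case 2
      then show ?thesis using monomial.step[OF step(1), of g']
        by (auto intro!: A.lspan.base simp: monomials_def)
    qed
  qed
  show ?case
    using A.brk_jacobi[OF g[OF x] g'[OF step(1)] c(1)] 1 2
    by (auto intro: A.lspan.add A.lspan.scale)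
qed

lemma e_f_ct: "x \<in> X \<Longrightarrow> y \<in> X \<Longrightarrow> brk A (e x) (f y) \<in> ct ` H"
  using e_f A.subspaceD(2)[OF ct_image_subspace] by auto

lemma f_e_ct: "x \<in> X \<Longrightarrow> y \<in> X \<Longrightarrow> brk A (f x) (e y) \<in> ct ` H"
  using A.brk_skew[OF f_part e_part, of x y] e_f_ct[of y x] A.subspaceD(4)[OF ct_image_subspace]
  by simp

text \<open>The factors \<open>1\<close> and \<open>- 1\<close> are spelled out so that these facts
  unify with the parameter \<open>s\<close> of \<open>monomial_weight\<close> and
  \<open>brk_opposite_monomial\<close>.\<close>

lemma ct_e1: "x \<in> X \<Longrightarrow> h \<in> H \<Longrightarrow> brk A (ct h) (e x) = (1 * bv v x h) \<odot>\<^bsub>A\<^esub> e x"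
  and ct_f1: "x \<in> X \<Longrightarrow> h \<in> H \<Longrightarrow> brk A (ct h) (f x) = (- 1 * bv v x h) \<odot>\<^bsub>A\<^esub> f x"
  by (simp_all add: ct_e ct_f)

definition triangular :: "('x, 'h) hb_gen lie_term set set" where
  "triangular = ct ` H \<union> monomials e \<union> monomials f"

lemma triangular_carrier: "triangular \<subseteq> carrier A"
  unfolding triangular_def using monomials_carrier[of e] monomials_carrier[of f] by auto

text \<open>Stability under the generators is a case distinction over Cartan elements and the two
  kinds of monomials. It extends to all homogeneous elements because \<open>ad [u, u']\<close> is a
  combination of \<open>ad u\<close> after \<open>ad u'\<close> and \<open>ad u'\<close> after
  \<open>ad u\<close>.\<close>

lemma triangular_stable:
  assumes u: "u \<in> part A i" and w: "w \<in> A.lspan triangular"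
  shows "brk A u w \<in> A.lspan triangular"
proof -
  let ?S = "A.lspan triangular"
  note sub = A.lspan_subspace[OF triangular_carrier]
  note subD = A.subspaceD[OF sub]
  have gen: "brk A u w \<in> ?S"
    if uc: "u \<in> carrier A" and base: "\<And>z. z \<in> triangular \<Longrightarrow> brk A u z \<in> ?S" and w: "w \<in> ?S" for u w
    by (rule A.brk_lspan[OF triangular_carrier sub uc base w])
  have mono: "z \<in> ?S" if "z \<in> A.lspan (ct ` H \<union> monomials e) \<or> z \<in> A.lspan (ct ` H \<union> monomials f)" for z
    using that by (auto simp: triangular_def intro: A.lspan_mono[rotated])
  have cart: "brk A (ct h) z \<in> ?S" if h: "h \<in> H" and z: "z \<in> triangular" for h z
    using z[unfolded triangular_def]
  proof (elim UnE)
    assume "z \<in> ct ` H" then show ?thesis using ct_ct[OF h] subD(2) by auto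
  next
    assume "z \<in> monomials e"
    then obtain k where k: "monomial e z k" by (auto simp: monomials_def)
    have "z \<in> ?S" using \<open>z \<in> monomials e\<close> by (auto simp: triangular_def intro: A.lspan.base)
    then show ?thesis using monomial_weight[OF e_carrier ct_e1[OF _ h] h k] subD(4) by simp
  next
    assume "z \<in> monomials f"
    then obtain k where k: "monomial f z k" by (auto simp: monomials_def)
    have "z \<in> ?S" using \<open>z \<in> monomials f\<close> by (auto simp: triangular_def intro: A.lspan.base)
    then show ?thesis using monomial_weight[OF f_carrier ct_f1[OF _ h] h k] subD(4) by simp
  qed
  have ce: "brk A (e x) (ct h) \<in> ?S" "brk A (f x) (ct h) \<in> ?S" if "x \<in> X" "h \<in> H" for x h
  proof -
    have "e x \<in> ?S" "f x \<in> ?S"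
      using monomial.single[OF that(1), of e] monomial.single[OF that(1), of f]
      unfolding triangular_def monomials_def by (intro A.lspan.base; blast)+
    then show "brk A (e x) (ct h) \<in> ?S" "brk A (f x) (ct h) \<in> ?S"
      using brk_ct_right[OF e_part that(2)] brk_ct_right[OF f_part that(2)] that ct_e ct_f subD(4)
      by simp_all
  qed
  have pe: "brk A (e x) z \<in> ?S" if x: "x \<in> X" and z: "z \<in> triangular" for x z
    using z[unfolded triangular_def]
  proof (elim UnE)
    assume "z \<in> ct ` H" then show "brk A (e x) z \<in> ?S"
      using ce[OF x] by (auto simp: triangular_def)
  next
    assume "z \<in> monomials e"
    then show "brk A (e x) z \<in> ?S"
      using monomial.step[OF x, of e] unfolding monomials_def triangular_def
      by (intro A.lspan.base) blast
  next
    assume "z \<in> monomials f"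
    then obtain k where k: "monomial f z k" by (auto simp: monomials_def)
    show "brk A (e x) z \<in> ?S"
      using mono brk_opposite_monomial[OF e_part f_part ct_f1 e_f_ct x k] by (simp add: triangular_def)
  qed
  have pf: "brk A (f x) z \<in> ?S" if x: "x \<in> X" and z: "z \<in> triangular" for x z
    using z[unfolded triangular_def]
  proof (elim UnE)
    assume "z \<in> ct ` H" then show "brk A (f x) z \<in> ?S"
      using ce[OF x] by (auto simp: triangular_def)
  next
    assume "z \<in> monomials f"
    then show "brk A (f x) z \<in> ?S"
      using monomial.step[OF x, of f] unfolding monomials_def triangular_def
      by (intro A.lspan.base) blast
  next
    assume "z \<in> monomials e"
    then obtain k where k: "monomial e z k" by (auto simp: monomials_def)
    show "brk A (f x) z \<in> ?S"
      using mono brk_opposite_monomial[OF f_part e_part ct_e1 f_e_ct x k] by (simp add: triangular_def)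
  qed
  have "\<forall>w\<in>?S. brk A u w \<in> ?S"
    using u
  proof (rule A_homog_induct)
    show "\<forall>w\<in>?S. brk A (ct h) w \<in> ?S" if "h \<in> H" for h
      using gen[of "ct h"] cart[OF that] that by simp
    show "\<forall>w\<in>?S. brk A (e x) w \<in> ?S" if "x \<in> X" for x
      using gen[of "e x"] pe[OF that] that by simp
    show "\<forall>w\<in>?S. brk A (f x) w \<in> ?S" if "x \<in> X" for x
      using gen[of "f x"] pf[OF that] that by simp
    show "\<forall>w\<in>?S. brk A \<zero>\<^bsub>A\<^esub> w \<in> ?S" using subD(1,2) by (simp add: subset_iff)
    show "\<forall>w\<in>?S. brk A (u \<oplus>\<^bsub>A\<^esub> u') w \<in> ?S"
      if "u \<in> carrier A" "u' \<in> carrier A" "\<forall>w\<in>?S. brk A u w \<in> ?S" "\<forall>w\<in>?S. brk A u' w \<in> ?S" for u u'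
      using that subD(1,3) by (simp add: A.brk_add_left subset_iff)
    show "\<forall>w\<in>?S. brk A (c \<odot>\<^bsub>A\<^esub> u) w \<in> ?S"
      if "u \<in> carrier A" "\<forall>w\<in>?S. brk A u w \<in> ?S" for c u
      using that subD(1,4) by (simp add: A.brk_smult_left subset_iff)
    fix u u' i j
    assume uu: "u \<in> part A i" "u' \<in> part A j"
      and IH: "\<forall>w\<in>?S. brk A u w \<in> ?S" "\<forall>w\<in>?S. brk A u' w \<in> ?S"
    show "\<forall>w\<in>?S. brk A (brk A u u') w \<in> ?S"
    proof
      fix w assume w: "w \<in> ?S"
      then have c: "w \<in> carrier A" "u \<in> carrier A" "u' \<in> carrier A" using subD(1) uu by auto
      have "brk A (brk A u u') w
          = brk A u (brk A u' w) \<ominus>\<^bsub>A\<^esub> super_sign i j \<odot>\<^bsub>A\<^esub> brk A u' (brk A u w)"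
        using A.brk_jacobi[OF uu c(1)] c by (simp add: A.diff_simps)
      then show "brk A (brk A u u') w \<in> ?S"
        using IH w subD(4,5) by simp
    qed
  qed
  then show ?thesis using w by blast
qed

text \<open>The span contains the generators and is stable under the adjoint action of the whole
  algebra, hence contains every bracket.\<close>

lemma triangular_decomposition: "u \<in> carrier A \<Longrightarrow> u \<in> A.lspan triangular"
proof (induction rule: A_induct)
  case (brk u w)
  obtain u0 u1 where *: "u0 \<in> part A 0" "u1 \<in> part A 1" "u = u0 \<oplus>\<^bsub>A\<^esub> u1"
    using A.part_sum[OF brk(1)] by blast
  have "brk A u w = brk A u0 w \<oplus>\<^bsub>A\<^esub> brk A u1 w"
    using * brk by (simp add: A.brk_add_left A.part_carrier)
  then show ?case
    using triangular_stable[OF *(1) brk(4)] triangular_stable[OF *(2) brk(4)] by (simp add: A.lspan.add)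
next
  case (e x)
  then show ?case using monomial.single[of x e] unfolding triangular_def monomials_def
    by (intro A.lspan.base) blast
next
  case (f x)
  then show ?case using monomial.single[of x f] unfolding triangular_def monomials_def
    by (intro A.lspan.base) blast
qed (auto simp: triangular_def intro: A.lspan.intros)

end


context half_baked_alg
begin

subsection \<open>Weight spaces\<close>

definition weight_gens :: "('x \<Rightarrow> int) \<Rightarrow> ('x, 'h) hb_gen lie_term set set" where
  "weight_gens k = {u. u \<in> ct ` H \<and> k = (\<lambda>_. 0)} \<union> {u. monomial e u k} \<union> {u. monomial f u (\<lambda>y. - k y)}"

text \<open>A span of generators of fixed degree rather than an eigenspace: the spanning set shows
  directly which degrees are small. A degree with entries of both signs has no generators at
  all.\<close>

definition wspace :: "('x \<Rightarrow> int) \<Rightarrow> ('x, 'h) hb_gen lie_term set set" where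
  "wspace k = A.lspan (weight_gens k)"

lemma weight_gens_carrier: "weight_gens k \<subseteq> carrier A"
  using monomial_carrier[of e] monomial_carrier[of f] unfolding weight_gens_def by auto

lemma wspace_subspace: "subspace class_ring (wspace k) A"
  unfolding wspace_def by (rule A.lspan_subspace[OF weight_gens_carrier])

lemmas wspaceD = A.subspaceD[OF wspace_subspace]

lemma wspace_weight:
  assumes "u \<in> wspace k" and h: "h \<in> H"
  shows "brk A (ct h) u = wt k h \<odot>\<^bsub>A\<^esub> u"
  using assms(1) unfolding wspace_def
proof (induction rule: A.lspan.induct)
  case (base u)
  then consider "u \<in> ct ` H" "k = (\<lambda>_. 0)" | "monomial e u k" | "monomial f u (\<lambda>y. - k y)"
    by (auto simp: weight_gens_def)
  then show ?case
  proof cases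
    case 1
    then show ?thesis using ct_ct[OF h] by auto
  next
    case 2
    then show ?thesis using monomial_weight[OF e_carrier ct_e1[OF _ h] h] by simp
  next
    case 3
    then show ?thesis using monomial_weight[OF f_carrier ct_f1[OF _ h] h 3] by (simp add: wt_minus)
  qed
next
  case (add u w)
  then show ?case using A.lspan_carrier[OF weight_gens_carrier] h
    by (simp add: A.brk_add_right A.scale_add_right)
next
  case (scale u c)
  then show ?case using A.lspan_carrier[OF weight_gens_carrier] h
    by (simp add: A.brk_smult_right A.scale_scale mult.commute)
qed (use h in simp)

lemma weight_gens_supported:
  assumes "u \<in> weight_gens k"
  shows "supported k"
proof -
  from assms consider "k = (\<lambda>_. 0)" | "monomial e u k" | "monomial f u (\<lambda>y. - k y)"
    by (auto simp: weight_gens_def)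
  then show ?thesis
    by cases (use monomial_support[of e u k] monomial_support[of f u "\<lambda>y. - k y"] in
        \<open>auto simp: supported_def\<close>)
qed

lemma wspace_zero: "wspace (\<lambda>_. 0) \<subseteq> ct ` H"
  unfolding wspace_def
proof (rule A.lspan_least[OF ct_image_subspace])
  have "\<not> monomial e u (\<lambda>_. 0)" "\<not> monomial f u (\<lambda>_. 0)" for u
    using monomial_support[of _ u "\<lambda>_. 0"] by auto
  then show "weight_gens (\<lambda>_. 0) \<subseteq> ct ` H" by (auto simp: weight_gens_def)
qed

lemma sum_delta: "x \<in> X \<Longrightarrow> sum (\<delta> x) X = 1"
  using fin by (simp add: \<delta>_def)

lemma delta_inj: "\<delta> x = \<delta> y \<Longrightarrow> x = y"
  by (metis (mono_tags) \<delta>_def zero_neq_one)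

lemma scale_span_subspace: "u \<in> carrier A \<Longrightarrow> subspace class_ring (range (\<lambda>c. c \<odot>\<^bsub>A\<^esub> u)) A"
proof (rule A.subspaceI)
  assume u: "u \<in> carrier A"
  show "\<zero>\<^bsub>A\<^esub> \<in> range (\<lambda>c. c \<odot>\<^bsub>A\<^esub> u)" using u A.scale_zero by (metis rangeI)
  show "a \<oplus>\<^bsub>A\<^esub> b \<in> range (\<lambda>c. c \<odot>\<^bsub>A\<^esub> u)"
    if "a \<in> range (\<lambda>c. c \<odot>\<^bsub>A\<^esub> u)" "b \<in> range (\<lambda>c. c \<odot>\<^bsub>A\<^esub> u)" for a b
    using that u by (auto simp flip: A.scale_add_left)
qed (auto simp: A.scale_scale)

text \<open>An \<open>e\<close>-monomial of degree \<open>\<delta> x\<close> has length one, hence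
  is \<open>e x\<close>; \<open>f\<close>-monomials have no positive entry in their degree, and
  Cartan elements have degree zero.\<close>

lemma wspace_e:
  assumes x: "x \<in> X" shows "wspace (\<delta> x) \<subseteq> range (\<lambda>c. c \<odot>\<^bsub>A\<^esub> e x)"
  unfolding wspace_def
proof (rule A.lspan_least[OF scale_span_subspace])
  show "e x \<in> carrier A" using x by simp
  then have "e x \<in> range (\<lambda>c. c \<odot>\<^bsub>A\<^esub> e x)" using A.scale_one by (metis rangeI)
  moreover have "u = e x" if "monomial e u (\<delta> x)" for u
    using monomial_support[OF that] sum_delta[OF x] delta_inj by auto
  moreover have "\<not> monomial f u (\<lambda>y. - \<delta> x y)" for u
  proof
    assume "monomial f u (\<lambda>y. - \<delta> x y)"
    then have "0 \<le> - \<delta> x x" using monomial_support by blast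
    then show False by (simp add: \<delta>_def)
  qed
  moreover have "\<delta> x \<noteq> (\<lambda>_. 0)" by (metis \<delta>_def zero_neq_one)
  ultimately show "weight_gens (\<delta> x) \<subseteq> range (\<lambda>c. c \<odot>\<^bsub>A\<^esub> e x)" by (auto simp: weight_gens_def)
qed

lemma wspace_f:
  assumes x: "x \<in> X" shows "wspace (\<lambda>y. - \<delta> x y) \<subseteq> range (\<lambda>c. c \<odot>\<^bsub>A\<^esub> f x)"
  unfolding wspace_def
proof (rule A.lspan_least[OF scale_span_subspace])
  show "f x \<in> carrier A" using x by simp
  then have "f x \<in> range (\<lambda>c. c \<odot>\<^bsub>A\<^esub> f x)" using A.scale_one by (metis rangeI)
  moreover have "u = f x" if "monomial f u (\<delta> x)" for u
    using monomial_support[OF that] sum_delta[OF x] delta_inj by auto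
  moreover have "\<not> monomial e u (\<lambda>y. - \<delta> x y)" for u
  proof
    assume "monomial e u (\<lambda>y. - \<delta> x y)"
    then have "0 \<le> - \<delta> x x" using monomial_support by blast
    then show False by (simp add: \<delta>_def)
  qed
  moreover have "(\<lambda>y. - \<delta> x y) \<noteq> (\<lambda>_. 0)"
  proof
    assume "(\<lambda>y. - \<delta> x y) = (\<lambda>_. 0)"
    from fun_cong[OF this, of x] show False by (simp add: \<delta>_def)
  qed
  ultimately show "weight_gens (\<lambda>y. - \<delta> x y) \<subseteq> range (\<lambda>c. c \<odot>\<^bsub>A\<^esub> f x)"
    by (auto simp: weight_gens_def)
qed

text \<open>Neither \<open>\<delta> x - \<delta> y\<close> nor its negative has all entries
  nonnegative, so no monomial has this degree. That \<open>s\<close> lies in every admissible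
  \<open>I\<close> rests on this.\<close>

lemma wspace_diff:
  assumes "x \<in> X" "y \<in> X" "x \<noteq> y" shows "wspace (\<lambda>z. \<delta> x z - \<delta> y z) \<subseteq> {\<zero>\<^bsub>A\<^esub>}"
  unfolding wspace_def
proof (rule A.lspan_least)
  show "subspace class_ring {\<zero>\<^bsub>A\<^esub>} A" using A.idealD(1)[OF A.zero_is_ideal] .
  have "\<not> monomial e u (\<lambda>z. \<delta> x z - \<delta> y z)" for u
  proof
    assume "monomial e u (\<lambda>z. \<delta> x z - \<delta> y z)"
    then have "0 \<le> \<delta> x y - \<delta> y y" using monomial_support by blast
    then show False using assms by (simp add: \<delta>_def)
  qed
  moreover have "\<not> monomial f u (\<lambda>z. - (\<delta> x z - \<delta> y z))" for u
  proof
    assume "monomial f u (\<lambda>z. - (\<delta> x z - \<delta> y z))"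
    then have "0 \<le> - (\<delta> x x - \<delta> y x)" using monomial_support by blast
    then show False using assms by (simp add: \<delta>_def)
  qed
  moreover have "(\<lambda>z. \<delta> x z - \<delta> y z) \<noteq> (\<lambda>_. 0)"
  proof
    assume "(\<lambda>z. \<delta> x z - \<delta> y z) = (\<lambda>_. 0)"
    from fun_cong[OF this, of x] show False using assms by (simp add: \<delta>_def)
  qed
  ultimately show "weight_gens (\<lambda>z. \<delta> x z - \<delta> y z) \<subseteq> {\<zero>\<^bsub>A\<^esub>}" by (auto simp: weight_gens_def)
qed

text \<open>The index set \<open>K\<close> lets one induction serve both all degrees and the nonzero
  ones. Components are total and vanish off \<open>N\<close>, so two decompositions can be added
  over \<open>N \<union> M\<close>.\<close>

lemma weight_decomposition:
  assumes "u \<in> A.lspan (\<Union>k\<in>K. weight_gens k)"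
  shows "\<exists>N c. finite N \<and> N \<subseteq> K \<and> (\<forall>k\<in>N. supported k) \<and> (\<forall>k. c k \<in> wspace k)
     \<and> (\<forall>k. k \<notin> N \<longrightarrow> c k = \<zero>\<^bsub>A\<^esub>) \<and> u = (\<Oplus>\<^bsub>A\<^esub>k\<in>N. c k)"
  using assms
proof (induction rule: A.lspan.induct)
  case (base u)
  then obtain k where k: "k \<in> K" "u \<in> weight_gens k" by blast
  then have u: "u \<in> wspace k" "u \<in> carrier A"
    using weight_gens_carrier by (auto simp: wspace_def intro: A.lspan.base)
  let ?c = "\<lambda>l. if l = k then u else \<zero>\<^bsub>A\<^esub>"
  have "u = (\<Oplus>\<^bsub>A\<^esub>l\<in>{k}. ?c l)" using u(2) by simp
  moreover have "\<forall>l. ?c l \<in> wspace l" using u(1) wspaceD(2) by simp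
  moreover have "supported k" using weight_gens_supported[OF k(2)] .
  ultimately show ?case using k(1)
    by (intro exI[of _ "{k}"] exI[of _ ?c]) simp
next
  case zero
  show ?case using wspaceD(2) by (intro exI[of _ "{}"] exI[of _ "\<lambda>_. \<zero>\<^bsub>A\<^esub>"]) simp
next
  case (add u w)
  then obtain N c M d where N: "finite N" "N \<subseteq> K" "\<forall>k\<in>N. supported k" "\<And>k. c k \<in> wspace k"
      "\<And>k. k \<notin> N \<Longrightarrow> c k = \<zero>\<^bsub>A\<^esub>" "u = (\<Oplus>\<^bsub>A\<^esub>k\<in>N. c k)"
    and M: "finite M" "M \<subseteq> K" "\<forall>k\<in>M. supported k" "\<And>k. d k \<in> wspace k"
      "\<And>k. k \<notin> M \<Longrightarrow> d k = \<zero>\<^bsub>A\<^esub>" "w = (\<Oplus>\<^bsub>A\<^esub>k\<in>M. d k)"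
    by (elim exE conjE) blast
  have cd: "\<And>k. c k \<in> carrier A" "\<And>k. d k \<in> carrier A" using N(4) M(4) wspaceD(1) by blast+
  have "(\<Oplus>\<^bsub>A\<^esub>k\<in>N. c k) = (\<Oplus>\<^bsub>A\<^esub>k\<in>N \<union> M. c k)"
    by (rule A.add.finprod_mono_neutral_cong_left) (use N M cd in auto)
  moreover have "(\<Oplus>\<^bsub>A\<^esub>k\<in>M. d k) = (\<Oplus>\<^bsub>A\<^esub>k\<in>N \<union> M. d k)"
    by (rule A.add.finprod_mono_neutral_cong_left) (use N M cd in auto)
  moreover have "(\<Oplus>\<^bsub>A\<^esub>k\<in>N \<union> M. c k \<oplus>\<^bsub>A\<^esub> d k) = (\<Oplus>\<^bsub>A\<^esub>k\<in>N \<union> M. c k) \<oplus>\<^bsub>A\<^esub> (\<Oplus>\<^bsub>A\<^esub>k\<in>N \<union> M. d k)"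
    by (rule A.finsum_addf) (use cd in auto)
  ultimately have "u \<oplus>\<^bsub>A\<^esub> w = (\<Oplus>\<^bsub>A\<^esub>k\<in>N \<union> M. c k \<oplus>\<^bsub>A\<^esub> d k)" using N(6) M(6) by simp
  moreover have "\<forall>k. c k \<oplus>\<^bsub>A\<^esub> d k \<in> wspace k" using N(4) M(4) wspaceD(3) by blast
  moreover have "\<forall>k. k \<notin> N \<union> M \<longrightarrow> c k \<oplus>\<^bsub>A\<^esub> d k = \<zero>\<^bsub>A\<^esub>" using N(5) M(5) by simp
  ultimately show ?case using N(1-3) M(1-3)
    by (intro exI[of _ "N \<union> M"] exI[of _ "\<lambda>k. c k \<oplus>\<^bsub>A\<^esub> d k"]) blast
next
  case (scale u a)
  then obtain N c where N: "finite N" "N \<subseteq> K" "\<forall>k\<in>N. supported k" "\<And>k. c k \<in> wspace k"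
      "\<And>k. k \<notin> N \<Longrightarrow> c k = \<zero>\<^bsub>A\<^esub>" "u = (\<Oplus>\<^bsub>A\<^esub>k\<in>N. c k)"
    by (elim exE conjE) blast
  have c: "\<And>k. c k \<in> carrier A" using N(4) wspaceD(1) by blast
  have "a \<odot>\<^bsub>A\<^esub> (\<Oplus>\<^bsub>A\<^esub>k\<in>N. c k) = (\<Oplus>\<^bsub>A\<^esub>k\<in>N. a \<odot>\<^bsub>A\<^esub> c k)"
    by (rule A.finsum_linear) (use N(1) c in \<open>auto simp: A.scale_add_right\<close>)
  then have "a \<odot>\<^bsub>A\<^esub> u = (\<Oplus>\<^bsub>A\<^esub>k\<in>N. a \<odot>\<^bsub>A\<^esub> c k)" using N(6) by simp
  moreover have "\<forall>k. a \<odot>\<^bsub>A\<^esub> c k \<in> wspace k" using N(4) wspaceD(4) by blast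
  moreover have "\<forall>k. k \<notin> N \<longrightarrow> a \<odot>\<^bsub>A\<^esub> c k = \<zero>\<^bsub>A\<^esub>" using N(5) by simp
  ultimately show ?case using N(1-3)
    by (intro exI[of _ N] exI[of _ "\<lambda>k. a \<odot>\<^bsub>A\<^esub> c k"]) blast
qed

lemma triangular_weight_gens: "triangular \<subseteq> (\<Union>k. weight_gens k)"
proof
  fix u assume "u \<in> triangular"
  then consider "u \<in> ct ` H" | k where "monomial e u k" | k where "monomial f u k"
    by (auto simp: triangular_def monomials_def)
  then show "u \<in> (\<Union>k. weight_gens k)"
  proof cases
    case 1 then show ?thesis by (auto simp: weight_gens_def)
  next
    case (2 k) then show ?thesis by (auto simp: weight_gens_def)
  next
    case (3 k)
    then have "u \<in> weight_gens (\<lambda>y. - k y)" by (simp add: weight_gens_def)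
    then show ?thesis by blast
  qed
qed

lemma weight_distinct:
  "supported k \<Longrightarrow> supported l \<Longrightarrow> k \<noteq> l \<Longrightarrow> \<exists>h\<in>H. wt k h \<noteq> wt l h"
  using wt_inj by blast

text \<open>An ideal is stable under the Cartan elements, and distinct supported degrees are
  separated by some \<open>h\<close>, so \<open>weight_components\<close> applies: ideals are graded
  by weight.\<close>

lemma ideal_weight_components:
  assumes V: "lie_ideal V A" and N: "finite N" "\<And>k. k \<in> N \<Longrightarrow> supported k"
    and c: "\<And>k. k \<in> N \<Longrightarrow> c k \<in> wspace k" and sum: "(\<Oplus>\<^bsub>A\<^esub>k\<in>N. c k) \<in> V" and k: "k \<in> N"
  shows "c k \<in> V"
proof (rule A.weight_components[where C = H and t = ct and \<omega> = wt, OF N(1) _ _ _ _ A.idealD(1)[OF V] _ sum k])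
  show "\<And>k. k \<in> N \<Longrightarrow> c k \<in> carrier A" using c wspaceD(1) by blast
  show "\<And>k l. \<lbrakk>k \<in> N; l \<in> N; k \<noteq> l\<rbrakk> \<Longrightarrow> \<exists>h\<in>H. wt k h \<noteq> wt l h" using weight_distinct N(2) by blast
  show "\<And>k h. k \<in> N \<Longrightarrow> h \<in> H \<Longrightarrow> brk A (ct h) (c k) = wt k h \<odot>\<^bsub>A\<^esub> c k"
    using wspace_weight c by blast
  show "\<And>h u. h \<in> H \<Longrightarrow> u \<in> V \<Longrightarrow> brk A (ct h) u \<in> V" using A.idealD(7)[OF V] by simp
qed simp

text \<open>Decompose \<open>u\<close> by degree. Applying \<open>ad (ct h) - \<mu> h\<close>
  componentwise shows that every component whose weight differs from \<open>\<mu>\<close> lies in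
  \<open>V\<close>. At most one degree remains; its component is the lift, and if there is none the
  lift is zero.\<close>

lemma weight_lift:
  assumes V: "lie_ideal V A" and u: "u \<in> carrier A"
    and weight: "\<And>h. h \<in> H \<Longrightarrow> brk A (ct h) u \<ominus>\<^bsub>A\<^esub> \<mu> h \<odot>\<^bsub>A\<^esub> u \<in> V"
  shows "\<exists>w\<in>carrier A. u \<ominus>\<^bsub>A\<^esub> w \<in> V \<and> (\<forall>h\<in>H. brk A (ct h) w = \<mu> h \<odot>\<^bsub>A\<^esub> w)
     \<and> (w = \<zero>\<^bsub>A\<^esub> \<or> (\<exists>k. supported k \<and> w \<in> wspace k \<and> (\<forall>h\<in>H. wt k h = \<mu> h)))"
proof -
  note VD = A.idealD[OF V]
  have "u \<in> A.lspan (\<Union>k\<in>UNIV. weight_gens k)"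
    using A.lspan_mono[OF triangular_weight_gens triangular_decomposition[OF u]] .
  from weight_decomposition[OF this]
  obtain N c where N: "finite N" "\<And>k. k \<in> N \<Longrightarrow> supported k" "\<And>k. c k \<in> wspace k"
    "u = (\<Oplus>\<^bsub>A\<^esub>k\<in>N. c k)"
    by (elim exE conjE) blast
  have cc: "\<And>k. c k \<in> carrier A" using N(3) wspaceD(1) by blast
  have in_V: "c k \<in> V" if k: "k \<in> N" and h: "h \<in> H" "wt k h \<noteq> \<mu> h" for k h
  proof -
    define T where "T u = brk A (ct h) u \<ominus>\<^bsub>A\<^esub> \<mu> h \<odot>\<^bsub>A\<^esub> u" for u
    have Tc: "T (c k) = (wt k h - \<mu> h) \<odot>\<^bsub>A\<^esub> c k" for k
      using wspace_weight[OF N(3) h(1)] cc by (simp add: T_def A.scale_minus_left)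
    have "T u = (\<Oplus>\<^bsub>A\<^esub>k\<in>N. T (c k))"
      unfolding N(4)
      by (rule A.finsum_linear)
        (use N(1) cc h(1) in \<open>auto simp: T_def A.brk_add_right A.scale_add_right A.diff_simps\<close>)
    then have "(\<Oplus>\<^bsub>A\<^esub>k\<in>N. T (c k)) \<in> V" using weight[OF h(1)] by (simp add: T_def)
    moreover have "T (c k) \<in> wspace k" for k using Tc wspaceD(4) N(3) by simp
    ultimately have "T (c k) \<in> V" using ideal_weight_components[OF V N(1,2), of "\<lambda>k. T (c k)" k] k by blast
    then have "inverse (wt k h - \<mu> h) \<odot>\<^bsub>A\<^esub> ((wt k h - \<mu> h) \<odot>\<^bsub>A\<^esub> c k) \<in> V"
      using VD(5) Tc by simp
    moreover have "wt k h - \<mu> h \<noteq> 0" using h(2) by simp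
    ultimately show "c k \<in> V" using cc by (simp add: A.scale_scale)
  qed
  show ?thesis
  proof (cases "\<exists>k\<in>N. \<forall>h\<in>H. wt k h = \<mu> h")
    case True
    then obtain k where k: "k \<in> N" "\<And>h. h \<in> H \<Longrightarrow> wt k h = \<mu> h" by blast
    have "c l \<in> V" if l: "l \<in> N - {k}" for l
    proof -
      have "l \<noteq> k" "supported l" "supported k" using l k N(2) by auto
      then obtain h where "h \<in> H" "wt l h \<noteq> wt k h" using weight_distinct by blast
      then show ?thesis using in_V[of l h] l k by auto
    qed
    then have s: "(\<Oplus>\<^bsub>A\<^esub>l\<in>N - {k}. c l) \<in> V" using N(1) by (intro A.finsum_in_subspace[OF VD(1)]) auto
    have "insert k (N - {k}) = N" using k(1) by auto
    then have "u = c k \<oplus>\<^bsub>A\<^esub> (\<Oplus>\<^bsub>A\<^esub>l\<in>N - {k}. c l)"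
      using A.finsum_insert[of "N - {k}" k c] N(1,4) cc by auto
    moreover have "(\<Oplus>\<^bsub>A\<^esub>l\<in>N - {k}. c l) \<in> carrier A" using s VD(2) by auto
    ultimately have "u \<ominus>\<^bsub>A\<^esub> c k = (\<Oplus>\<^bsub>A\<^esub>l\<in>N - {k}. c l)" using cc by (simp add: A.diff_simps)
    then have "u \<ominus>\<^bsub>A\<^esub> c k \<in> V" using s by simp
    moreover have "\<forall>h\<in>H. brk A (ct h) (c k) = \<mu> h \<odot>\<^bsub>A\<^esub> c k" using wspace_weight[OF N(3)] k(2) by simp
    ultimately show ?thesis using cc N(2,3) k by blast
  next
    case False
    then have "c k \<in> V" if "k \<in> N" for k using in_V that by blast
    then have "u \<in> V" unfolding N(4) using N(1) by (intro A.finsum_in_subspace[OF VD(1)])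
    then show ?thesis using u by (intro bexI[of _ "\<zero>\<^bsub>A\<^esub>"]) auto
  qed
qed

text \<open>Cartan elements are even, so both parity components of a lift are again weight vectors,
  and gradedness of \<open>V\<close> shows that the component of parity \<open>i\<close> is already
  a lift of \<open>u\<close>.\<close>

lemma weight_lift_homogeneous:
  assumes V: "lie_ideal V A" and u: "u \<in> part A i"
    and weight: "\<And>h. h \<in> H \<Longrightarrow> brk A (ct h) u \<ominus>\<^bsub>A\<^esub> \<mu> h \<odot>\<^bsub>A\<^esub> u \<in> V"
  shows "\<exists>w\<in>part A i. u \<ominus>\<^bsub>A\<^esub> w \<in> V \<and> (\<forall>h\<in>H. brk A (ct h) w = \<mu> h \<odot>\<^bsub>A\<^esub> w)"
proof -
  note VD = A.idealD[OF V]
  obtain w where w: "w \<in> carrier A" "u \<ominus>\<^bsub>A\<^esub> w \<in> V" "\<forall>h\<in>H. brk A (ct h) w = \<mu> h \<odot>\<^bsub>A\<^esub> w"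
    using weight_lift[OF V _ weight] u by blast
  obtain w0 w1 where ws: "w0 \<in> part A 0" "w1 \<in> part A 1" "w = w0 \<oplus>\<^bsub>A\<^esub> w1"
    using A.part_sum[OF w(1)] by blast
  have c: "w0 \<in> carrier A" "w1 \<in> carrier A" "u \<in> carrier A" using ws u by auto
  have wt: "brk A (ct h) w0 = \<mu> h \<odot>\<^bsub>A\<^esub> w0 \<and> brk A (ct h) w1 = \<mu> h \<odot>\<^bsub>A\<^esub> w1" if h: "h \<in> H" for h
  proof -
    have p: "brk A (ct h) w0 \<in> part A 0" "brk A (ct h) w1 \<in> part A 1"
      using A.brk_part[OF ct_part[OF h] ws(1)] A.brk_part[OF ct_part[OF h] ws(2)] by auto
    have "brk A (ct h) w0 \<oplus>\<^bsub>A\<^esub> brk A (ct h) w1 = \<mu> h \<odot>\<^bsub>A\<^esub> w0 \<oplus>\<^bsub>A\<^esub> \<mu> h \<odot>\<^bsub>A\<^esub> w1"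
      using bspec[OF w(3) h] ws(3) c h by (simp add: A.brk_add_right A.scale_add_right)
    then show ?thesis
      using A.part_unique[OF p(1) A.part_scale[OF ws(1)] p(2) A.part_scale[OF ws(2)]] by blast
  qed
  show ?thesis
  proof (cases "i = 0")
    case True
    have "u \<ominus>\<^bsub>A\<^esub> w = (u \<ominus>\<^bsub>A\<^esub> w0) \<oplus>\<^bsub>A\<^esub> ((- 1) \<odot>\<^bsub>A\<^esub> w1)"
      using ws(3) c by (simp add: A.diff_simps flip: A.neg_scale A.minus_eq)
    then have "u \<ominus>\<^bsub>A\<^esub> w0 \<in> V"
      using A.ideal_component(1)[OF V, of "u \<ominus>\<^bsub>A\<^esub> w0" "(- 1) \<odot>\<^bsub>A\<^esub> w1"] u True ws w(2) by auto
    then show ?thesis using wt ws True by blast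
  next
    case False
    then have i: "i = 1" by simp
    have "u \<ominus>\<^bsub>A\<^esub> w = ((- 1) \<odot>\<^bsub>A\<^esub> w0) \<oplus>\<^bsub>A\<^esub> (u \<ominus>\<^bsub>A\<^esub> w1)"
      using ws(3) c A.a_comm[of "(- 1) \<odot>\<^bsub>A\<^esub> w0" "u \<ominus>\<^bsub>A\<^esub> w1"]
      by (simp add: A.diff_simps flip: A.neg_scale A.minus_eq)
    then have "u \<ominus>\<^bsub>A\<^esub> w1 \<in> V"
      using A.ideal_component(2)[OF V, of "(- 1) \<odot>\<^bsub>A\<^esub> w0" "u \<ominus>\<^bsub>A\<^esub> w1"] u i ws w(2) by auto
    then show ?thesis using wt ws i by blast
  qed
qed

text \<open>This and the next three lemmas apply \<open>weight_lift\<close> to the weights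
  \<open>0\<close>, \<open>b x\<close>, \<open>- b x\<close> and \<open>b x - b y\<close>.
  Injectivity of \<open>wt\<close> identifies the degree of the lift, and the corresponding
  \<open>wspace\<close> lies in the Cartan subalgebra, a line, a line, and zero.\<close>

lemma weight_zero_mod:
  assumes V: "lie_ideal V A" and u: "u \<in> carrier A"
    and weight: "\<And>h. h \<in> H \<Longrightarrow> brk A (ct h) u \<in> V"
  shows "\<exists>h\<in>H. u \<ominus>\<^bsub>A\<^esub> ct h \<in> V"
proof -
  have "brk A (ct h) u \<ominus>\<^bsub>A\<^esub> 0 \<odot>\<^bsub>A\<^esub> u \<in> V" if "h \<in> H" for h
    using weight[OF that] that u by simp
  from weight_lift[OF V u, of "\<lambda>_. 0", OF this]
  obtain w where w: "w \<in> carrier A" "u \<ominus>\<^bsub>A\<^esub> w \<in> V"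
    and *: "w = \<zero>\<^bsub>A\<^esub> \<or> (\<exists>k. supported k \<and> w \<in> wspace k \<and> (\<forall>h\<in>H. wt k h = 0))" by blast
  have "w \<in> ct ` H"
    using *
  proof
    assume "w = \<zero>\<^bsub>A\<^esub>" then show ?thesis using A.subspaceD(2)[OF ct_image_subspace] by simp
  next
    assume "\<exists>k. supported k \<and> w \<in> wspace k \<and> (\<forall>h\<in>H. wt k h = 0)"
    then obtain k where k: "supported k" "w \<in> wspace k" "\<forall>h\<in>H. wt k h = 0" by blast
    have "k = (\<lambda>_. 0)" by (rule wt_inj) (use k in \<open>auto simp: supported_def\<close>)
    then show ?thesis using k(2) wspace_zero by auto
  qed
  then show ?thesis using w(2) by auto
qed

lemma weight_e_mod:
  assumes V: "lie_ideal V A" and u: "u \<in> carrier A" and x: "x \<in> X"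
    and weight: "\<And>h. h \<in> H \<Longrightarrow> brk A (ct h) u \<ominus>\<^bsub>A\<^esub> bv v x h \<odot>\<^bsub>A\<^esub> u \<in> V"
  shows "\<exists>c. u \<ominus>\<^bsub>A\<^esub> c \<odot>\<^bsub>A\<^esub> e x \<in> V"
proof -
  from weight_lift[OF V u weight]
  obtain w where w: "w \<in> carrier A" "u \<ominus>\<^bsub>A\<^esub> w \<in> V"
    and *: "w = \<zero>\<^bsub>A\<^esub> \<or> (\<exists>k. supported k \<and> w \<in> wspace k \<and> (\<forall>h\<in>H. wt k h = bv v x h))" by blast
  have "w \<in> range (\<lambda>c. c \<odot>\<^bsub>A\<^esub> e x)"
    using *
  proof
    assume "w = \<zero>\<^bsub>A\<^esub>" then show ?thesis using A.subspaceD(2)[OF scale_span_subspace] x by simp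
  next
    assume "\<exists>k. supported k \<and> w \<in> wspace k \<and> (\<forall>h\<in>H. wt k h = bv v x h)"
    then obtain k where k: "supported k" "w \<in> wspace k" "\<forall>h\<in>H. wt k h = bv v x h" by blast
    have "k = \<delta> x" by (rule wt_inj) (use k x in \<open>auto simp: supported_def \<delta>_def wt_delta[unfolded \<delta>_def]\<close>)
    then show ?thesis using k(2) wspace_e[OF x] by auto
  qed
  then show ?thesis using w(2) by auto
qed

lemma weight_f_mod:
  assumes V: "lie_ideal V A" and u: "u \<in> carrier A" and x: "x \<in> X"
    and weight: "\<And>h. h \<in> H \<Longrightarrow> brk A (ct h) u \<ominus>\<^bsub>A\<^esub> (- bv v x h) \<odot>\<^bsub>A\<^esub> u \<in> V"
  shows "\<exists>c. u \<ominus>\<^bsub>A\<^esub> c \<odot>\<^bsub>A\<^esub> f x \<in> V"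
proof -
  from weight_lift[OF V u, of "\<lambda>h. - bv v x h", OF weight]
  obtain w where w: "w \<in> carrier A" "u \<ominus>\<^bsub>A\<^esub> w \<in> V"
    and *: "w = \<zero>\<^bsub>A\<^esub> \<or> (\<exists>k. supported k \<and> w \<in> wspace k \<and> (\<forall>h\<in>H. wt k h = - bv v x h))" by blast
  have "w \<in> range (\<lambda>c. c \<odot>\<^bsub>A\<^esub> f x)"
    using *
  proof
    assume "w = \<zero>\<^bsub>A\<^esub>" then show ?thesis using A.subspaceD(2)[OF scale_span_subspace] x by simp
  next
    assume "\<exists>k. supported k \<and> w \<in> wspace k \<and> (\<forall>h\<in>H. wt k h = - bv v x h)"
    then obtain k where k: "supported k" "w \<in> wspace k" "\<forall>h\<in>H. wt k h = - bv v x h" by blast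
    have "k = (\<lambda>y. - \<delta> x y)"
    proof (rule wt_inj[OF k(1)])
      show "supported (\<lambda>y. - \<delta> x y)" using x by (auto simp: supported_def \<delta>_def)
      show "wt k h = wt (\<lambda>y. - \<delta> x y) h" if "h \<in> H" for h
        using k(3) that x by (simp add: wt_minus wt_delta)
    qed
    then show ?thesis using k(2) wspace_f[OF x] by auto
  qed
  then show ?thesis using w(2) by auto
qed

lemma weight_diff_mod:
  assumes V: "lie_ideal V A" and u: "u \<in> carrier A" and xy: "x \<in> X" "y \<in> X" "x \<noteq> y"
    and weight: "\<And>h. h \<in> H \<Longrightarrow> brk A (ct h) u \<ominus>\<^bsub>A\<^esub> (bv v x h - bv v y h) \<odot>\<^bsub>A\<^esub> u \<in> V"
  shows "u \<in> V"
proof -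
  from weight_lift[OF V u, of "\<lambda>h. bv v x h - bv v y h", OF weight]
  obtain w where w: "w \<in> carrier A" "u \<ominus>\<^bsub>A\<^esub> w \<in> V"
    and *: "w = \<zero>\<^bsub>A\<^esub> \<or> (\<exists>k. supported k \<and> w \<in> wspace k \<and> (\<forall>h\<in>H. wt k h = bv v x h - bv v y h))"
    by blast
  have "w = \<zero>\<^bsub>A\<^esub>"
    using *
  proof
    assume "\<exists>k. supported k \<and> w \<in> wspace k \<and> (\<forall>h\<in>H. wt k h = bv v x h - bv v y h)"
    then obtain k where k: "supported k" "w \<in> wspace k" "\<forall>h\<in>H. wt k h = bv v x h - bv v y h" by blast
    have "k = (\<lambda>z. \<delta> x z - \<delta> y z)"
    proof (rule wt_inj[OF k(1)])
      show "supported (\<lambda>z. \<delta> x z - \<delta> y z)" using xy by (auto simp: supported_def \<delta>_def)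
      show "wt k h = wt (\<lambda>z. \<delta> x z - \<delta> y z) h" if "h \<in> H" for h
        using k(3) that xy wt_add[of "\<delta> x" "\<lambda>z. - \<delta> y z" h] by (simp add: wt_minus wt_delta)
    qed
    then show ?thesis using k(2) wspace_diff[OF xy] by auto
  qed
  then show ?thesis using w u by simp
qed

subsection \<open>The maximal ideal that avoids the Cartan subalgebra\<close>

definition nonzero_weights :: "('x, 'h) hb_gen lie_term set set" where
  "nonzero_weights = A.lspan (\<Union>k\<in>- {\<lambda>_. 0}. weight_gens k)"

lemma nonzero_weights_subspace: "subspace class_ring nonzero_weights A"
  unfolding nonzero_weights_def using weight_gens_carrier by (intro A.lspan_subspace) blast

lemma nonzero_weights_cart: "nonzero_weights \<inter> ct ` H \<subseteq> {\<zero>\<^bsub>A\<^esub>}"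
proof
  fix u assume u: "u \<in> nonzero_weights \<inter> ct ` H"
  then obtain h where h: "h \<in> H" "u = ct h" by blast
  from u weight_decomposition[of u "- {\<lambda>_. 0}"]
  obtain N c where N: "finite N" "N \<subseteq> - {\<lambda>_. 0}" "\<forall>k\<in>N. supported k" "\<And>k. c k \<in> wspace k"
    "u = (\<Oplus>\<^bsub>A\<^esub>k\<in>N. c k)"
    unfolding nonzero_weights_def by blast
  have cc: "\<And>k. c k \<in> carrier A" using N(4) wspaceD(1) by blast
  let ?z = "\<lambda>_. 0 :: int"
  have u0: "u \<in> wspace ?z" using h unfolding wspace_def weight_gens_def by (intro A.lspan.base) auto
  \<comment> \<open>Moving \<open>u\<close> to the other side gives a decomposition of zero with
    \<open>- u\<close> in degree 0. All its components then lie in the zero ideal.\<close>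
  define d where "d k = (if k = ?z then (- 1) \<odot>\<^bsub>A\<^esub> u else c k)" for k
  have uc: "u \<in> carrier A" using h by simp
  have dN: "(\<Oplus>\<^bsub>A\<^esub>k\<in>N. d k) = (\<Oplus>\<^bsub>A\<^esub>k\<in>N. c k)"
    by (rule A.finsum_cong') (use N(2) cc in \<open>auto simp: d_def\<close>)
  have "?z \<notin> N" using N(2) by blast
  moreover have "d \<in> N \<rightarrow> carrier A" "d ?z \<in> carrier A" using cc uc by (auto simp: d_def)
  ultimately have "(\<Oplus>\<^bsub>A\<^esub>k\<in>insert ?z N. d k) = d ?z \<oplus>\<^bsub>A\<^esub> (\<Oplus>\<^bsub>A\<^esub>k\<in>N. d k)"
    using N(1) by (intro A.finsum_insert)
  also have "\<dots> = (- 1) \<odot>\<^bsub>A\<^esub> u \<oplus>\<^bsub>A\<^esub> u" using N(5) dN by (simp add: d_def)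
  also have "\<dots> = \<zero>\<^bsub>A\<^esub>" using uc A.neg_scale[OF uc] A.l_neg[OF uc] by simp
  finally have "(\<Oplus>\<^bsub>A\<^esub>k\<in>insert ?z N. d k) \<in> {\<zero>\<^bsub>A\<^esub>}" by simp
  moreover have "d k \<in> wspace k" for k using N(4) u0 wspaceD(4) by (simp add: d_def)
  moreover have "supported k" if "k \<in> insert ?z N" for k using that N(3) by (auto simp: supported_def)
  ultimately have "d ?z \<in> {\<zero>\<^bsub>A\<^esub>}"
    using ideal_weight_components[OF A.zero_is_ideal, of "insert ?z N" d ?z] N(1) by blast
  then show "u \<in> {\<zero>\<^bsub>A\<^esub>}" using A.scale_eq_zero[OF uc, of "- 1"] by (simp add: d_def)
qed

text \<open>Since \<open>I\<close> is graded by weight, the degree 0 component of an element of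
  \<open>I\<close> lies both in \<open>I\<close> and in the Cartan subalgebra, so it
  vanishes.\<close>

lemma cartan_free_nonzero_weights:
  assumes I: "cartan_free_ideal X v I"
  shows "I \<subseteq> nonzero_weights"
proof
  fix u assume u: "u \<in> I"
  have ideal: "lie_ideal I A" and free: "I \<inter> ct ` H = {\<zero>\<^bsub>A\<^esub>}"
    using I by (auto simp: cartan_free_ideal_def)
  note ID = A.idealD[OF ideal]
  have "u \<in> A.lspan (\<Union>k\<in>UNIV. weight_gens k)"
    using A.lspan_mono[OF triangular_weight_gens triangular_decomposition] ID(2) u by blast
  from weight_decomposition[OF this]
  obtain N c where N: "finite N" "\<And>k. k \<in> N \<Longrightarrow> supported k" "\<And>k. c k \<in> wspace k"
    "u = (\<Oplus>\<^bsub>A\<^esub>k\<in>N. c k)"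
    by (elim exE conjE) blast
  have "c k \<in> nonzero_weights" if k: "k \<in> N" for k
  proof (cases "k = (\<lambda>_. 0)")
    case True
    have "c k \<in> I" using ideal_weight_components[OF ideal N(1,2,3)] N(4) u k by blast
    moreover have "c k \<in> ct ` H" using N(3)[of k] wspace_zero True by auto
    ultimately have "c k = \<zero>\<^bsub>A\<^esub>" using free by blast
    then show ?thesis by (simp add: nonzero_weights_def A.lspan.zero)
  next
    case False
    then show ?thesis using N(3)[of k] A.lspan_mono[of "weight_gens k" "\<Union>k\<in>- {\<lambda>_. 0}. weight_gens k"]
      unfolding nonzero_weights_def wspace_def by blast
  qed
  then show "u \<in> nonzero_weights" unfolding N(4)
    using N(1) by (intro A.finsum_in_subspace[OF nonzero_weights_subspace])
qed

lemma lspan_Union_ideal: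
  assumes I: "\<And>I. I \<in> \<I> \<Longrightarrow> lie_ideal I A"
  shows "lie_ideal (A.lspan (\<Union>\<I>)) A"
proof -
  have S: "\<Union>\<I> \<subseteq> carrier A" using A.idealD(2)[OF I] by blast
  let ?S = "A.lspan (\<Union>\<I>)"
  note sub = A.lspan_subspace[OF S]
  show ?thesis
    unfolding lie_ideal_def
  proof (intro conjI ballI)
    show "subspace class_ring ?S A" by (rule sub)
  next
    fix u w assume u: "u \<in> carrier A" and w: "w \<in> ?S"
    show "brk A u w \<in> ?S"
      by (rule A.brk_lspan[OF S sub u _ w]) (use A.idealD(7)[OF I u] in \<open>blast intro: A.lspan.base\<close>)
    show "brk A w u \<in> ?S"
      using w
    proof (induction rule: A.lspan.induct)
      case (base w)
      then show ?case using A.idealD(8)[OF I u] by (blast intro: A.lspan.base)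
    next
      case (add w w')
      then show ?case using A.lspan_carrier[OF S] u by (simp add: A.brk_add_left A.lspan.add)
    next
      case (scale w c)
      then show ?case using A.lspan_carrier[OF S] u by (simp add: A.brk_smult_left A.lspan.scale)
    qed (use u in \<open>simp add: A.lspan.zero\<close>)
  next
    fix w assume "w \<in> ?S"
    then show "\<exists>w0\<in>?S \<inter> part A 0. \<exists>w1\<in>?S \<inter> part A 1. w = w0 \<oplus>\<^bsub>A\<^esub> w1"
    proof (induction rule: A.lspan.induct)
      case (base w)
      then obtain I where I': "I \<in> \<I>" "w \<in> I" by blast
      from A.idealD(9)[OF I[OF I'(1)] I'(2)] show ?case
        using I'(1) by (blast intro: A.lspan.base)
    next
      case zero
      then show ?case by (intro bexI[of _ "\<zero>\<^bsub>A\<^esub>"]) (auto intro: A.lspan.zero)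
    next
      case (add u w)
      then obtain u0 u1 w0 w1 where *: "u0 \<in> ?S" "u1 \<in> ?S" "w0 \<in> ?S" "w1 \<in> ?S"
        "u0 \<in> part A 0" "u1 \<in> part A 1" "w0 \<in> part A 0" "w1 \<in> part A 1"
        "u = u0 \<oplus>\<^bsub>A\<^esub> u1" "w = w0 \<oplus>\<^bsub>A\<^esub> w1" by blast
      then have "u \<oplus>\<^bsub>A\<^esub> w = (u0 \<oplus>\<^bsub>A\<^esub> w0) \<oplus>\<^bsub>A\<^esub> (u1 \<oplus>\<^bsub>A\<^esub> w1)"
        by (simp add: A.a_ac)
      moreover have "u0 \<oplus>\<^bsub>A\<^esub> w0 \<in> ?S \<inter> part A 0" "u1 \<oplus>\<^bsub>A\<^esub> w1 \<in> ?S \<inter> part A 1"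
        using * by (simp_all add: A.lspan.add A.part_add)
      ultimately show ?case by blast
    next
      case (scale u c)
      then obtain u0 u1 where *: "u0 \<in> ?S" "u1 \<in> ?S" "u0 \<in> part A 0" "u1 \<in> part A 1"
        "u = u0 \<oplus>\<^bsub>A\<^esub> u1" by blast
      then have "c \<odot>\<^bsub>A\<^esub> u = c \<odot>\<^bsub>A\<^esub> u0 \<oplus>\<^bsub>A\<^esub> c \<odot>\<^bsub>A\<^esub> u1" by (simp add: A.scale_add_right)
      moreover have "c \<odot>\<^bsub>A\<^esub> u0 \<in> ?S \<inter> part A 0" "c \<odot>\<^bsub>A\<^esub> u1 \<in> ?S \<inter> part A 1"
        using * by (simp_all add: A.lspan.scale A.part_scale)
      ultimately show ?case by blast
    qed
  qed
qed

text \<open>The sum of all Cartan-free ideals still lies in \<open>nonzero_weights\<close> and is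
  therefore Cartan-free itself. So the \<open>GREATEST\<close> in the definition of
  \<open>r_ideal\<close> is attained, without which nothing could be derived from it.\<close>

lemma r_ideal:
  shows "cartan_free_ideal X v (r_ideal X v)"
    and "cartan_free_ideal X v I \<Longrightarrow> I \<subseteq> r_ideal X v"
proof -
  let ?R = "A.lspan (\<Union>{I. cartan_free_ideal X v I})"
  have "?R \<subseteq> nonzero_weights"
    using cartan_free_nonzero_weights by (intro A.lspan_least[OF nonzero_weights_subspace]) blast
  moreover have "\<zero>\<^bsub>A\<^esub> \<in> ct ` H" using A.subspaceD(2)[OF ct_image_subspace] .
  ultimately have "?R \<inter> ct ` H = {\<zero>\<^bsub>A\<^esub>}" using nonzero_weights_cart A.lspan.zero by blast
  moreover have "lie_ideal ?R A" by (rule lspan_Union_ideal) (simp add: cartan_free_ideal_def)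
  ultimately have 1: "cartan_free_ideal X v ?R" by (simp add: cartan_free_ideal_def)
  have 2: "I \<subseteq> ?R" if "cartan_free_ideal X v I" for I
    using that by (blast intro: A.lspan.base)
  have "r_ideal X v = ?R" unfolding r_ideal_def using 1 2 by (intro Greatest_equality) blast+
  then show "cartan_free_ideal X v (r_ideal X v)" "cartan_free_ideal X v I \<Longrightarrow> I \<subseteq> r_ideal X v"
    using 1 2 by simp_all
qed

end


section \<open>Non-degeneracy of the Cartan subalgebra\<close>

text \<open>A coordinate functional of a finite basis: \<open>a\<close> is nonzero, so one of its
  coordinates is.\<close>

lemma exists_nonvanishing_functional:
  fixes V :: "(complex, 'h) module"
  assumes vs: "vectorspace class_ring V" and fd: "vectorspace.fin_dim class_ring V"
    and a: "a \<in> carrier V" "a \<noteq> \<zero>\<^bsub>V\<^esub>"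
  shows "\<exists>l :: 'h \<Rightarrow> complex. (\<forall>h\<in>carrier V. \<forall>k\<in>carrier V. l (h \<oplus>\<^bsub>V\<^esub> k) = l h + l k)
     \<and> (\<forall>c. \<forall>h\<in>carrier V. l (c \<odot>\<^bsub>V\<^esub> h) = c * l h) \<and> l a \<noteq> 0"
proof -
  interpret V: vectorspace class_ring V by fact
  obtain B where B: "finite B" "V.basis B" using V.finite_basis_exists[OF fd] by blast
  have BV: "B \<subseteq> carrier V" using B(2) by (simp add: V.basis_def)
  have uniq: "\<exists>!c. c \<in> B \<rightarrow>\<^sub>E UNIV \<and> V.lincomb c B = h" if "h \<in> carrier V" for h
    using V.basis_criterion[OF B(1) BV] B(2) that by simp
  define co where "co h = (THE c. c \<in> B \<rightarrow>\<^sub>E UNIV \<and> V.lincomb c B = h)" for h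
  have co: "co h \<in> B \<rightarrow>\<^sub>E UNIV" "V.lincomb (co h) B = h" if "h \<in> carrier V" for h
    using theI'[OF uniq[OF that]] by (simp_all add: co_def)
  have co_eq: "co h b = c b" if "h \<in> carrier V" "V.lincomb c B = h" "b \<in> B" for h c b
  proof -
    have "V.lincomb (restrict c B) B = V.lincomb c B"
      by (rule V.lincomb_cong) (use BV in auto)
    then have "restrict c B \<in> B \<rightarrow>\<^sub>E UNIV \<and> V.lincomb (restrict c B) B = h" using that(2) by simp
    then have "co h = restrict c B" unfolding co_def by (rule the1_equality[OF uniq[OF that(1)]])
    then show ?thesis using that(3) by simp
  qed
  have add: "co (h \<oplus>\<^bsub>V\<^esub> k) b = co h b + co k b" if "h \<in> carrier V" "k \<in> carrier V" "b \<in> B" for h k b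
  proof (rule co_eq)
    show "V.lincomb (\<lambda>b. co h b + co k b) B = h \<oplus>\<^bsub>V\<^esub> k"
      using V.lincomb_sum[OF B(1) BV, of "co h" "co k"] co(2)[OF that(1)] co(2)[OF that(2)] by simp
  qed (use that in simp_all)
  have scale: "co (c \<odot>\<^bsub>V\<^esub> h) b = c * co h b" if "h \<in> carrier V" "b \<in> B" for h c b
  proof (rule co_eq)
    show "V.lincomb (\<lambda>b. c * co h b) B = c \<odot>\<^bsub>V\<^esub> h"
      using V.lincomb_smult[OF BV, of "co h" c] co(2)[OF that(1)] by simp
    show "c \<odot>\<^bsub>V\<^esub> h \<in> carrier V" using that V.smult_closed[of c h] by simp
  qed (use that in simp_all)
  have "\<exists>b\<in>B. co a b \<noteq> 0"
  proof (rule ccontr)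
    assume *: "\<not> (\<exists>b\<in>B. co a b \<noteq> 0)"
    have "V.lincomb (co a) B = V.lincomb (\<lambda>b. 0 * co a b) B"
      by (rule V.lincomb_cong) (use BV * in auto)
    also have "\<dots> = 0 \<odot>\<^bsub>V\<^esub> a"
      using V.lincomb_smult[OF BV, of "co a" 0] co(2)[OF a(1)] by simp
    also have "\<dots> = \<zero>\<^bsub>V\<^esub>" using V.lmult_0[OF a(1)] by simp
    finally show False using co(2)[OF a(1)] a(2) by simp
  qed
  then obtain b where "b \<in> B" "co a b \<noteq> 0" by blast
  then show ?thesis using add scale by (intro exI[of _ "\<lambda>h. co h b"]) simp
qed

section \<open>Linear operators on functions of words and their supercommutator\<close>

type_synonym 'x op = "('x list \<Rightarrow> complex) \<Rightarrow> 'x list \<Rightarrow> complex"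

definition op_linear :: "'x op \<Rightarrow> bool" where
  "op_linear T \<longleftrightarrow> (\<forall>\<phi> \<psi>. T (\<lambda>w. \<phi> w + \<psi> w) = (\<lambda>w. T \<phi> w + T \<psi> w))
     \<and> (\<forall>c \<phi>. T (\<lambda>w. c * \<phi> w) = (\<lambda>w. c * T \<phi> w))"

lemma op_linearD:
  assumes "op_linear T"
  shows "T (\<lambda>w. \<phi> w + \<psi> w) = (\<lambda>w. T \<phi> w + T \<psi> w)" "T (\<lambda>w. c * \<phi> w) = (\<lambda>w. c * T \<phi> w)"
    "T (\<lambda>w. \<phi> w - \<psi> w) = (\<lambda>w. T \<phi> w - T \<psi> w)" "T (\<lambda>w. - \<phi> w) = (\<lambda>w. - T \<phi> w)"
    "T (\<lambda>w. \<phi> w * c) = (\<lambda>w. T \<phi> w * c)"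
proof -
  show 1: "T (\<lambda>w. \<phi> w + \<psi> w) = (\<lambda>w. T \<phi> w + T \<psi> w)"
    and 2: "T (\<lambda>w. c * \<phi> w) = (\<lambda>w. c * T \<phi> w)" for \<phi> \<psi> c
    using assms unfolding op_linear_def by blast+
  show 3: "T (\<lambda>w. - \<phi> w) = (\<lambda>w. - T \<phi> w)" for \<phi> using 2[of "- 1" \<phi>] by simp
  show "T (\<lambda>w. \<phi> w - \<psi> w) = (\<lambda>w. T \<phi> w - T \<psi> w)" using 1[of \<phi> "\<lambda>w. - \<psi> w"] 3[of \<psi>] by simp
  show "T (\<lambda>w. \<phi> w * c) = (\<lambda>w. T \<phi> w * c)" using 2[of c \<phi>] by (simp add: mult.commute)
qed

lemma par_sign_square [simp]: "par_sign i * par_sign i = 1" "par_sign i * (par_sign i * c) = c"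
  by (simp_all add: par_sign_def)

lemma super_sign_square [simp]: "super_sign i j * super_sign i j = 1" "super_sign i j * (super_sign i j * c) = c"
  by (simp_all add: super_sign_def)

lemma super_sign_commute: "super_sign i j = super_sign j i"
  by (auto simp: super_sign_def)

locale word_module =
  fixes p :: "'x \<Rightarrow> bit"
begin

primrec word_sign :: "'x list \<Rightarrow> complex" where
  "word_sign [] = 1"
| "word_sign (x # w) = par_sign (p x) * word_sign w"

lemma word_sign_square [simp]: "word_sign w * word_sign w = 1" "word_sign w * (word_sign w * c) = c"
  by (induction w) (simp_all add: ac_simps)

text \<open>Conjugation by the grading involution \<open>word_sign\<close>. Even and odd operators
  are its eigenvectors for \<open>1\<close> and \<open>-1\<close>, which is how
  \<open>op_parity\<close> expresses parity.\<close>

definition conj_op :: "'x op \<Rightarrow> 'x op" where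
  "conj_op T \<phi> = (\<lambda>w. word_sign w * T (\<lambda>w. word_sign w * \<phi> w) w)"

text \<open>The sign rule for an operator of unknown parity: an operator of parity \<open>i\<close>
  passing \<open>T\<close> turns \<open>T\<close> into \<open>conj_pow i T\<close>. For
  \<open>T\<close> of parity \<open>j\<close> this is multiplication by
  \<open>super_sign i j\<close>.\<close>

definition conj_pow :: "bit \<Rightarrow> 'x op \<Rightarrow> 'x op" where
  "conj_pow i T = (if i = 1 then conj_op T else T)"

text \<open>
  The supercommutator of arbitrary operators, in terms of the even and odd parts
  \<open>(S \<plusminus> conj_op S) / 2\<close>.
\<close>

definition supercomm :: "'x op \<Rightarrow> 'x op \<Rightarrow> 'x op" where
  "supercomm S T \<phi> = (\<lambda>w. S (T \<phi>) w - (T (S \<phi>) w + T (conj_op S \<phi>) w) / 2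
     - (conj_op T (S \<phi>) w - conj_op T (conj_op S \<phi>) w) / 2)"

definition op_parity :: "'x op \<Rightarrow> bit \<Rightarrow> bool" where
  "op_parity T i \<longleftrightarrow> (\<forall>\<phi>. conj_op T \<phi> = (\<lambda>w. par_sign i * T \<phi> w))"

lemma conj_linear:
  assumes "op_linear T" shows "op_linear (conj_op T)"
  unfolding op_linear_def[of "conj_op T"] conj_op_def
proof (intro conjI allI)
  note T = op_linearD[OF assms]
  show "(\<lambda>w. word_sign w * T (\<lambda>w. word_sign w * (\<phi> w + \<psi> w)) w) = (\<lambda>w. word_sign w * T (\<lambda>w. word_sign w * \<phi> w) w
      + word_sign w * T (\<lambda>w. word_sign w * \<psi> w) w)" for \<phi> \<psi>
    by (simp only: distrib_left T(1))
  have c: "word_sign w * (c * z) = c * (word_sign w * z)" for w c z by (rule mult.left_commute)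
  show "(\<lambda>w. word_sign w * T (\<lambda>w. word_sign w * (c * \<phi> w)) w)
      = (\<lambda>w. c * (word_sign w * T (\<lambda>w. word_sign w * \<phi> w) w))" for c \<phi>
    by (simp only: c T(2))
qed

lemma conj_pow_linear: "op_linear T \<Longrightarrow> op_linear (conj_pow i T)"
  by (simp add: conj_pow_def conj_linear)

lemma conj_conj [simp]: "conj_op (conj_op T) = T"
  by (simp add: conj_op_def fun_eq_iff)

lemma conj_pow_add: "conj_pow (i + j) T = conj_pow i (conj_pow j T)"
  by (cases i; cases j) (simp_all add: conj_pow_def)

lemma conj_pow_commute: "conj_pow i (conj_pow j T) = conj_pow j (conj_pow i T)"
  by (simp add: conj_pow_def)

lemma conj_pow_parity: "op_parity T j \<Longrightarrow> conj_pow i T = (\<lambda>\<phi> w. super_sign i j * T \<phi> w)"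
  by (cases i; cases j) (auto simp: conj_pow_def op_parity_def super_sign_def par_sign_def)

lemma supercomm_linear:
  assumes "op_linear S" "op_linear T" shows "op_linear (supercomm S T)"
  unfolding op_linear_def supercomm_def
  using op_linearD[OF assms(1)] op_linearD[OF assms(2)] op_linearD[OF conj_linear[OF assms(1)]]
    op_linearD[OF conj_linear[OF assms(2)]]
  by (simp add: algebra_simps add_divide_distrib diff_divide_distrib)

lemma supercomm_homogeneous:
  assumes S: "op_parity S i" and T: "op_linear T"
  shows "supercomm S T \<phi> = (\<lambda>w. S (T \<phi>) w - conj_pow i T (S \<phi>) w)"
proof -
  have c: "conj_op S \<phi> = (\<lambda>w. par_sign i * S \<phi> w)" using S by (simp add: op_parity_def)
  show ?thesis unfolding supercomm_def c
    using op_linearD(4)[OF T] op_linearD(4)[OF conj_linear[OF T]]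
    by (cases i) (simp_all add: par_sign_def conj_pow_def)
qed

lemma conj_pow_supercomm:
  assumes B: "op_parity B j" "op_linear B" and C: "op_linear C"
  shows "conj_pow i (supercomm B C) \<phi>
    = (\<lambda>w. super_sign i j * (B (conj_pow i C \<phi>) w - conj_pow i (conj_pow j C) (B \<phi>) w))"
proof (cases "i = 0")
  case True
  then show ?thesis using supercomm_homogeneous[OF B(1) C] by (simp add: conj_pow_def super_sign_def)
next
  case False
  then have i: "i = 1" by simp
  have B': "word_sign w * B (\<lambda>w. word_sign w * \<phi> w) w = par_sign j * B \<phi> w" for w \<phi>
    using B(1) by (simp add: op_parity_def conj_op_def fun_eq_iff)
  have B'': "B (\<lambda>w. word_sign w * \<phi> w) = (\<lambda>w. word_sign w * (par_sign j * B \<phi> w))" for \<phi>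
  proof
    fix w
    have "word_sign w * (word_sign w * B (\<lambda>w. word_sign w * \<phi> w) w) = word_sign w * (par_sign j * B \<phi> w)"
      by (simp only: B')
    then show "B (\<lambda>w. word_sign w * \<phi> w) w = word_sign w * (par_sign j * B \<phi> w)" by simp
  qed
  have C': "C (\<lambda>w. word_sign w * \<phi> w) = (\<lambda>w. word_sign w * conj_op C \<phi> w)" for \<phi>
    by (simp add: conj_op_def fun_eq_iff)
  have L: "conj_op T (\<lambda>w. par_sign j * \<psi> w) = (\<lambda>w. par_sign j * conj_op T \<psi> w)" if "op_linear T" for T \<psi>
    using op_linearD(2)[OF conj_linear[OF that]] .
  have s: "super_sign 1 j = par_sign j" by (simp add: super_sign_def par_sign_def)
  show ?thesis
  proof
    fix w
    have "conj_pow i (supercomm B C) \<phi> w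
        = word_sign w * supercomm B C (\<lambda>w. word_sign w * \<phi> w) w"
      by (simp add: i conj_pow_def conj_op_def)
    also have "\<dots> = word_sign w * B (\<lambda>w. word_sign w * conj_op C \<phi> w) w
       - word_sign w * conj_pow j C (\<lambda>w. word_sign w * (par_sign j * B \<phi> w)) w"
      by (simp add: supercomm_homogeneous[OF B(1) C] B'' C' right_diff_distrib)
    also have "\<dots> = par_sign j * B (conj_op C \<phi>) w - conj_op (conj_pow j C) (\<lambda>w. par_sign j * B \<phi> w) w"
      using B'[of w "conj_op C \<phi>"] by (simp add: conj_op_def[of "conj_pow j C"])
    also have "\<dots> = par_sign j * (B (conj_op C \<phi>) w - conj_op (conj_pow j C) (B \<phi>) w)"
      by (simp add: L[OF conj_pow_linear[OF C]] right_diff_distrib)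
    finally show "conj_pow i (supercomm B C) \<phi> w
      = super_sign i j * (B (conj_pow i C \<phi>) w - conj_pow i (conj_pow j C) (B \<phi>) w)"
      by (simp add: i s conj_pow_def)
  qed
qed

lemma supercomm_parity:
  assumes S: "op_parity S i" and T: "op_parity T j" and lin: "op_linear S" "op_linear T"
  shows "op_parity (supercomm S T) (i + j)"
  unfolding op_parity_def
proof
  fix \<phi>
  have T': "op_parity (conj_pow i T) j"
    using T unfolding op_parity_def conj_pow_def by (cases i) simp_all
  have c: "conj_pow 1 T = (\<lambda>\<phi> w. par_sign j * T \<phi> w)" "conj_pow i T = (\<lambda>\<phi> w. super_sign i j * T \<phi> w)"
    "conj_pow 1 (conj_pow i T) = (\<lambda>\<phi> w. par_sign j * conj_pow i T \<phi> w)"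
    using conj_pow_parity[OF T, of 1] conj_pow_parity[OF T, of i] conj_pow_parity[OF T', of 1]
    by (simp_all add: super_sign_def par_sign_def)
  have "conj_op (supercomm S T) \<phi> = conj_pow 1 (supercomm S T) \<phi>" by (simp add: conj_pow_def)
  also have "\<dots> = (\<lambda>w. par_sign i * (S (conj_pow 1 T \<phi>) w - conj_pow 1 (conj_pow i T) (S \<phi>) w))"
    using conj_pow_supercomm[OF S lin, of 1] by (simp add: super_sign_def par_sign_def)
  also have "\<dots> = (\<lambda>w. par_sign i * par_sign j * (S (T \<phi>) w - conj_pow i T (S \<phi>) w))"
    using op_linearD(2)[OF lin(1)] by (simp only: c(1,3)) (simp add: algebra_simps)
  finally show "conj_op (supercomm S T) \<phi> = (\<lambda>w. par_sign (i + j) * supercomm S T \<phi> w)"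
    by (simp only: par_sign_add supercomm_homogeneous[OF S lin(2)])
qed

lemma supercomm_skew:
  assumes S: "op_parity S i" and T: "op_parity T j" and lin: "op_linear S" "op_linear T"
  shows "supercomm S T \<phi> = (\<lambda>w. - super_sign i j * supercomm T S \<phi> w)"
  by (simp add: supercomm_homogeneous[OF S lin(2)] supercomm_homogeneous[OF T lin(1)]
      conj_pow_parity[OF S] conj_pow_parity[OF T] super_sign_commute[of j i] algebra_simps)

text \<open>The third argument of the \<open>jacobi\<close> rule of \<open>lie_cong\<close> is an
  arbitrary term, so \<open>C\<close> has no parity here; the signs it would receive are carried by
  \<open>conj_pow\<close>. After expansion, both sides consist of the same compositions of
  operators.\<close>

lemma supercomm_jacobi:
  assumes A: "op_parity A i" "op_linear A" and B: "op_parity B j" "op_linear B" and C: "op_linear C"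
  shows "supercomm A (supercomm B C) \<phi>
    = (\<lambda>w. supercomm (supercomm A B) C \<phi> w + super_sign i j * supercomm B (supercomm A C) \<phi> w)"
proof -
  let ?s = "super_sign i j"
  note lin = op_linearD[OF A(2)] op_linearD[OF B(2)]
  have 1: "supercomm A (supercomm B C) \<phi> w = A (B (C \<phi>)) w - A (conj_pow j C (B \<phi>)) w
      - ?s * (B (conj_pow i C (A \<phi>)) w - conj_pow i (conj_pow j C) (B (A \<phi>)) w)" for w
    by (simp add: supercomm_homogeneous[OF A(1) supercomm_linear[OF B(2) C]]
        conj_pow_supercomm[OF B C] supercomm_homogeneous[OF B(1) C] lin)
  have 2: "supercomm B (supercomm A C) \<phi> w = B (A (C \<phi>)) w - B (conj_pow i C (A \<phi>)) w
      - ?s * (A (conj_pow j C (B \<phi>)) w - conj_pow i (conj_pow j C) (A (B \<phi>)) w)" for w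
    by (simp add: supercomm_homogeneous[OF B(1) supercomm_linear[OF A(2) C]]
        conj_pow_supercomm[OF A C] supercomm_homogeneous[OF A(1) C] lin super_sign_commute[of j i]
        conj_pow_commute[of j i])
  have AB: "supercomm A B \<psi> = (\<lambda>w. A (B \<psi>) w - ?s * B (A \<psi>) w)" for \<psi>
    by (simp add: supercomm_homogeneous[OF A(1) B(2)] conj_pow_parity[OF B(1)])
  have 3: "supercomm (supercomm A B) C \<phi> w = A (B (C \<phi>)) w - ?s * B (A (C \<phi>)) w
      - (conj_pow i (conj_pow j C) (A (B \<phi>)) w - ?s * conj_pow i (conj_pow j C) (B (A \<phi>)) w)" for w
    unfolding supercomm_homogeneous[OF supercomm_parity[OF A(1) B(1) A(2) B(2)] C]
    using op_linearD[OF conj_pow_linear[OF conj_pow_linear[OF C]], of i j]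
    by (simp only: conj_pow_add AB)
  show ?thesis by (rule ext) (simp add: 1 2 3 algebra_simps)
qed

end


text \<open>
  The dual of a Verma module of highest weight \<open>l\<close>: functions on words in \<open>X\<close>, on which \<open>E x\<close>
  acts by \<open>(E x \<phi>) w = \<phi> (x # w)\<close>; the recursion for \<open>F y\<close> is the relation for \<open>[E x, F y]\<close>.
\<close>

locale dual_verma = half_baked_alg X v + word_module "pv v"
  for X :: "'x set" and v :: "('x, 'h) root_datum" +
  fixes l :: "'h \<Rightarrow> complex"
  assumes l_add: "\<lbrakk>h \<in> carrier (hsp v); k \<in> carrier (hsp v)\<rbrakk> \<Longrightarrow> l (h \<oplus>\<^bsub>hsp v\<^esub> k) = l h + l k"
    and l_scale: "h \<in> carrier (hsp v) \<Longrightarrow> l (c \<odot>\<^bsub>hsp v\<^esub> h) = c * l h"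
begin

text \<open>Words run over the whole type. The value 0 off \<open>X\<close>, where
  \<open>bv v x\<close> is unspecified, keeps \<open>word_weight w\<close> linear for every
  word.\<close>

definition letter_weight :: "'x \<Rightarrow> 'h \<Rightarrow> complex" where
  "letter_weight x h = (if x \<in> X then bv v x h else 0)"

primrec word_weight :: "'x list \<Rightarrow> 'h \<Rightarrow> complex" where
  "word_weight [] h = l h"
| "word_weight (x # w) h = word_weight w h - letter_weight x h"

primrec lower :: "'x list \<Rightarrow> 'x \<Rightarrow> ('x list \<Rightarrow> complex) \<Rightarrow> complex" where
  "lower [] y \<phi> = 0"
| "lower (x # w) y \<phi> = (if x = y then word_weight w (av v y) * \<phi> w else 0)
     + super_sign (pv v x) (pv v y) * lower w y (\<lambda>u. \<phi> (x # u))"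

definition gen_op :: "('x, 'h) hb_gen \<Rightarrow> 'x op" where
  "gen_op g = (case g of Cart h \<Rightarrow> (\<lambda>\<phi> w. word_weight w h * \<phi> w) | E x \<Rightarrow> (\<lambda>\<phi> w. \<phi> (x # w))
     | F y \<Rightarrow> (\<lambda>\<phi> w. lower w y \<phi>))"

lemma gen_op_simps [simp]:
  "gen_op (Cart h) = (\<lambda>\<phi> w. word_weight w h * \<phi> w)" "gen_op (E x) = (\<lambda>\<phi> w. \<phi> (x # w))"
  "gen_op (F y) = (\<lambda>\<phi> w. lower w y \<phi>)"
  by (simp_all add: gen_op_def)

text \<open>Arguments of \<open>Brk\<close> need not be homogeneous, which is why
  \<open>supercomm\<close> is defined for all operators. The rules of \<open>lie_cong\<close> are
  verified directly for this evaluation, so the operators need not be packed into a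
  \<open>lie_super\<close> record.\<close>

primrec op_eval :: "('x, 'h) hb_gen lie_term \<Rightarrow> 'x op" where
  "op_eval (Gen g) = gen_op g"
| "op_eval Zero = (\<lambda>\<phi> w. 0)"
| "op_eval (Plus s t) = (\<lambda>\<phi> w. op_eval s \<phi> w + op_eval t \<phi> w)"
| "op_eval (Scale c t) = (\<lambda>\<phi> w. c * op_eval t \<phi> w)"
| "op_eval (Brk s t) = supercomm (op_eval s) (op_eval t)"

lemma word_weight_linear:
  assumes "h \<in> H" "k \<in> H"
  shows "word_weight w (h \<oplus>\<^bsub>hsp v\<^esub> k) = word_weight w h + word_weight w k"
    "word_weight w (c \<odot>\<^bsub>hsp v\<^esub> h) = c * word_weight w h"
  by (induction w) (use assms in \<open>simp_all add: l_add l_scale letter_weight_def bv_add bv_scale algebra_simps\<close>)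

lemma lower_linear:
  "lower w y (\<lambda>u. \<phi> u + \<psi> u) = lower w y \<phi> + lower w y \<psi>"
  "lower w y (\<lambda>u. c * \<phi> u) = c * lower w y \<phi>"
  by (induction w arbitrary: \<phi> \<psi>) (simp_all add: algebra_simps)

lemma gen_op_linear: "op_linear (gen_op g)"
  by (cases g) (simp_all add: op_linear_def lower_linear algebra_simps)

text \<open>\<open>lower w y\<close> reads its function only at words obtained by deleting one
  letter \<open>y\<close> from \<open>w\<close>, so the two factors \<open>word_sign\<close> differ
  by the sign of \<open>y\<close>.\<close>

lemma lower_parity:
  "word_sign w * lower w y (\<lambda>w. word_sign w * \<phi> w) = par_sign (pv v y) * lower w y \<phi>"
proof (induction w arbitrary: \<phi>)
  case (Cons x w)
  let ?s = "super_sign (pv v x) (pv v y)"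
  have 1: "lower w y (\<lambda>u. word_sign (x # u) * \<phi> (x # u))
      = par_sign (pv v x) * lower w y (\<lambda>u. word_sign u * \<phi> (x # u))"
    using lower_linear(2)[of w y "par_sign (pv v x)" "\<lambda>u. word_sign u * \<phi> (x # u)"]
    by (simp add: mult.assoc)
  have 2: "word_sign (x # w) * lower w y (\<lambda>u. word_sign (x # u) * \<phi> (x # u))
      = par_sign (pv v y) * lower w y (\<lambda>u. \<phi> (x # u))"
    using Cons.IH[of "\<lambda>u. \<phi> (x # u)"] unfolding 1 by (simp add: ac_simps)
  have 3: "word_sign (y # w) * (word_weight w (av v y) * (word_sign w * \<phi> w))
      = par_sign (pv v y) * (word_weight w (av v y) * \<phi> w)"
    by (simp add: ac_simps)
  have "word_sign (x # w) * lower (x # w) y (\<lambda>w. word_sign w * \<phi> w)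
      = (if x = y then word_sign (y # w) * (word_weight w (av v y) * (word_sign w * \<phi> w)) else 0)
        + ?s * (word_sign (x # w) * lower w y (\<lambda>u. word_sign (x # u) * \<phi> (x # u)))"
    by (simp add: algebra_simps)
  also have "\<dots> = par_sign (pv v y) * lower (x # w) y \<phi>"
    unfolding 2 3 by (simp add: algebra_simps)
  finally show ?case .
qed simp

lemma gen_op_parity: "op_parity (gen_op g) (hb_par v g)"
proof (cases g)
  case (Cart h)
  then show ?thesis by (simp add: op_parity_def conj_op_def par_sign_def ac_simps)
next
  case (E x)
  then show ?thesis by (simp add: op_parity_def conj_op_def ac_simps)
next
  case (F y)
  then show ?thesis by (simp add: op_parity_def conj_op_def lower_parity)
qed

lemma op_eval_linear: "op_linear (op_eval t)"
proof (induction t)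
  case (Plus s t)
  then show ?case
    unfolding op_linear_def[of "op_eval (Plus s t)"]
    by (simp add: op_linearD[OF Plus(1)] op_linearD[OF Plus(2)] algebra_simps)
next
  case (Scale c t)
  then show ?case
    unfolding op_linear_def[of "op_eval (Scale c t)"]
    by (simp add: op_linearD[OF Scale(1)] algebra_simps)
qed (simp_all add: gen_op_linear supercomm_linear op_linear_def[of "\<lambda>\<phi> w. 0"])

lemma op_eval_parity: "homog (hb_par v) t i \<Longrightarrow> op_parity (op_eval t) i"
proof (induction rule: homog.induct)
  case (5 s i t j)
  then show ?case using supercomm_parity[OF _ _ op_eval_linear op_eval_linear] by simp
qed (simp_all add: gen_op_parity, auto simp: op_parity_def conj_op_def fun_eq_iff algebra_simps)

text \<open>Deleting a letter \<open>y\<close> raises the weight of a word by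
  \<open>bv v y h\<close>; this is the relation for \<open>[h, f y]\<close>.\<close>

lemma lower_weight:
  assumes y: "y \<in> X" and h: "h \<in> H"
  shows "word_weight w h * lower w y \<phi> - lower w y (\<lambda>u. word_weight u h * \<phi> u)
    = - bv v y h * lower w y \<phi>"
proof (induction w arbitrary: \<phi>)
  case (Cons x w)
  let ?s = "super_sign (pv v x) (pv v y)"
  let ?\<psi> = "\<lambda>u. \<phi> (x # u)"
  have "lower w y (\<lambda>u. (word_weight u h - letter_weight x h) * ?\<psi> u)
      = lower w y (\<lambda>u. word_weight u h * ?\<psi> u + (- letter_weight x h) * ?\<psi> u)"
    by (simp add: algebra_simps)
  also have "\<dots> = lower w y (\<lambda>u. word_weight u h * ?\<psi> u) - letter_weight x h * lower w y ?\<psi>"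
    by (simp only: lower_linear) simp
  also have "lower w y (\<lambda>u. word_weight u h * ?\<psi> u) = word_weight w h * lower w y ?\<psi> + bv v y h * lower w y ?\<psi>"
    using Cons.IH[of ?\<psi>] by (simp add: algebra_simps)
  finally have 1: "lower w y (\<lambda>u. (word_weight u h - letter_weight x h) * ?\<psi> u)
    = (word_weight w h + bv v y h - letter_weight x h) * lower w y ?\<psi>" by (simp add: algebra_simps)
  have 2: "letter_weight y h = bv v y h" using y by (simp add: letter_weight_def)
  show ?case
    by (simp add: 1) (auto simp: 2 algebra_simps)
qed simp

lemma op_eval_rels:
  assumes "(s, t) \<in> hb_rels X v"
  shows "op_eval s = op_eval t"
proof -
  have cart: "supercomm (gen_op (Cart h)) T \<phi> w
      = word_weight w h * T \<phi> w - T (\<lambda>u. word_weight u h * \<phi> u) w" if "op_linear T" for h T \<phi> w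
    using supercomm_homogeneous[OF gen_op_parity[of "Cart h"] that] by (simp add: conj_pow_def)
  have ef: "supercomm (gen_op (E x)) (gen_op (F y)) \<phi> w
      = lower (x # w) y \<phi> - super_sign (pv v x) (pv v y) * lower w y (\<lambda>u. \<phi> (x # u))" for x y \<phi> w
    using supercomm_homogeneous[OF gen_op_parity[of "E x"] gen_op_linear[of "F y"]]
      conj_pow_parity[OF gen_op_parity[of "F y"], of "pv v x"] by simp
  from assms show ?thesis
  proof cases
    case (1 h k)
    then show ?thesis by (simp add: word_weight_linear algebra_simps)
  next
    case (2 h c)
    then show ?thesis by (simp add: word_weight_linear algebra_simps)
  next
    case (3 h k)
    then show ?thesis using cart[OF gen_op_linear[of "Cart k"]] by (simp add: fun_eq_iff del: gen_op_simps) simp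
  next
    case (4 h x)
    then show ?thesis using cart[OF gen_op_linear[of "E x"], of h]
      by (simp add: fun_eq_iff letter_weight_def algebra_simps)
  next
    case (5 h x)
    then show ?thesis using cart[OF gen_op_linear[of "F x"], of h] lower_weight[of x h]
      by (simp add: fun_eq_iff)
  next
    case (6 x y)
    then show ?thesis using ef[of x y] by (simp add: fun_eq_iff)
  next
    case (7 x)
    then show ?thesis using ef[of x x] by (simp add: fun_eq_iff)
  qed
qed

lemma op_eval_cong: "(s, t) \<in> lie_cong (hb_gens X v) (hb_par v) (hb_rels X v) \<Longrightarrow> op_eval s = op_eval t"
proof (induction rule: lie_cong.induct)
  case (rel s t)
  then show ?case by (simp add: op_eval_rels)
next
  case (skew s t i j)
  then show ?case
    using supercomm_skew[OF op_eval_parity op_eval_parity op_eval_linear op_eval_linear, of s i t j]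
    by (simp add: fun_eq_iff)
next
  case (jacobi s t u i j)
  then show ?case
    using supercomm_jacobi[OF op_eval_parity op_eval_linear op_eval_parity op_eval_linear op_eval_linear, of s i t j u]
    by (simp add: fun_eq_iff)
next
  case (brk_plus_left s t u)
  note L = op_linearD[OF op_eval_linear[of u]] op_linearD[OF conj_linear[OF op_eval_linear[of u]]]
  show ?case
    by (simp add: fun_eq_iff supercomm_def conj_op_def[of "\<lambda>\<phi> w. op_eval s \<phi> w + op_eval t \<phi> w"]
        distrib_left L flip: conj_op_def) (simp add: conj_op_def[of "op_eval s"] conj_op_def[of "op_eval t"] L field_simps)
next
  case (brk_plus_right s t u)
  note L = op_linearD[OF op_eval_linear[of s]]
  show ?case
    by (simp add: fun_eq_iff supercomm_def conj_op_def[of "\<lambda>\<phi> w. op_eval t \<phi> w + op_eval u \<phi> w"] L)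
      (simp add: conj_op_def[of "op_eval t"] conj_op_def[of "op_eval u"] field_simps)
next
  case (brk_scale_left s t c)
  note L = op_linearD[OF op_eval_linear[of t]] op_linearD[OF conj_linear[OF op_eval_linear[of t]]]
  have c: "conj_op (\<lambda>\<phi> w. c * op_eval s \<phi> w) \<phi> = (\<lambda>w. c * conj_op (op_eval s) \<phi> w)" for \<phi>
    by (simp add: conj_op_def mult.left_commute)
  show ?case
    by (rule ext, rule ext) (simp add: supercomm_def c L, simp add: field_simps)
next
  case (brk_scale_right s t c)
  note L = op_linearD[OF op_eval_linear[of s]]
  have c: "conj_op (\<lambda>\<phi> w. c * op_eval t \<phi> w) \<phi> = (\<lambda>w. c * conj_op (op_eval t) \<phi> w)" for \<phi>
    by (simp add: conj_op_def mult.left_commute)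
  show ?case
    by (rule ext, rule ext) (simp add: supercomm_def c L, simp add: field_simps)
qed (simp_all add: algebra_simps)

text \<open>At the empty word \<open>Cart h\<close> acts by the scalar \<open>l h\<close>, so the
  representation detects every \<open>h\<close> on which the chosen highest weight \<open>l\<close>
  does not vanish.\<close>

lemma ct_zero_imp: "h \<in> H \<Longrightarrow> ct h = \<zero>\<^bsub>A\<^esub> \<Longrightarrow> l h = 0"
proof -
  assume h: "h \<in> H" and z: "ct h = \<zero>\<^bsub>A\<^esub>"
  then have "cls (Gen (Cart h)) = cls Zero" by (simp add: cls_gen cls_ops(4)[of Zero])
  then have "op_eval (Gen (Cart h)) = op_eval Zero" using h by (intro op_eval_cong) (simp flip: cls_eq_iff)
  then have "op_eval (Gen (Cart h)) (\<lambda>_. 1) [] = op_eval Zero (\<lambda>_. 1) []" by simp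
  then show "l h = 0" by simp
qed

end

context half_baked_alg
begin

lemma av_nonzero:
  assumes x: "x \<in> X" shows "av v x \<noteq> \<zero>\<^bsub>hsp v\<^esub>"
proof
  assume z: "av v x = \<zero>\<^bsub>hsp v\<^esub>"
  let ?c = "\<lambda>y. if y = x then 1 else 0 :: complex"
  have "(\<Oplus>\<^bsub>hsp v\<^esub>y\<in>X. ?c y \<odot>\<^bsub>hsp v\<^esub> av v y) = (\<Oplus>\<^bsub>hsp v\<^esub>y\<in>X. \<zero>\<^bsub>hsp v\<^esub>)"
  proof (rule H.finsum_cong')
    show "?c y \<odot>\<^bsub>hsp v\<^esub> av v y = \<zero>\<^bsub>hsp v\<^esub>" if "y \<in> X" for y
      using z H.lmult_0[OF av_closed[OF that]] H.rmult_0[of 1] by auto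
  qed auto
  also have "\<dots> = \<zero>\<^bsub>hsp v\<^esub>" by simp
  finally have "(\<Oplus>\<^bsub>hsp v\<^esub>y\<in>X. ?c y \<odot>\<^bsub>hsp v\<^esub> av v y) = \<zero>\<^bsub>hsp v\<^esub>" .
  from a_independent[OF this x] show False by simp
qed

lemma ct_av_nonzero:
  assumes x: "x \<in> X" shows "ct (av v x) \<noteq> \<zero>\<^bsub>A\<^esub>"
proof -
  have "vectorspace.fin_dim class_ring (hsp v)" using root_datum by (simp add: is_root_datum_def)
  from exists_nonvanishing_functional[OF H.vectorspace_axioms this av_closed[OF x] av_nonzero[OF x]]
  obtain l where l: "\<forall>h\<in>H. \<forall>k\<in>H. l (h \<oplus>\<^bsub>hsp v\<^esub> k) = l h + (l k :: complex)"
    "\<forall>c. \<forall>h\<in>H. l (c \<odot>\<^bsub>hsp v\<^esub> h) = c * l h" "l (av v x) \<noteq> 0" by blast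
  interpret dual_verma X v l by unfold_locales (use l in auto)
  show ?thesis using ct_zero_imp[OF av_closed[OF x]] l(3) by blast
qed

text \<open>If one of them lay in \<open>I\<close>, so would \<open>[e x, f x] = ct (a x)\<close>, a
  nonzero Cartan element.\<close>

lemma e_f_notin_cartan_free:
  assumes I: "cartan_free_ideal X v I" and x: "x \<in> X"
  shows "e x \<notin> I" "f x \<notin> I"
proof -
  have ideal: "lie_ideal I A" and free: "I \<inter> ct ` H = {\<zero>\<^bsub>A\<^esub>}"
    using I by (auto simp: cartan_free_ideal_def)
  have "ct (av v x) \<notin> I" using free ct_av_nonzero[OF x] av_closed[OF x] by blast
  moreover have "ct (av v x) = brk A (e x) (f x)" using e_f x by simp
  ultimately show "e x \<notin> I" "f x \<notin> I"
    using A.idealD(7)[OF ideal, of "e x" "f x"] A.idealD(8)[OF ideal, of "f x" "e x"] x by auto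
qed

end


section \<open>Transport along arrows\<close>

text \<open>The weights generating \<open>s\<close> as a predicate. Equality is demanded on
  \<open>hsp v\<close> only, so that functionals can be pulled back along arrows, whose values
  matter only there.\<close>

definition s_weight :: "'x set \<Rightarrow> ('x, 'h) root_datum \<Rightarrow> ('h \<Rightarrow> complex) \<Rightarrow> bool" where
  "s_weight X v \<mu> \<longleftrightarrow> (\<exists>v' x y. reflexion_connected X v v' \<and> x \<in> X \<and> y \<in> X \<and> x \<noteq> y
     \<and> (\<forall>h\<in>carrier (hsp v). \<mu> h = bv v' x h - bv v' y h))"

lemma s_weightI:
  "\<lbrakk>reflexion_connected X v v'; x \<in> X; y \<in> X; x \<noteq> y; \<And>h. h \<in> carrier (hsp v) \<Longrightarrow> \<mu> h = bv v' x h - bv v' y h\<rbrakk>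
    \<Longrightarrow> s_weight X v \<mu>"
  unfolding s_weight_def by blast

context half_baked_alg
begin

lemma s_ideal_is_ideal: "lie_ideal (s_ideal X v) A"
  unfolding s_ideal_def by (rule A.lie_ideal_gen_props) (auto simp: hb_weight_space_def)

lemma weight_vector_in_s_ideal:
  assumes \<mu>: "s_weight X v \<mu>" and u: "u \<in> carrier A"
    and weight: "\<And>h. h \<in> H \<Longrightarrow> brk A (ct h) u = \<mu> h \<odot>\<^bsub>A\<^esub> u"
  shows "u \<in> s_ideal X v"
proof -
  obtain v' x y where *: "reflexion_connected X v v'" "x \<in> X" "y \<in> X" "x \<noteq> y"
    "\<forall>h\<in>H. \<mu> h = bv v' x h - bv v' y h" using \<mu> unfolding s_weight_def by blast
  have "u \<in> hb_weight_space X v (\<lambda>h. bv v' x h - bv v' y h)"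
    using u weight *(5) unfolding hb_weight_space_def by simp
  moreover have "hb_weight_space X v (\<lambda>h. bv v' x h - bv v' y h)
      \<in> {hb_weight_space X v (\<lambda>h. bv v' x h - bv v' y h) | v' x y.
          reflexion_connected X v v' \<and> x \<in> X \<and> y \<in> X \<and> x \<noteq> y}" using * by blast
  ultimately have "u \<in> \<Union> {hb_weight_space X v (\<lambda>h. bv v' x h - bv v' y h) | v' x y.
          reflexion_connected X v v' \<and> x \<in> X \<and> y \<in> X \<and> x \<noteq> y}" by blast
  moreover have "\<Union> {hb_weight_space X v (\<lambda>h. bv v' x h - bv v' y h) | v' x y.
          reflexion_connected X v v' \<and> x \<in> X \<and> y \<in> X \<and> x \<noteq> y} \<subseteq> s_ideal X v"
    unfolding s_ideal_def by (rule A.lie_ideal_gen_props) (auto simp: hb_weight_space_def)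
  ultimately show ?thesis by blast
qed

lemma s_ideal_least:
  assumes I: "lie_ideal I A"
    and sub: "\<And>\<mu> u. \<lbrakk>s_weight X v \<mu>; u \<in> carrier A; \<And>h. h \<in> H \<Longrightarrow> brk A (ct h) u = \<mu> h \<odot>\<^bsub>A\<^esub> u\<rbrakk> \<Longrightarrow> u \<in> I"
  shows "s_ideal X v \<subseteq> I"
  unfolding s_ideal_def
proof (rule lie_ideal_gen_least[OF I], rule Union_least)
  fix W assume "W \<in> {hb_weight_space X v (\<lambda>h. bv v' x h - bv v' y h) | v' x y.
          reflexion_connected X v v' \<and> x \<in> X \<and> y \<in> X \<and> x \<noteq> y}"
  then obtain v' x y where *: "W = hb_weight_space X v (\<lambda>h. bv v' x h - bv v' y h)"
    "reflexion_connected X v v'" "x \<in> X" "y \<in> X" "x \<noteq> y" by blast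
  show "W \<subseteq> I"
  proof
    fix u assume "u \<in> W"
    then show "u \<in> I" using sub[OF s_weightI[OF *(2-5) HOL.refl]] unfolding *(1) hb_weight_space_def by blast
  qed
qed

text \<open>Lift the class of \<open>u\<close> modulo \<open>s\<close> to a genuine weight vector of
  the same weight; that vector is one of the generators of \<open>s\<close>.\<close>

lemma s_weight_mod:
  assumes \<mu>: "s_weight X v \<mu>" and u: "u \<in> carrier A"
    and weight: "\<And>h. h \<in> H \<Longrightarrow> brk A (ct h) u \<ominus>\<^bsub>A\<^esub> \<mu> h \<odot>\<^bsub>A\<^esub> u \<in> s_ideal X v"
  shows "u \<in> s_ideal X v"
proof -
  obtain w where w: "w \<in> carrier A" "u \<ominus>\<^bsub>A\<^esub> w \<in> s_ideal X v" "\<forall>h\<in>H. brk A (ct h) w = \<mu> h \<odot>\<^bsub>A\<^esub> w"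
    using weight_lift[OF s_ideal_is_ideal u weight] by blast
  then have "w \<in> s_ideal X v" using weight_vector_in_s_ideal[OF \<mu>] by blast
  then have "(u \<ominus>\<^bsub>A\<^esub> w) \<oplus>\<^bsub>A\<^esub> w \<in> s_ideal X v" using A.idealD(4)[OF s_ideal_is_ideal] w(2) by blast
  moreover have "(u \<ominus>\<^bsub>A\<^esub> w) \<oplus>\<^bsub>A\<^esub> w = u" using u w(1) by (simp add: A.diff_simps)
  ultimately show ?thesis by simp
qed

lemma A_superalgebra: "lie_superalgebra A"
  by (rule A.lie_superalgebra_axioms)

lemma A_hom_eqI:
  assumes f: "\<alpha> \<in> lie_hom A M" and g: "\<beta> \<in> lie_hom A M"
    and eq: "\<And>h. h \<in> H \<Longrightarrow> \<alpha> (ct h) = \<beta> (ct h)" "\<And>x. x \<in> X \<Longrightarrow> \<alpha> (e x) = \<beta> (e x)"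
      "\<And>x. x \<in> X \<Longrightarrow> \<alpha> (f x) = \<beta> (f x)"
    and u: "u \<in> carrier A"
  shows "\<alpha> u = \<beta> u"
  using u by (induction rule: A_induct) (simp_all add: eq lie_homD[OF f] lie_homD[OF g])

lemma A_universal:
  fixes M :: "'a lie_super"
  assumes M: "lie_superalgebra M"
    and part: "\<And>h. h \<in> H \<Longrightarrow> ct' h \<in> part M 0" "\<And>x. x \<in> X \<Longrightarrow> e' x \<in> part M (pv v x)"
      "\<And>x. x \<in> X \<Longrightarrow> f' x \<in> part M (pv v x)"
    and add: "\<And>h k. \<lbrakk>h \<in> H; k \<in> H\<rbrakk> \<Longrightarrow> ct' (h \<oplus>\<^bsub>hsp v\<^esub> k) = ct' h \<oplus>\<^bsub>M\<^esub> ct' k"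
    and scale: "\<And>c h. h \<in> H \<Longrightarrow> ct' (c \<odot>\<^bsub>hsp v\<^esub> h) = c \<odot>\<^bsub>M\<^esub> ct' h"
    and hh: "\<And>h k. \<lbrakk>h \<in> H; k \<in> H\<rbrakk> \<Longrightarrow> brk M (ct' h) (ct' k) = \<zero>\<^bsub>M\<^esub>"
    and he: "\<And>h x. \<lbrakk>h \<in> H; x \<in> X\<rbrakk> \<Longrightarrow> brk M (ct' h) (e' x) = bv v x h \<odot>\<^bsub>M\<^esub> e' x"
    and hf: "\<And>h x. \<lbrakk>h \<in> H; x \<in> X\<rbrakk> \<Longrightarrow> brk M (ct' h) (f' x) = (- bv v x h) \<odot>\<^bsub>M\<^esub> f' x"
    and ef: "\<And>x y. \<lbrakk>x \<in> X; y \<in> X; x \<noteq> y\<rbrakk> \<Longrightarrow> brk M (e' x) (f' y) = \<zero>\<^bsub>M\<^esub>"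
    and ef': "\<And>x. x \<in> X \<Longrightarrow> brk M (e' x) (f' x) = ct' (av v x)"
  obtains \<Phi> where "\<Phi> \<in> lie_hom A M" "\<And>h. h \<in> H \<Longrightarrow> \<Phi> (ct h) = ct' h"
    "\<And>x. x \<in> X \<Longrightarrow> \<Phi> (e x) = e' x" "\<And>x. x \<in> X \<Longrightarrow> \<Phi> (f x) = f' x"
proof -
  let ?g = "\<lambda>g. case g of Cart h \<Rightarrow> ct' h | E x \<Rightarrow> e' x | F x \<Rightarrow> f' x"
  have gp: "?g g \<in> part M (hb_par v g)" if "g \<in> hb_gens X v" for g
    using that part by (cases g) simp_all
  have rels: "lie_eval M ?g s = lie_eval M ?g t" if "(s, t) \<in> hb_rels X v" for s t
    using that by cases (simp_all add: add scale hh he hf ef ef')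
  from universal_property[where f = ?g, OF M gp rels]
  obtain \<Phi> where *: "\<Phi> \<in> lie_hom A M" "\<And>t. t \<in> lie_terms (hb_gens X v) \<Longrightarrow> \<Phi> (cls t) = lie_eval M ?g t"
    unfolding half_baked_def by blast
  show ?thesis
    by (rule that[OF *(1)]) (use *(2)[of "Gen (Cart _)"] *(2)[of "Gen (E _)"] *(2)[of "Gen (F _)"] in
        \<open>simp_all add: cls_gen\<close>)
qed

end

text \<open>One direction of an arrow, where \<open>\<phi>\<close> from \<open>v\<close> to
  \<open>w\<close> and \<open>\<theta>\<close> are mutually inverse. The map \<open>\<chi>\<close>
  of quotients runs from \<open>w\<close> to \<open>v\<close>, because the universal property will
  be applied to the algebra of \<open>w\<close>. An arrow gives two instances with the roles
  exchanged.\<close>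

locale half_baked_pair = V: half_baked_alg X v + W: half_baked_alg X w
  for X :: "'x set" and v w :: "('x, 'h) root_datum" +
  fixes I J and \<chi> and \<phi> \<theta> :: "'h \<Rightarrow> 'h"
  assumes I: "cartan_free_ideal X v I" and J: "cartan_free_ideal X w J"
    and \<chi>: "\<chi> \<in> lie_hom (lie_quot (half_baked X w) J) (lie_quot (half_baked X v) I)"
    and \<chi>_cart: "k \<in> carrier (hsp w) \<Longrightarrow>
      \<chi> (J +>\<^bsub>half_baked X w\<^esub> hb_cart X w k) = I +>\<^bsub>half_baked X v\<^esub> hb_cart X v (\<theta> k)"
    and \<phi>_closed: "h \<in> carrier (hsp v) \<Longrightarrow> \<phi> h \<in> carrier (hsp w)"
    and \<theta>_closed: "k \<in> carrier (hsp w) \<Longrightarrow> \<theta> k \<in> carrier (hsp v)"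
    and \<theta>_\<phi>: "h \<in> carrier (hsp v) \<Longrightarrow> \<theta> (\<phi> h) = h"
    and \<phi>_\<theta>: "k \<in> carrier (hsp w) \<Longrightarrow> \<phi> (\<theta> k) = k"
    and \<theta>_add: "\<lbrakk>k \<in> carrier (hsp w); k' \<in> carrier (hsp w)\<rbrakk> \<Longrightarrow> \<theta> (k \<oplus>\<^bsub>hsp w\<^esub> k') = \<theta> k \<oplus>\<^bsub>hsp v\<^esub> \<theta> k'"
    and \<theta>_scale: "k \<in> carrier (hsp w) \<Longrightarrow> \<theta> (c \<odot>\<^bsub>hsp w\<^esub> k) = c \<odot>\<^bsub>hsp v\<^esub> \<theta> k"
begin

lemma I_ideal: "lie_ideal I V.A" and I_free: "I \<inter> V.ct ` V.H = {\<zero>\<^bsub>V.A\<^esub>}"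
  and J_ideal: "lie_ideal J W.A" and J_free: "J \<inter> W.ct ` W.H = {\<zero>\<^bsub>W.A\<^esub>}"
  using I J by (auto simp: cartan_free_ideal_def)

text \<open>As \<open>\<chi>\<close> matches the Cartan elements by \<open>\<theta>\<close>, it
  turns weight \<open>\<mu>\<close> over \<open>w\<close> into weight \<open>\<mu>\<close> after
  \<open>\<phi>\<close> over \<open>v\<close>, at first only modulo \<open>I\<close>;
  \<open>weight_lift_homogeneous\<close> removes the "modulo" and keeps the parity.\<close>

lemma lift_weight_vector:
  assumes u: "u \<in> part W.A i"
    and weight: "\<And>k. k \<in> W.H \<Longrightarrow> brk W.A (W.ct k) u = \<mu> k \<odot>\<^bsub>W.A\<^esub> u"
  shows "\<exists>z\<in>part V.A i. \<chi> (J +>\<^bsub>W.A\<^esub> u) = I +>\<^bsub>V.A\<^esub> z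
     \<and> (\<forall>h\<in>V.H. brk V.A (V.ct h) z = \<mu> (\<phi> h) \<odot>\<^bsub>V.A\<^esub> z)"
proof -
  note \<chi>D = lie_homD[OF \<chi>]
  note QV = lie_quot[OF V.A_superalgebra I_ideal] and QW = lie_quot[OF W.A_superalgebra J_ideal]
  have uc: "u \<in> carrier W.A" using u by auto
  have "\<chi> (J +>\<^bsub>W.A\<^esub> u) \<in> part (lie_quot V.A I) i"
    using \<chi>D(7) lie_homD(7)[OF QW(2) u] by blast
  then obtain z where z: "z \<in> part V.A i" "\<chi> (J +>\<^bsub>W.A\<^esub> u) = I +>\<^bsub>V.A\<^esub> z"
    unfolding lie_quot_part by auto
  have zc: "z \<in> carrier V.A" using z by auto
  have Ju: "J +>\<^bsub>W.A\<^esub> u \<in> carrier (lie_quot W.A J)" using lie_homD(3)[OF QW(2) uc] .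
  have "brk V.A (V.ct h) z \<ominus>\<^bsub>V.A\<^esub> \<mu> (\<phi> h) \<odot>\<^bsub>V.A\<^esub> z \<in> I" if h: "h \<in> V.H" for h
  proof -
    have k: "\<phi> h \<in> W.H" using \<phi>_closed h .
    have Jk: "J +>\<^bsub>W.A\<^esub> W.ct (\<phi> h) \<in> carrier (lie_quot W.A J)" using lie_homD(3)[OF QW(2)] k by simp
    have "I +>\<^bsub>V.A\<^esub> brk V.A (V.ct h) z
        = brk (lie_quot V.A I) (I +>\<^bsub>V.A\<^esub> V.ct h) (I +>\<^bsub>V.A\<^esub> z)"
      using V.A.quot_brk[OF I_ideal V.ct_carrier[OF h] zc] by simp
    also have "\<dots> = brk (lie_quot V.A I) (\<chi> (J +>\<^bsub>W.A\<^esub> W.ct (\<phi> h))) (\<chi> (J +>\<^bsub>W.A\<^esub> u))"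
      using \<chi>_cart[OF k] \<theta>_\<phi>[OF h] z(2) by simp
    also have "\<dots> = \<chi> (brk (lie_quot W.A J) (J +>\<^bsub>W.A\<^esub> W.ct (\<phi> h)) (J +>\<^bsub>W.A\<^esub> u))"
      using \<chi>D(6)[OF Jk Ju] by simp
    also have "\<dots> = \<chi> (J +>\<^bsub>W.A\<^esub> (\<mu> (\<phi> h) \<odot>\<^bsub>W.A\<^esub> u))"
      using W.A.quot_brk[OF J_ideal W.ct_carrier[OF k] uc] weight[OF k] by simp
    also have "\<dots> = \<mu> (\<phi> h) \<odot>\<^bsub>lie_quot V.A I\<^esub> \<chi> (J +>\<^bsub>W.A\<^esub> u)"
      using W.A.quot_smult[OF J_ideal uc, symmetric] \<chi>D(5)[OF Ju] by simp
    also have "\<dots> = I +>\<^bsub>V.A\<^esub> (\<mu> (\<phi> h) \<odot>\<^bsub>V.A\<^esub> z)"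
      using V.A.quot_smult[OF I_ideal zc] z(2) by simp
    finally show ?thesis using V.A.coset_eq_iff[OF I_ideal] zc h by simp
  qed
  from V.weight_lift_homogeneous[OF I_ideal z(1) this]
  obtain z' where z': "z' \<in> part V.A i" "z \<ominus>\<^bsub>V.A\<^esub> z' \<in> I"
    "\<forall>h\<in>V.H. brk V.A (V.ct h) z' = \<mu> (\<phi> h) \<odot>\<^bsub>V.A\<^esub> z'" by blast
  have "I +>\<^bsub>V.A\<^esub> z = I +>\<^bsub>V.A\<^esub> z'" using V.A.coset_eq_iff[OF I_ideal zc] z'(1,2) by auto
  then show ?thesis using z(2) z' by auto
qed

end

text \<open>These two assumptions are all that the comparison of the quotients by \<open>s\<close>
  has to know about reflexions.\<close>

locale half_baked_pair_s = half_baked_pair +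
  assumes s_I: "s_ideal X v \<subseteq> I" and s_transport: "s_weight X w \<mu> \<Longrightarrow> s_weight X v (\<lambda>h. \<mu> (\<phi> h))"
begin

abbreviation "s \<equiv> s_ideal X v"

lemma proj_s_I: "quot_lift V.A (\<lambda>u. I +>\<^bsub>V.A\<^esub> u) s \<in> lie_hom (lie_quot V.A s) (lie_quot V.A I)"
  "u \<in> carrier V.A \<Longrightarrow> quot_lift V.A (\<lambda>u. I +>\<^bsub>V.A\<^esub> u) s (s +>\<^bsub>V.A\<^esub> u) = I +>\<^bsub>V.A\<^esub> u"
proof -
  note QI = lie_quot[OF V.A_superalgebra I_ideal]
  have ker: "I +>\<^bsub>V.A\<^esub> u = \<zero>\<^bsub>lie_quot V.A I\<^esub>" if "u \<in> s" for u
    using that s_I V.A.idealD(2)[OF I_ideal] V.A.coset_eq_self_iff[OF I_ideal] by (auto simp: lie_quot_zero)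
  show "quot_lift V.A (\<lambda>u. I +>\<^bsub>V.A\<^esub> u) s \<in> lie_hom (lie_quot V.A s) (lie_quot V.A I)"
    by (rule quot_lift(2)[OF V.s_ideal_is_ideal QI(2) ker])
  show "u \<in> carrier V.A \<Longrightarrow> quot_lift V.A (\<lambda>u. I +>\<^bsub>V.A\<^esub> u) s (s +>\<^bsub>V.A\<^esub> u) = I +>\<^bsub>V.A\<^esub> u"
    by (rule quot_lift(1)[OF V.s_ideal_is_ideal QI(2) ker])
qed

text \<open>
  Images of the generators are lifted from the quotient by \<open>I\<close> to weight vectors. The relations
  between \<open>e x\<close> and \<open>f y\<close> for \<open>x \<noteq> y\<close> then hold modulo \<open>s\<close> for weight reasons, and
  \<open>[e x, f x]\<close> is correct because the Cartan subalgebra embeds in the quotient by \<open>I\<close>.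
\<close>

lemma lifted_hom:
  "\<exists>\<Phi>\<in>lie_hom W.A (lie_quot V.A s).
     (\<forall>k\<in>W.H. \<Phi> (W.ct k) = s +>\<^bsub>V.A\<^esub> V.ct (\<theta> k))
     \<and> (\<forall>u\<in>s_ideal X w. \<Phi> u = \<zero>\<^bsub>lie_quot V.A s\<^esub>)
     \<and> (\<forall>u\<in>carrier W.A. \<forall>z\<in>carrier V.A. \<Phi> u = s +>\<^bsub>V.A\<^esub> z \<longrightarrow> \<chi> (J +>\<^bsub>W.A\<^esub> u) = I +>\<^bsub>V.A\<^esub> z)"
proof -
  note \<chi>D = lie_homD[OF \<chi>]
  note QV = lie_quot[OF V.A_superalgebra I_ideal] and QW = lie_quot[OF W.A_superalgebra J_ideal]
  note Qs = lie_quot[OF V.A_superalgebra V.s_ideal_is_ideal]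
  note sI = V.s_ideal_is_ideal
  have "\<forall>x\<in>X. \<exists>z\<in>part V.A (pv w x). \<chi> (J +>\<^bsub>W.A\<^esub> W.e x) = I +>\<^bsub>V.A\<^esub> z
     \<and> (\<forall>h\<in>V.H. brk V.A (V.ct h) z = bv w x (\<phi> h) \<odot>\<^bsub>V.A\<^esub> z)"
    using lift_weight_vector[OF W.e_part W.ct_e] by blast
  then obtain ee where ee: "\<And>x. x \<in> X \<Longrightarrow> ee x \<in> part V.A (pv w x)"
    "\<And>x. x \<in> X \<Longrightarrow> \<chi> (J +>\<^bsub>W.A\<^esub> W.e x) = I +>\<^bsub>V.A\<^esub> ee x"
    "\<And>x h. x \<in> X \<Longrightarrow> h \<in> V.H \<Longrightarrow> brk V.A (V.ct h) (ee x) = bv w x (\<phi> h) \<odot>\<^bsub>V.A\<^esub> ee x" by metis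
  have "\<forall>x\<in>X. \<exists>z\<in>part V.A (pv w x). \<chi> (J +>\<^bsub>W.A\<^esub> W.f x) = I +>\<^bsub>V.A\<^esub> z
     \<and> (\<forall>h\<in>V.H. brk V.A (V.ct h) z = (- bv w x (\<phi> h)) \<odot>\<^bsub>V.A\<^esub> z)"
    using lift_weight_vector[OF W.f_part W.ct_f] by blast
  then obtain ff where ff: "\<And>x. x \<in> X \<Longrightarrow> ff x \<in> part V.A (pv w x)"
    "\<And>x. x \<in> X \<Longrightarrow> \<chi> (J +>\<^bsub>W.A\<^esub> W.f x) = I +>\<^bsub>V.A\<^esub> ff x"
    "\<And>x h. x \<in> X \<Longrightarrow> h \<in> V.H \<Longrightarrow> brk V.A (V.ct h) (ff x) = (- bv w x (\<phi> h)) \<odot>\<^bsub>V.A\<^esub> ff x" by metis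
  have eec: "x \<in> X \<Longrightarrow> ee x \<in> carrier V.A" and ffc: "x \<in> X \<Longrightarrow> ff x \<in> carrier V.A" for x
    using ee(1) ff(1) V.A.part_carrier by blast+
  have weight: "brk V.A (V.ct h) (brk V.A (ee x) (ff y))
      = (bv w x (\<phi> h) - bv w y (\<phi> h)) \<odot>\<^bsub>V.A\<^esub> brk V.A (ee x) (ff y)"
    if "x \<in> X" "y \<in> X" "h \<in> V.H" for x y h
  proof -
    have "brk V.A (V.ct h) (brk V.A (ee x) (ff y))
       = bv w x (\<phi> h) \<odot>\<^bsub>V.A\<^esub> brk V.A (ee x) (ff y) \<oplus>\<^bsub>V.A\<^esub> (- bv w y (\<phi> h)) \<odot>\<^bsub>V.A\<^esub> brk V.A (ee x) (ff y)"
      using V.A.even_derivation[OF V.ct_part[OF that(3)] eec[OF that(1)] ffc[OF that(2)]] that ee(3) ff(3) eec ffc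
      by (simp add: V.A.brk_smult_left V.A.brk_smult_right)
    also have "\<dots> = (bv w x (\<phi> h) + - bv w y (\<phi> h)) \<odot>\<^bsub>V.A\<^esub> brk V.A (ee x) (ff y)"
      using eec ffc that by (intro V.A.scale_add_left[symmetric]) simp
    finally show ?thesis by simp
  qed
  \<comment> \<open>The empty chain of reflexions makes \<open>b x - b y\<close> one of the weights
    generating \<open>s\<close> at \<open>w\<close>. Transported to \<open>v\<close> it is the
    weight of this bracket, which is thus itself a generator of \<open>s\<close>.\<close>
  have off: "brk V.A (ee x) (ff y) \<in> s" if "x \<in> X" "y \<in> X" "x \<noteq> y" for x y
  proof (rule V.weight_vector_in_s_ideal)
    have "reflexion_connected X w w" by (simp add: reflexion_connected_def)
    from s_weightI[OF this that HOL.refl] show "s_weight X v (\<lambda>h. bv w x (\<phi> h) - bv w y (\<phi> h))"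
      by (rule s_transport)
  qed (use that eec ffc weight in auto)
  \<comment> \<open>The equality holds in the half-baked algebra itself, not just modulo
    \<open>s\<close>. The bracket has weight zero, so it is some \<open>ct h\<close>; modulo
    \<open>I\<close> it agrees with \<open>ct (\<theta> (a x))\<close> since \<open>\<chi>\<close>
    is a homomorphism, and \<open>I\<close> contains no nonzero Cartan element.\<close>
  have diag: "brk V.A (ee x) (ff x) = V.ct (\<theta> (av w x))" if x: "x \<in> X" for x
  proof -
    let ?q = "brk V.A (ee x) (ff x)"
    have qc: "?q \<in> carrier V.A" using eec ffc x by simp
    have a: "\<theta> (av w x) \<in> V.H" using \<theta>_closed x by simp
    have "brk V.A (V.ct h) ?q \<in> {\<zero>\<^bsub>V.A\<^esub>}" if "h \<in> V.H" for h using weight[OF x x that] qc by simp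
    from V.weight_zero_mod[OF V.A.zero_is_ideal qc this]
    obtain h where h: "h \<in> V.H" "?q = V.ct h" using V.A.minus_eq_zero_iff qc by auto
    have Jc: "J +>\<^bsub>W.A\<^esub> W.e x \<in> carrier (lie_quot W.A J)" "J +>\<^bsub>W.A\<^esub> W.f x \<in> carrier (lie_quot W.A J)"
      using lie_homD(3)[OF QW(2)] x by simp_all
    have "I +>\<^bsub>V.A\<^esub> ?q = brk (lie_quot V.A I) (I +>\<^bsub>V.A\<^esub> ee x) (I +>\<^bsub>V.A\<^esub> ff x)"
      using V.A.quot_brk[OF I_ideal eec[OF x] ffc[OF x]] by simp
    also have "\<dots> = \<chi> (brk (lie_quot W.A J) (J +>\<^bsub>W.A\<^esub> W.e x) (J +>\<^bsub>W.A\<^esub> W.f x))"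
      using \<chi>D(6)[OF Jc] ee(2)[OF x] ff(2)[OF x] by simp
    also have "\<dots> = \<chi> (J +>\<^bsub>W.A\<^esub> W.ct (av w x))"
      using W.A.quot_brk[OF J_ideal W.e_carrier[OF x] W.f_carrier[OF x]] W.e_f[OF x x] by simp
    also have "\<dots> = I +>\<^bsub>V.A\<^esub> V.ct (\<theta> (av w x))" using \<chi>_cart x by simp
    finally have "?q \<ominus>\<^bsub>V.A\<^esub> V.ct (\<theta> (av w x)) \<in> I"
      using V.A.coset_eq_iff[OF I_ideal qc V.ct_carrier[OF a]] by simp
    moreover have "V.ct h \<ominus>\<^bsub>V.A\<^esub> V.ct (\<theta> (av w x)) \<in> V.ct ` V.H"
      using V.A.subspaceD(5)[OF V.ct_image_subspace] h(1) a by blast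
    ultimately have "?q \<ominus>\<^bsub>V.A\<^esub> V.ct (\<theta> (av w x)) = \<zero>\<^bsub>V.A\<^esub>" using I_free h(2) by auto
    then show ?thesis using V.A.minus_eq_zero_iff qc a by simp
  qed
  let ?pr = "\<lambda>u. s +>\<^bsub>V.A\<^esub> u"
  note prD = lie_homD[OF Qs(2)]
  have brk_pr: "brk (lie_quot V.A s) (?pr u) (?pr z) = ?pr (brk V.A u z)"
    if "u \<in> carrier V.A" "z \<in> carrier V.A" for u z using prD(6)[OF that] by simp
  obtain \<Phi> where \<Phi>: "\<Phi> \<in> lie_hom W.A (lie_quot V.A s)"
    "\<And>k. k \<in> W.H \<Longrightarrow> \<Phi> (W.ct k) = ?pr (V.ct (\<theta> k))"
    "\<And>x. x \<in> X \<Longrightarrow> \<Phi> (W.e x) = ?pr (ee x)" "\<And>x. x \<in> X \<Longrightarrow> \<Phi> (W.f x) = ?pr (ff x)"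
  proof (rule W.A_universal[of "lie_quot V.A s" "\<lambda>k. ?pr (V.ct (\<theta> k))" "\<lambda>x. ?pr (ee x)" "\<lambda>x. ?pr (ff x)"])
    show "lie_superalgebra (lie_quot V.A s)" by (rule Qs(1))
    show "?pr (V.ct (\<theta> k)) \<in> part (lie_quot V.A s) 0" if "k \<in> W.H" for k
      using prD(7) V.ct_part \<theta>_closed that by blast
    show "?pr (ee x) \<in> part (lie_quot V.A s) (pv w x)" "?pr (ff x) \<in> part (lie_quot V.A s) (pv w x)"
      if "x \<in> X" for x using prD(7) ee(1) ff(1) that by blast+
    show "?pr (V.ct (\<theta> (h \<oplus>\<^bsub>hsp w\<^esub> k))) = ?pr (V.ct (\<theta> h)) \<oplus>\<^bsub>lie_quot V.A s\<^esub> ?pr (V.ct (\<theta> k))"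
      if "h \<in> W.H" "k \<in> W.H" for h k
      using that \<theta>_closed by (simp add: \<theta>_add V.ct_add prD(4))
    show "?pr (V.ct (\<theta> (c \<odot>\<^bsub>hsp w\<^esub> h))) = c \<odot>\<^bsub>lie_quot V.A s\<^esub> ?pr (V.ct (\<theta> h))" if "h \<in> W.H" for c h
      using that \<theta>_closed by (simp add: \<theta>_scale V.ct_scale prD(5))
    show "brk (lie_quot V.A s) (?pr (V.ct (\<theta> h))) (?pr (V.ct (\<theta> k))) = \<zero>\<^bsub>lie_quot V.A s\<^esub>"
      if "h \<in> W.H" "k \<in> W.H" for h k
      using that \<theta>_closed by (simp add: brk_pr V.ct_ct prD(8))
    show "brk (lie_quot V.A s) (?pr (V.ct (\<theta> h))) (?pr (ee x)) = bv w x h \<odot>\<^bsub>lie_quot V.A s\<^esub> ?pr (ee x)"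
      if "h \<in> W.H" "x \<in> X" for h x
      using that \<theta>_closed eec by (simp add: brk_pr ee(3) \<phi>_\<theta> prD(5))
    show "brk (lie_quot V.A s) (?pr (V.ct (\<theta> h))) (?pr (ff x)) = (- bv w x h) \<odot>\<^bsub>lie_quot V.A s\<^esub> ?pr (ff x)"
      if "h \<in> W.H" "x \<in> X" for h x
      using that \<theta>_closed ffc by (simp add: brk_pr ff(3) \<phi>_\<theta> prD(5))
    show "brk (lie_quot V.A s) (?pr (ee x)) (?pr (ff y)) = \<zero>\<^bsub>lie_quot V.A s\<^esub>"
      if "x \<in> X" "y \<in> X" "x \<noteq> y" for x y
      using that eec ffc off V.A.coset_eq_self_iff[OF sI] by (simp add: brk_pr lie_quot_zero)
    show "brk (lie_quot V.A s) (?pr (ee x)) (?pr (ff x)) = ?pr (V.ct (\<theta> (av w x)))" if "x \<in> X" for x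
      using that eec ffc diag by (simp add: brk_pr)
  qed blast
  note \<Phi>D = lie_homD[OF \<Phi>(1)]
  \<comment> \<open>Both sides are homomorphisms from the half-baked algebra of \<open>w\<close> to
    the quotient by \<open>I\<close>; by choice of the lifts they agree on generators.\<close>
  have compat: "quot_lift V.A (\<lambda>u. I +>\<^bsub>V.A\<^esub> u) s (\<Phi> u) = \<chi> (J +>\<^bsub>W.A\<^esub> u)" if u: "u \<in> carrier W.A" for u
  proof -
    have "(quot_lift V.A (\<lambda>u. I +>\<^bsub>V.A\<^esub> u) s \<circ> \<Phi>) u = (\<chi> \<circ> (\<lambda>u. J +>\<^bsub>W.A\<^esub> u)) u"
      by (rule W.A_hom_eqI[OF lie_hom_comp[OF \<Phi>(1) proj_s_I(1)] lie_hom_comp[OF QW(2) \<chi>] _ _ _ u])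
        (use \<Phi>(2-4) proj_s_I(2) \<theta>_closed eec ffc ee(2) ff(2) \<chi>_cart in simp_all)
    then show ?thesis by simp
  qed
  have 1: "\<chi> (J +>\<^bsub>W.A\<^esub> u) = I +>\<^bsub>V.A\<^esub> z" if "u \<in> carrier W.A" "z \<in> carrier V.A" "\<Phi> u = ?pr z" for u z
    using compat[OF that(1)] proj_s_I(2)[OF that(2)] that(3) by simp
  \<comment> \<open>The kernel is an ideal, so it is enough to look at a vector whose weight is
    among those generating \<open>s\<close> at \<open>w\<close>. Its image has the transported
    weight modulo \<open>s\<close>, hence vanishes by \<open>s_weight_mod\<close>.\<close>
  have 2: "\<Phi> u = \<zero>\<^bsub>lie_quot V.A s\<^esub>" if "u \<in> s_ideal X w" for u
  proof -
    interpret Qs: lie_alg "lie_quot V.A s" by (rule lie_alg.intro[OF Qs(1)])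
    have "s_ideal X w \<subseteq> {u \<in> carrier W.A. \<Phi> u \<in> {\<zero>\<^bsub>lie_quot V.A s\<^esub>}}"
    proof (rule W.s_ideal_least)
      show "lie_ideal {u \<in> carrier W.A. \<Phi> u \<in> {\<zero>\<^bsub>lie_quot V.A s\<^esub>}} W.A"
        by (rule lie_hom_kernel_ideal[OF \<Phi>(1) Qs.zero_is_ideal])
      fix \<mu> u assume \<mu>: "s_weight X w \<mu>" and u: "u \<in> carrier W.A"
        and wt: "\<And>k. k \<in> W.H \<Longrightarrow> brk W.A (W.ct k) u = \<mu> k \<odot>\<^bsub>W.A\<^esub> u"
      obtain z where z: "z \<in> carrier V.A" "\<Phi> u = ?pr z"
        using \<Phi>D(3)[OF u] unfolding V.A.quot_carrier by blast
      have "z \<in> s"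
      proof (rule V.s_weight_mod[OF s_transport[OF \<mu>] z(1)])
        fix h assume h: "h \<in> V.H"
        have "?pr (brk V.A (V.ct h) z) = brk (lie_quot V.A s) (\<Phi> (W.ct (\<phi> h))) (\<Phi> u)"
          using h z \<Phi>(2)[OF \<phi>_closed[OF h]] by (simp add: \<theta>_\<phi> brk_pr)
        also have "\<dots> = \<Phi> (\<mu> (\<phi> h) \<odot>\<^bsub>W.A\<^esub> u)"
          using \<Phi>D(6)[OF W.ct_carrier[OF \<phi>_closed[OF h]] u] wt[OF \<phi>_closed[OF h]] by simp
        also have "\<dots> = ?pr (\<mu> (\<phi> h) \<odot>\<^bsub>V.A\<^esub> z)" using \<Phi>D(5)[OF u] z prD(5) by simp
        finally show "brk V.A (V.ct h) z \<ominus>\<^bsub>V.A\<^esub> \<mu> (\<phi> h) \<odot>\<^bsub>V.A\<^esub> z \<in> s"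
          using V.A.coset_eq_iff[OF sI] h z(1) by simp
      qed
      then show "u \<in> {u \<in> carrier W.A. \<Phi> u \<in> {\<zero>\<^bsub>lie_quot V.A s\<^esub>}}"
        using u z V.A.coset_eq_self_iff[OF sI] by (simp add: lie_quot_zero)
    qed
    then show ?thesis using that by blast
  qed
  show ?thesis
  proof (intro bexI[OF _ \<Phi>(1)] conjI ballI impI)
    show "\<Phi> (W.ct k) = ?pr (V.ct (\<theta> k))" if "k \<in> W.H" for k using \<Phi>(2)[OF that] .
    show "\<Phi> u = \<zero>\<^bsub>lie_quot V.A s\<^esub>" if "u \<in> s_ideal X w" for u using 2[OF that] .
    show "\<chi> (J +>\<^bsub>W.A\<^esub> u) = I +>\<^bsub>V.A\<^esub> z"
      if "u \<in> carrier W.A" "z \<in> carrier V.A" "\<Phi> u = ?pr z" for u z using 1[OF that] .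
  qed
qed

end


text \<open>The last clause says that the lift lies over \<open>\<chi>\<close>. Stating it by
  representatives \<open>u\<close> and \<open>z\<close> avoids naming the projection from the
  quotient by \<open>s\<close> to the quotient by \<open>I\<close>.\<close>

definition arrow_lift where
  "arrow_lift X v w I J \<chi> \<theta> \<Phi> \<longleftrightarrow> \<Phi> \<in> lie_hom (half_baked X w) (lie_quot (half_baked X v) (s_ideal X v))
     \<and> (\<forall>k\<in>carrier (hsp w). \<Phi> (hb_cart X w k) = s_ideal X v +>\<^bsub>half_baked X v\<^esub> hb_cart X v (\<theta> k))
     \<and> (\<forall>u\<in>s_ideal X w. \<Phi> u = \<zero>\<^bsub>lie_quot (half_baked X v) (s_ideal X v)\<^esub>)
     \<and> (\<forall>u\<in>carrier (half_baked X w). \<forall>z\<in>carrier (half_baked X v).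
          \<Phi> u = s_ideal X v +>\<^bsub>half_baked X v\<^esub> z \<longrightarrow>
          \<chi> (J +>\<^bsub>half_baked X w\<^esub> u) = I +>\<^bsub>half_baked X v\<^esub> z)"

lemma (in half_baked_pair_s) arrow_lift_exists: "\<exists>\<Phi>. arrow_lift X v w I J \<chi> \<theta> \<Phi>"
  using lifted_hom unfolding arrow_lift_def by blast

section \<open>Homomorphisms that are the identity modulo I\<close>

context half_baked_alg
begin

text \<open>Subtracting the two congruences, the first of which also holds modulo \<open>I\<close>,
  leaves \<open>(c - 1) g\<close> in \<open>I\<close>. As \<open>g\<close> is not in
  \<open>I\<close>, the scalar is 1, and the finer congruence modulo \<open>s\<close> becomes the
  claim.\<close>

lemma scalar_of_congruence:
  assumes I: "cartan_free_ideal X v I" and sI: "s_ideal X v \<subseteq> I" and g: "g \<in> carrier A" "g \<notin> I"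
    and w: "w \<in> carrier A" "w \<ominus>\<^bsub>A\<^esub> c \<odot>\<^bsub>A\<^esub> g \<in> s_ideal X v" "w \<ominus>\<^bsub>A\<^esub> g \<in> I"
  shows "w \<ominus>\<^bsub>A\<^esub> g \<in> s_ideal X v"
proof -
  have ideal: "lie_ideal I A" using I by (simp add: cartan_free_ideal_def)
  have "(w \<ominus>\<^bsub>A\<^esub> g) \<ominus>\<^bsub>A\<^esub> (w \<ominus>\<^bsub>A\<^esub> c \<odot>\<^bsub>A\<^esub> g) \<in> I"
    using A.idealD(6)[OF ideal w(3)] w(2) sI by blast
  moreover have "(w \<ominus>\<^bsub>A\<^esub> g) \<ominus>\<^bsub>A\<^esub> (w \<ominus>\<^bsub>A\<^esub> c \<odot>\<^bsub>A\<^esub> g) = c \<odot>\<^bsub>A\<^esub> g \<ominus>\<^bsub>A\<^esub> g"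
    using g w(1) by (simp add: A.diff_simps)
  moreover have "c \<odot>\<^bsub>A\<^esub> g \<ominus>\<^bsub>A\<^esub> g = (c - 1) \<odot>\<^bsub>A\<^esub> g" using g by (simp add: A.scale_minus_left)
  ultimately have *: "(c - 1) \<odot>\<^bsub>A\<^esub> g \<in> I" by simp
  have "c = 1"
  proof (rule ccontr)
    assume c: "c \<noteq> 1"
    have "inverse (c - 1) \<odot>\<^bsub>A\<^esub> ((c - 1) \<odot>\<^bsub>A\<^esub> g) \<in> I" using A.idealD(5)[OF ideal *] .
    moreover have "inverse (c - 1) \<odot>\<^bsub>A\<^esub> ((c - 1) \<odot>\<^bsub>A\<^esub> g) = g" using g(1) c by (simp add: A.scale_scale)
    ultimately show False using g(2) by simp
  qed
  then show ?thesis using w(2) g(1) by simp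
qed

text \<open>
  The weight spaces of the generators are lines, and no generator lies in \<open>I\<close>; so an endomorphism
  that is the identity modulo \<open>I\<close> fixes the generators.
\<close>

lemma identity_mod_s:
  assumes I: "cartan_free_ideal X v I" and sI: "s_ideal X v \<subseteq> I"
    and \<Omega>: "\<Omega> \<in> lie_hom A (lie_quot A (s_ideal X v))"
    and cart: "\<And>h. h \<in> H \<Longrightarrow> \<Omega> (ct h) = s_ideal X v +>\<^bsub>A\<^esub> ct h"
    and mod_I: "\<And>u w. \<lbrakk>u \<in> carrier A; w \<in> carrier A; \<Omega> u = s_ideal X v +>\<^bsub>A\<^esub> w\<rbrakk> \<Longrightarrow> I +>\<^bsub>A\<^esub> u = I +>\<^bsub>A\<^esub> w"
    and u: "u \<in> carrier A"
  shows "\<Omega> u = s_ideal X v +>\<^bsub>A\<^esub> u"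
proof -
  let ?s = "s_ideal X v"
  note s = s_ideal_is_ideal
  note Q = lie_quot[OF A_superalgebra s]
  note \<Omega>D = lie_homD[OF \<Omega>] and prD = lie_homD[OF Q(2)]
  have ideal: "lie_ideal I A" using I by (simp add: cartan_free_ideal_def)
  have fixes_gen: "\<Omega> g = ?s +>\<^bsub>A\<^esub> g"
    if g: "g \<in> carrier A" "g \<notin> I" "\<And>h. h \<in> H \<Longrightarrow> brk A (ct h) g = \<mu> h \<odot>\<^bsub>A\<^esub> g"
      and line: "\<And>w. \<lbrakk>w \<in> carrier A; \<And>h. h \<in> H \<Longrightarrow> brk A (ct h) w \<ominus>\<^bsub>A\<^esub> \<mu> h \<odot>\<^bsub>A\<^esub> w \<in> ?s\<rbrakk>
        \<Longrightarrow> \<exists>c. w \<ominus>\<^bsub>A\<^esub> c \<odot>\<^bsub>A\<^esub> g \<in> ?s" for g \<mu>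
  proof -
    obtain w where w: "w \<in> carrier A" "\<Omega> g = ?s +>\<^bsub>A\<^esub> w"
      using \<Omega>D(3)[OF g(1)] unfolding A.quot_carrier by blast
    \<comment> \<open>The image of \<open>g\<close> has the weight of \<open>g\<close> because the
      Cartan elements are mapped to their own classes; by \<open>line\<close> it is then a multiple
      of \<open>g\<close> modulo \<open>s\<close>.\<close>
    have "brk A (ct h) w \<ominus>\<^bsub>A\<^esub> \<mu> h \<odot>\<^bsub>A\<^esub> w \<in> ?s" if h: "h \<in> H" for h
    proof -
      have "?s +>\<^bsub>A\<^esub> brk A (ct h) w = brk (lie_quot A ?s) (\<Omega> (ct h)) (\<Omega> g)"
        using prD(6)[OF ct_carrier[OF h] w(1)] cart[OF h] w(2) by simp
      also have "\<dots> = \<Omega> (\<mu> h \<odot>\<^bsub>A\<^esub> g)" using \<Omega>D(6)[OF ct_carrier[OF h] g(1)] g(3)[OF h] by simp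
      also have "\<dots> = ?s +>\<^bsub>A\<^esub> (\<mu> h \<odot>\<^bsub>A\<^esub> w)" using \<Omega>D(5)[OF g(1)] w prD(5)[OF w(1)] by simp
      finally show ?thesis using A.coset_eq_iff[OF s] h w(1) by simp
    qed
    from line[OF w(1) this] obtain c where c: "w \<ominus>\<^bsub>A\<^esub> c \<odot>\<^bsub>A\<^esub> g \<in> ?s" by blast
    have "w \<ominus>\<^bsub>A\<^esub> g \<in> I" using mod_I[OF g(1) w] A.coset_eq_iff[OF ideal w(1) g(1)] by simp
    then have "w \<ominus>\<^bsub>A\<^esub> g \<in> ?s" using scalar_of_congruence[OF I sI g(1,2) w(1) c] by simp
    then show ?thesis using w A.coset_eq_iff[OF s w(1) g(1)] by simp
  qed
  show ?thesis
  proof (rule A_hom_eqI[OF \<Omega> Q(2) cart _ _ u])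
    fix x assume x: "x \<in> X"
    show "\<Omega> (e x) = ?s +>\<^bsub>A\<^esub> e x"
      by (rule fixes_gen[of "e x" "bv v x"])
        (use x e_f_notin_cartan_free[OF I x] ct_e weight_e_mod[OF s] in auto)
    show "\<Omega> (f x) = ?s +>\<^bsub>A\<^esub> f x"
      by (rule fixes_gen[of "f x" "\<lambda>h. - bv v x h"])
        (use x e_f_notin_cartan_free[OF I x] ct_f weight_f_mod[OF s] in auto)
  qed
qed

end

context half_baked_pair_s
begin

text \<open>The composite maps the half-baked algebra of \<open>v\<close> to its quotient by
  \<open>s\<close>, preserves Cartan elements, and lies over \<open>\<chi>\<close> after
  \<open>\<psi>\<close>, which is the identity. So \<open>identity_mod_s\<close> applies.\<close>

lemma arrow_lift_inverse:
  assumes \<Phi>: "arrow_lift X v w I J \<chi> \<theta> \<Phi>" and \<Psi>: "arrow_lift X w v J I \<psi> \<phi> \<Psi>"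
    and inv: "\<And>q. q \<in> carrier (lie_quot V.A I) \<Longrightarrow> \<chi> (\<psi> q) = q"
    and u: "u \<in> carrier V.A"
  shows "quot_lift W.A \<Phi> (s_ideal X w) (\<Psi> u) = s +>\<^bsub>V.A\<^esub> u"
proof -
  have \<Phi>1: "\<Phi> \<in> lie_hom W.A (lie_quot V.A s)"
    and \<Phi>2: "\<And>k. k \<in> W.H \<Longrightarrow> \<Phi> (W.ct k) = s +>\<^bsub>V.A\<^esub> V.ct (\<theta> k)"
    and \<Phi>3: "\<And>u. u \<in> s_ideal X w \<Longrightarrow> \<Phi> u = \<zero>\<^bsub>lie_quot V.A s\<^esub>"
    and \<Phi>4: "\<And>u z. \<lbrakk>u \<in> carrier W.A; z \<in> carrier V.A; \<Phi> u = s +>\<^bsub>V.A\<^esub> z\<rbrakk>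
        \<Longrightarrow> \<chi> (J +>\<^bsub>W.A\<^esub> u) = I +>\<^bsub>V.A\<^esub> z"
    using \<Phi> unfolding arrow_lift_def by blast+
  have \<Psi>1: "\<Psi> \<in> lie_hom V.A (lie_quot W.A (s_ideal X w))"
    and \<Psi>2: "\<And>k. k \<in> V.H \<Longrightarrow> \<Psi> (V.ct k) = s_ideal X w +>\<^bsub>W.A\<^esub> W.ct (\<phi> k)"
    and \<Psi>4: "\<And>u z. \<lbrakk>u \<in> carrier V.A; z \<in> carrier W.A; \<Psi> u = s_ideal X w +>\<^bsub>W.A\<^esub> z\<rbrakk>
        \<Longrightarrow> \<psi> (I +>\<^bsub>V.A\<^esub> u) = J +>\<^bsub>W.A\<^esub> z"
    using \<Psi> unfolding arrow_lift_def by blast+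
  let ?L = "quot_lift W.A \<Phi> (s_ideal X w)"
  have L: "\<And>u. u \<in> carrier W.A \<Longrightarrow> ?L (s_ideal X w +>\<^bsub>W.A\<^esub> u) = \<Phi> u"
    "?L \<in> lie_hom (lie_quot W.A (s_ideal X w)) (lie_quot V.A s)"
    by (rule quot_lift[OF W.s_ideal_is_ideal \<Phi>1 \<Phi>3]; assumption)+
  have "(?L \<circ> \<Psi>) u = s +>\<^bsub>V.A\<^esub> u"
  proof (rule V.identity_mod_s[OF I s_I lie_hom_comp[OF \<Psi>1 L(2)] _ _ u])
    show "(?L \<circ> \<Psi>) (V.ct h) = s +>\<^bsub>V.A\<^esub> V.ct h" if h: "h \<in> V.H" for h
      using \<Psi>2[OF h] L(1)[OF W.ct_carrier[OF \<phi>_closed[OF h]]] \<Phi>2[OF \<phi>_closed[OF h]] \<theta>_\<phi>[OF h] by simp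
    fix u z assume u: "u \<in> carrier V.A" and z: "z \<in> carrier V.A" and eq: "(?L \<circ> \<Psi>) u = s +>\<^bsub>V.A\<^esub> z"
    obtain y where y: "y \<in> carrier W.A" "\<Psi> u = s_ideal X w +>\<^bsub>W.A\<^esub> y"
      using lie_homD(3)[OF \<Psi>1 u] unfolding W.A.quot_carrier by blast
    have "\<Phi> y = s +>\<^bsub>V.A\<^esub> z" using eq y L(1)[OF y(1)] by simp
    then have "\<chi> (J +>\<^bsub>W.A\<^esub> y) = I +>\<^bsub>V.A\<^esub> z" by (rule \<Phi>4[OF y(1) z])
    moreover have "\<psi> (I +>\<^bsub>V.A\<^esub> u) = J +>\<^bsub>W.A\<^esub> y" by (rule \<Psi>4[OF u y])
    moreover have "I +>\<^bsub>V.A\<^esub> u \<in> carrier (lie_quot V.A I)" using u V.A.quot_carrier by blast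
    ultimately show "I +>\<^bsub>V.A\<^esub> u = I +>\<^bsub>V.A\<^esub> z" using inv by metis
  qed
  then show ?thesis by simp
qed

end

lemma lie_isoI:
  assumes f: "f \<in> lie_hom L M" and g: "g \<in> lie_hom M L"
    and "\<And>u. u \<in> carrier L \<Longrightarrow> g (f u) = u" "\<And>u. u \<in> carrier M \<Longrightarrow> f (g u) = u"
  shows "f \<in> lie_iso L M"
proof -
  have "bij_betw f (carrier L) (carrier M)"
    by (rule bij_betw_byWitness[where f' = g]) (use assms lie_homD(3)[OF f] lie_homD(3)[OF g] in auto)
  then show ?thesis using f by (simp add: lie_iso_def)
qed

lemma s_quotient_iso:
  assumes "half_baked_pair_s X v w I J \<chi> \<phi> \<theta>" and "half_baked_pair_s X w v J I \<psi> \<theta> \<phi>"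
    and inv: "\<And>q. q \<in> carrier (lie_quot (half_baked X v) I) \<Longrightarrow> \<chi> (\<psi> q) = q"
      "\<And>q. q \<in> carrier (lie_quot (half_baked X w) J) \<Longrightarrow> \<psi> (\<chi> q) = q"
  shows "\<exists>\<Psi>\<in>lie_iso (lie_quot (half_baked X v) (s_ideal X v)) (lie_quot (half_baked X w) (s_ideal X w)).
     \<forall>h\<in>carrier (hsp v). \<Psi> (s_ideal X v +>\<^bsub>half_baked X v\<^esub> hb_cart X v h)
        = s_ideal X w +>\<^bsub>half_baked X w\<^esub> hb_cart X w (\<phi> h)"
proof -
  interpret P: half_baked_pair_s X v w I J \<chi> \<phi> \<theta> by fact
  interpret Q: half_baked_pair_s X w v J I \<psi> \<theta> \<phi> by fact
  obtain \<Phi> where \<Phi>: "arrow_lift X v w I J \<chi> \<theta> \<Phi>" using P.arrow_lift_exists by blast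
  obtain \<Psi> where \<Psi>: "arrow_lift X w v J I \<psi> \<phi> \<Psi>" using Q.arrow_lift_exists by blast
  have \<Phi>1: "\<Phi> \<in> lie_hom P.W.A (lie_quot P.V.A (s_ideal X v))"
    and \<Phi>3: "\<And>u. u \<in> s_ideal X w \<Longrightarrow> \<Phi> u = \<zero>\<^bsub>lie_quot P.V.A (s_ideal X v)\<^esub>"
    using \<Phi> unfolding arrow_lift_def by blast+
  have \<Psi>1: "\<Psi> \<in> lie_hom P.V.A (lie_quot P.W.A (s_ideal X w))"
    and \<Psi>2: "\<And>k. k \<in> P.V.H \<Longrightarrow> \<Psi> (P.V.ct k) = s_ideal X w +>\<^bsub>P.W.A\<^esub> P.W.ct (\<phi> k)"
    and \<Psi>3: "\<And>u. u \<in> s_ideal X v \<Longrightarrow> \<Psi> u = \<zero>\<^bsub>lie_quot P.W.A (s_ideal X w)\<^esub>"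
    using \<Psi> unfolding arrow_lift_def by blast+
  have LW: "\<And>u. u \<in> carrier P.W.A \<Longrightarrow> quot_lift P.W.A \<Phi> (s_ideal X w) (s_ideal X w +>\<^bsub>P.W.A\<^esub> u) = \<Phi> u"
    "quot_lift P.W.A \<Phi> (s_ideal X w) \<in> lie_hom (lie_quot P.W.A (s_ideal X w)) (lie_quot P.V.A (s_ideal X v))"
    by (rule quot_lift[OF P.W.s_ideal_is_ideal \<Phi>1 \<Phi>3]; assumption)+
  have LV: "\<And>u. u \<in> carrier P.V.A \<Longrightarrow> quot_lift P.V.A \<Psi> (s_ideal X v) (s_ideal X v +>\<^bsub>P.V.A\<^esub> u) = \<Psi> u"
    "quot_lift P.V.A \<Psi> (s_ideal X v) \<in> lie_hom (lie_quot P.V.A (s_ideal X v)) (lie_quot P.W.A (s_ideal X w))"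
    by (rule quot_lift[OF P.V.s_ideal_is_ideal \<Psi>1 \<Psi>3]; assumption)+
  show ?thesis
  proof (intro bexI[of _ "quot_lift P.V.A \<Psi> (s_ideal X v)"] ballI)
    show "quot_lift P.V.A \<Psi> (s_ideal X v) (s_ideal X v +>\<^bsub>P.V.A\<^esub> P.V.ct h) = s_ideal X w +>\<^bsub>P.W.A\<^esub> P.W.ct (\<phi> h)"
      if "h \<in> P.V.H" for h
      using LV(1)[OF P.V.ct_carrier[OF that]] \<Psi>2[OF that] by simp
    show "quot_lift P.V.A \<Psi> (s_ideal X v) \<in> lie_iso (lie_quot P.V.A (s_ideal X v)) (lie_quot P.W.A (s_ideal X w))"
    proof (rule lie_isoI[OF LV(2) LW(2)])
      fix q assume "q \<in> carrier (lie_quot P.V.A (s_ideal X v))"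
      then obtain u where u: "u \<in> carrier P.V.A" "q = s_ideal X v +>\<^bsub>P.V.A\<^esub> u"
        unfolding P.V.A.quot_carrier by blast
      show "quot_lift P.W.A \<Phi> (s_ideal X w) (quot_lift P.V.A \<Psi> (s_ideal X v) q) = q"
        using P.arrow_lift_inverse[OF \<Phi> \<Psi> inv(1) u(1)] LV(1)[OF u(1)] u(2) by simp
    next
      fix q assume "q \<in> carrier (lie_quot P.W.A (s_ideal X w))"
      then obtain u where u: "u \<in> carrier P.W.A" "q = s_ideal X w +>\<^bsub>P.W.A\<^esub> u"
        unfolding P.W.A.quot_carrier by blast
      show "quot_lift P.V.A \<Psi> (s_ideal X v) (quot_lift P.W.A \<Phi> (s_ideal X w) q) = q"
        using Q.arrow_lift_inverse[OF \<Psi> \<Phi> inv(2) u(1)] LW(1)[OF u(1)] u(2) by simp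
    qed
  qed
qed


section \<open>Quotients by the maximal ideals avoiding the Cartan subalgebra\<close>

context half_baked_pair
begin

lemma I_subset_r: "I \<subseteq> r_ideal X v"
  by (rule V.r_ideal(2)[OF I])

lemma r_is_ideal: "lie_ideal (r_ideal X v) V.A" and r_free: "r_ideal X v \<inter> V.ct ` V.H = {\<zero>\<^bsub>V.A\<^esub>}"
  using V.r_ideal(1) by (simp_all add: cartan_free_ideal_def)

lemma proj_I_r:
  "quot_lift V.A (\<lambda>u. r_ideal X v +>\<^bsub>V.A\<^esub> u) I \<in> lie_hom (lie_quot V.A I) (lie_quot V.A (r_ideal X v))"
  "u \<in> carrier V.A \<Longrightarrow> quot_lift V.A (\<lambda>u. r_ideal X v +>\<^bsub>V.A\<^esub> u) I (I +>\<^bsub>V.A\<^esub> u) = r_ideal X v +>\<^bsub>V.A\<^esub> u"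
proof -
  note Qr = lie_quot[OF V.A_superalgebra r_is_ideal]
  have ker: "r_ideal X v +>\<^bsub>V.A\<^esub> u = \<zero>\<^bsub>lie_quot V.A (r_ideal X v)\<^esub>" if "u \<in> I" for u
    using that I_subset_r V.A.idealD(2)[OF r_is_ideal] V.A.coset_eq_self_iff[OF r_is_ideal]
    by (auto simp: lie_quot_zero)
  show "quot_lift V.A (\<lambda>u. r_ideal X v +>\<^bsub>V.A\<^esub> u) I \<in> lie_hom (lie_quot V.A I) (lie_quot V.A (r_ideal X v))"
    by (rule quot_lift(2)[OF I_ideal Qr(2) ker])
  show "u \<in> carrier V.A \<Longrightarrow> quot_lift V.A (\<lambda>u. r_ideal X v +>\<^bsub>V.A\<^esub> u) I (I +>\<^bsub>V.A\<^esub> u) = r_ideal X v +>\<^bsub>V.A\<^esub> u"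
    by (rule quot_lift(1)[OF I_ideal Qr(2) ker])
qed

text \<open>The preimage of \<open>r\<close> under \<open>\<chi>\<close> is an ideal over
  \<open>w\<close>. A Cartan element in it has a Cartan image lying in \<open>r\<close>, hence zero,
  so by injectivity of \<open>\<chi>\<close> it lies in \<open>J\<close> and vanishes. Maximality
  then puts the preimage inside \<open>r\<close> at \<open>w\<close>.\<close>

lemma r_transport:
  assumes inj: "\<And>q. q \<in> carrier (lie_quot W.A J) \<Longrightarrow> \<psi> (\<chi> q) = q" and \<psi>0: "\<psi> I = J"
    and u: "u \<in> carrier W.A" and z: "z \<in> r_ideal X v" and eq: "\<chi> (J +>\<^bsub>W.A\<^esub> u) = I +>\<^bsub>V.A\<^esub> z"
  shows "u \<in> r_ideal X w"
proof -
  note QW = lie_quot[OF W.A_superalgebra J_ideal]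
  note Qr = lie_quot[OF V.A_superalgebra r_is_ideal]
  interpret Qr: lie_alg "lie_quot V.A (r_ideal X v)" by (rule lie_alg.intro[OF Qr(1)])
  define \<Theta> where "\<Theta> = quot_lift V.A (\<lambda>u. r_ideal X v +>\<^bsub>V.A\<^esub> u) I \<circ> (\<chi> \<circ> (\<lambda>u. J +>\<^bsub>W.A\<^esub> u))"
  have \<Theta>: "\<Theta> \<in> lie_hom W.A (lie_quot V.A (r_ideal X v))"
    unfolding \<Theta>_def by (rule lie_hom_comp[OF lie_hom_comp[OF QW(2) \<chi>] proj_I_r(1)])
  let ?K = "{u \<in> carrier W.A. \<Theta> u \<in> {\<zero>\<^bsub>lie_quot V.A (r_ideal X v)\<^esub>}}"
  have "lie_ideal ?K W.A" by (rule lie_hom_kernel_ideal[OF \<Theta> Qr.zero_is_ideal])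
  moreover have "?K \<inter> W.ct ` W.H = {\<zero>\<^bsub>W.A\<^esub>}"
  proof (intro subset_antisym subsetI)
    fix u assume "u \<in> ?K \<inter> W.ct ` W.H"
    then obtain k where k: "k \<in> W.H" "u = W.ct k" "\<Theta> u = r_ideal X v" by (auto simp: lie_quot_zero)
    have t: "\<theta> k \<in> V.H" using \<theta>_closed k(1) .
    have "\<Theta> u = r_ideal X v +>\<^bsub>V.A\<^esub> V.ct (\<theta> k)"
      unfolding \<Theta>_def k(2) using \<chi>_cart[OF k(1)] proj_I_r(2)[OF V.ct_carrier[OF t]] by simp
    then have "V.ct (\<theta> k) \<in> r_ideal X v" using k(3) V.A.coset_eq_self_iff[OF r_is_ideal V.ct_carrier[OF t]] by simp
    then have "V.ct (\<theta> k) = \<zero>\<^bsub>V.A\<^esub>" using r_free t by blast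
    then have "\<chi> (J +>\<^bsub>W.A\<^esub> u) = I" using \<chi>_cart[OF k(1)] k(2) V.A.coset_zero[OF I_ideal] by simp
    moreover have "J +>\<^bsub>W.A\<^esub> u \<in> carrier (lie_quot W.A J)" using k W.A.quot_carrier by auto
    ultimately have "J +>\<^bsub>W.A\<^esub> u = J" using inj \<psi>0 by metis
    then have "u \<in> J" using W.A.coset_eq_self_iff[OF J_ideal] k by simp
    then show "u \<in> {\<zero>\<^bsub>W.A\<^esub>}" using J_free k by blast
  next
    fix u assume "u \<in> {\<zero>\<^bsub>W.A\<^esub>}"
    then show "u \<in> ?K \<inter> W.ct ` W.H"
      using W.A.subspaceD(2)[OF W.ct_image_subspace] lie_homD(8)[OF \<Theta>] by simp
  qed
  ultimately have K: "?K \<subseteq> r_ideal X w" by (intro W.r_ideal(2)) (simp add: cartan_free_ideal_def)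
  have zc: "z \<in> carrier V.A" using z V.A.idealD(2)[OF r_is_ideal] by blast
  have "\<Theta> u = r_ideal X v +>\<^bsub>V.A\<^esub> z" unfolding \<Theta>_def using eq proj_I_r(2)[OF zc] by simp
  then have "\<Theta> u = \<zero>\<^bsub>lie_quot V.A (r_ideal X v)\<^esub>"
    using z V.A.coset_eq_self_iff[OF r_is_ideal zc] by (simp add: lie_quot_zero)
  then show ?thesis using K u by blast
qed

end

text \<open>Apply \<open>\<psi>\<close> and project to the quotient by \<open>r\<close> at
  \<open>w\<close>. The elements of \<open>r\<close> at \<open>v\<close> are killed because
  \<open>r_transport\<close> is applied to the inverse \<open>\<chi>\<close>. Describing the result
  by representatives makes two such maps easy to compose.\<close>

lemma r_quotient_hom:
  assumes "half_baked_pair X v w I J \<chi> \<phi> \<theta>" and "half_baked_pair X w v J I \<psi> \<theta> \<phi>"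
    and inv: "\<And>q. q \<in> carrier (lie_quot (half_baked X v) I) \<Longrightarrow> \<chi> (\<psi> q) = q"
      "\<And>q. q \<in> carrier (lie_quot (half_baked X w) J) \<Longrightarrow> \<psi> (\<chi> q) = q"
  shows "\<exists>\<Psi>\<in>lie_hom (lie_quot (half_baked X v) (r_ideal X v)) (lie_quot (half_baked X w) (r_ideal X w)).
     \<forall>u\<in>carrier (half_baked X v). \<forall>z\<in>carrier (half_baked X w).
        \<psi> (I +>\<^bsub>half_baked X v\<^esub> u) = J +>\<^bsub>half_baked X w\<^esub> z
        \<longrightarrow> \<Psi> (r_ideal X v +>\<^bsub>half_baked X v\<^esub> u) = r_ideal X w +>\<^bsub>half_baked X w\<^esub> z"
proof -
  interpret P: half_baked_pair X v w I J \<chi> \<phi> \<theta> by fact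
  interpret Q: half_baked_pair X w v J I \<psi> \<theta> \<phi> by fact
  let ?rv = "r_ideal X v" and ?rw = "r_ideal X w"
  note QV = lie_quot[OF P.V.A_superalgebra P.I_ideal]
  define \<Theta> where "\<Theta> = quot_lift P.W.A (\<lambda>u. ?rw +>\<^bsub>P.W.A\<^esub> u) J \<circ> (\<psi> \<circ> (\<lambda>u. I +>\<^bsub>P.V.A\<^esub> u))"
  have \<Theta>: "\<Theta> \<in> lie_hom P.V.A (lie_quot P.W.A ?rw)"
    unfolding \<Theta>_def by (rule lie_hom_comp[OF lie_hom_comp[OF QV(2) Q.\<chi>] Q.proj_I_r(1)])
  have eval: "\<Theta> u = ?rw +>\<^bsub>P.W.A\<^esub> z"
    if "z \<in> carrier P.W.A" "\<psi> (I +>\<^bsub>P.V.A\<^esub> u) = J +>\<^bsub>P.W.A\<^esub> z" for u z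
    unfolding \<Theta>_def using Q.proj_I_r(2)[OF that(1)] that(2) by simp
  have rep: "\<exists>z\<in>carrier P.W.A. \<psi> (I +>\<^bsub>P.V.A\<^esub> u) = J +>\<^bsub>P.W.A\<^esub> z" if "u \<in> carrier P.V.A" for u
    using lie_homD(3)[OF Q.\<chi> lie_homD(3)[OF QV(2) that]] unfolding P.W.A.quot_carrier by blast
  have \<psi>0: "\<psi> I = J" using lie_homD(8)[OF Q.\<chi>] by (simp add: lie_quot_zero)
  have ker: "\<Theta> u = \<zero>\<^bsub>lie_quot P.W.A ?rw\<^esub>" if u: "u \<in> ?rv" for u
  proof -
    have uc: "u \<in> carrier P.V.A" using u P.V.A.idealD(2)[OF P.r_is_ideal] by blast
    obtain z where z: "z \<in> carrier P.W.A" "\<psi> (I +>\<^bsub>P.V.A\<^esub> u) = J +>\<^bsub>P.W.A\<^esub> z" using rep[OF uc] by blast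
    have "I +>\<^bsub>P.V.A\<^esub> u \<in> carrier (lie_quot P.V.A I)" using uc P.V.A.quot_carrier by blast
    then have c: "\<chi> (J +>\<^bsub>P.W.A\<^esub> z) = I +>\<^bsub>P.V.A\<^esub> u" using inv(1) z(2) by metis
    have "z \<in> ?rw" by (rule P.r_transport[where \<psi> = \<psi>, OF inv(2) \<psi>0 z(1) u c])
    then show ?thesis using eval[OF z] P.W.A.coset_eq_self_iff[OF Q.r_is_ideal z(1)] by (simp add: lie_quot_zero)
  qed
  have L: "\<And>u. u \<in> carrier P.V.A \<Longrightarrow> quot_lift P.V.A \<Theta> ?rv (?rv +>\<^bsub>P.V.A\<^esub> u) = \<Theta> u"
    "quot_lift P.V.A \<Theta> ?rv \<in> lie_hom (lie_quot P.V.A ?rv) (lie_quot P.W.A ?rw)"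
    by (rule quot_lift[OF P.r_is_ideal \<Theta> ker]; assumption)+
  show ?thesis
    by (intro bexI[OF _ L(2)] ballI impI) (simp add: L(1) eval)
qed

lemma r_quotient_iso:
  assumes PQ: "half_baked_pair X v w I J \<chi> \<phi> \<theta>" "half_baked_pair X w v J I \<psi> \<theta> \<phi>"
    and inv: "\<And>q. q \<in> carrier (lie_quot (half_baked X v) I) \<Longrightarrow> \<chi> (\<psi> q) = q"
      "\<And>q. q \<in> carrier (lie_quot (half_baked X w) J) \<Longrightarrow> \<psi> (\<chi> q) = q"
  shows "\<exists>\<Psi>\<in>lie_iso (lie_quot (half_baked X v) (r_ideal X v)) (lie_quot (half_baked X w) (r_ideal X w)).
     \<forall>h\<in>carrier (hsp v). \<Psi> (r_ideal X v +>\<^bsub>half_baked X v\<^esub> hb_cart X v h)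
        = r_ideal X w +>\<^bsub>half_baked X w\<^esub> hb_cart X w (\<phi> h)"
proof -
  interpret P: half_baked_pair X v w I J \<chi> \<phi> \<theta> by fact
  interpret Q: half_baked_pair X w v J I \<psi> \<theta> \<phi> by fact
  let ?rv = "r_ideal X v" and ?rw = "r_ideal X w"
  obtain \<Psi> where \<Psi>: "\<Psi> \<in> lie_hom (lie_quot P.V.A ?rv) (lie_quot P.W.A ?rw)"
    "\<And>u z. \<lbrakk>u \<in> carrier P.V.A; z \<in> carrier P.W.A; \<psi> (I +>\<^bsub>P.V.A\<^esub> u) = J +>\<^bsub>P.W.A\<^esub> z\<rbrakk>
      \<Longrightarrow> \<Psi> (?rv +>\<^bsub>P.V.A\<^esub> u) = ?rw +>\<^bsub>P.W.A\<^esub> z"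
    using r_quotient_hom[OF PQ inv] by blast
  obtain \<Phi> where \<Phi>: "\<Phi> \<in> lie_hom (lie_quot P.W.A ?rw) (lie_quot P.V.A ?rv)"
    "\<And>u z. \<lbrakk>u \<in> carrier P.W.A; z \<in> carrier P.V.A; \<chi> (J +>\<^bsub>P.W.A\<^esub> u) = I +>\<^bsub>P.V.A\<^esub> z\<rbrakk>
      \<Longrightarrow> \<Phi> (?rw +>\<^bsub>P.W.A\<^esub> u) = ?rv +>\<^bsub>P.V.A\<^esub> z"
    using r_quotient_hom[OF PQ(2,1) inv(2,1)] by blast
  have Vc: "I +>\<^bsub>P.V.A\<^esub> u \<in> carrier (lie_quot P.V.A I)" if "u \<in> carrier P.V.A" for u
    using that P.V.A.quot_carrier by blast
  have Wc: "J +>\<^bsub>P.W.A\<^esub> u \<in> carrier (lie_quot P.W.A J)" if "u \<in> carrier P.W.A" for u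
    using that P.W.A.quot_carrier by blast
  show ?thesis
  proof (intro bexI[of _ \<Psi>] ballI)
    show "\<Psi> (?rv +>\<^bsub>P.V.A\<^esub> P.V.ct h) = ?rw +>\<^bsub>P.W.A\<^esub> P.W.ct (\<phi> h)" if "h \<in> P.V.H" for h
      using \<Psi>(2)[OF P.V.ct_carrier[OF that] P.W.ct_carrier[OF P.\<phi>_closed[OF that]]] Q.\<chi>_cart[OF that] by simp
    show "\<Psi> \<in> lie_iso (lie_quot P.V.A ?rv) (lie_quot P.W.A ?rw)"
    proof (rule lie_isoI[OF \<Psi>(1) \<Phi>(1)])
      fix q assume "q \<in> carrier (lie_quot P.V.A ?rv)"
      then obtain u where u: "u \<in> carrier P.V.A" "q = ?rv +>\<^bsub>P.V.A\<^esub> u" unfolding P.V.A.quot_carrier by blast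
      obtain z where z: "z \<in> carrier P.W.A" "\<psi> (I +>\<^bsub>P.V.A\<^esub> u) = J +>\<^bsub>P.W.A\<^esub> z"
        using lie_homD(3)[OF Q.\<chi> Vc[OF u(1)]] unfolding P.W.A.quot_carrier by blast
      have "\<chi> (J +>\<^bsub>P.W.A\<^esub> z) = I +>\<^bsub>P.V.A\<^esub> u" using inv(1)[OF Vc[OF u(1)]] z(2) by simp
      then show "\<Phi> (\<Psi> q) = q" using \<Psi>(2)[OF u(1) z] \<Phi>(2)[OF z(1) u(1)] u(2) by simp
    next
      fix q assume "q \<in> carrier (lie_quot P.W.A ?rw)"
      then obtain u where u: "u \<in> carrier P.W.A" "q = ?rw +>\<^bsub>P.W.A\<^esub> u" unfolding P.W.A.quot_carrier by blast
      obtain z where z: "z \<in> carrier P.V.A" "\<chi> (J +>\<^bsub>P.W.A\<^esub> u) = I +>\<^bsub>P.V.A\<^esub> z"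
        using lie_homD(3)[OF P.\<chi> Wc[OF u(1)]] unfolding P.V.A.quot_carrier by blast
      have "\<psi> (I +>\<^bsub>P.V.A\<^esub> z) = J +>\<^bsub>P.W.A\<^esub> u" using inv(2)[OF Wc[OF u(1)]] z(2) by simp
      then show "\<Psi> (\<Phi> q) = q" using \<Phi>(2)[OF u(1) z] \<Psi>(2)[OF z(1) u(1)] u(2) by simp
    qed
  qed
qed

text \<open>
  The weight \<open>b x - b y\<close> does not occur in the half-baked algebra, and weight spaces are transported
  along isomorphisms of quotients.
\<close>

lemma weight_difference_in_ideal:
  assumes "half_baked_pair X w v J I \<psi> \<theta> \<phi>"
    and inj: "\<And>q. q \<in> carrier (lie_quot (half_baked X v) I) \<Longrightarrow> \<chi> (\<psi> q) = q" and \<chi>0: "\<chi> J = I"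
    and xy: "x \<in> X" "y \<in> X" "x \<noteq> y" and u: "u \<in> carrier (half_baked X v)"
    and weight: "\<And>h. h \<in> carrier (hsp v) \<Longrightarrow>
      brk (half_baked X v) (hb_cart X v h) u = (bv w x (\<phi> h) - bv w y (\<phi> h)) \<odot>\<^bsub>half_baked X v\<^esub> u"
  shows "u \<in> I"
proof -
  interpret Q: half_baked_pair X w v J I \<psi> \<theta> \<phi> by fact
  note VD = lie_quot[OF Q.W.A_superalgebra Q.J_ideal] and WD = lie_quot[OF Q.V.A_superalgebra Q.I_ideal]
  note \<psi>D = lie_homD[OF Q.\<chi>]
  have uc: "I +>\<^bsub>Q.W.A\<^esub> u \<in> carrier (lie_quot Q.W.A I)" using lie_homD(3)[OF VD(2) u] .
  obtain z where z: "z \<in> carrier Q.V.A" "\<psi> (I +>\<^bsub>Q.W.A\<^esub> u) = J +>\<^bsub>Q.V.A\<^esub> z"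
    using \<psi>D(3)[OF uc] unfolding Q.V.A.quot_carrier by blast
  \<comment> \<open>The class of \<open>z\<close> has weight \<open>b x - b y\<close> modulo
    \<open>J\<close>, taken with the \<open>b\<close> of \<open>w\<close>. That weight is absent
    over \<open>w\<close>, so the class is zero, and injectivity of \<open>\<psi>\<close> brings
    this back to \<open>u\<close>.\<close>
  have "z \<in> J"
  proof (rule Q.V.weight_diff_mod[OF Q.I_ideal z(1) xy])
    fix k assume k: "k \<in> Q.V.H"
    have h: "\<theta> k \<in> Q.W.H" "\<phi> (\<theta> k) = k" using Q.\<phi>_closed[OF k] Q.\<theta>_\<phi>[OF k] by auto
    have hc: "I +>\<^bsub>Q.W.A\<^esub> Q.W.ct (\<theta> k) \<in> carrier (lie_quot Q.W.A I)"
      using lie_homD(3)[OF VD(2) Q.W.ct_carrier[OF h(1)]] .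
    have "J +>\<^bsub>Q.V.A\<^esub> brk Q.V.A (Q.V.ct k) z = brk (lie_quot Q.V.A J) (\<psi> (I +>\<^bsub>Q.W.A\<^esub> Q.W.ct (\<theta> k))) (\<psi> (I +>\<^bsub>Q.W.A\<^esub> u))"
      using lie_homD(6)[OF WD(2) Q.V.ct_carrier[OF k] z(1)] Q.\<chi>_cart[OF h(1)] h(2) z(2) by simp
    also have "\<dots> = \<psi> (I +>\<^bsub>Q.W.A\<^esub> brk Q.W.A (Q.W.ct (\<theta> k)) u)"
      using \<psi>D(6)[OF hc uc] lie_homD(6)[OF VD(2) Q.W.ct_carrier[OF h(1)] u] by simp
    also have "\<dots> = \<psi> (I +>\<^bsub>Q.W.A\<^esub> ((bv w x k - bv w y k) \<odot>\<^bsub>Q.W.A\<^esub> u))"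
      using weight[OF h(1)] h(2) by simp
    also have "\<dots> = J +>\<^bsub>Q.V.A\<^esub> ((bv w x k - bv w y k) \<odot>\<^bsub>Q.V.A\<^esub> z)"
      using lie_homD(5)[OF VD(2) u] \<psi>D(5)[OF uc] z(2) lie_homD(5)[OF WD(2) z(1)] by simp
    finally show "brk Q.V.A (Q.V.ct k) z \<ominus>\<^bsub>Q.V.A\<^esub> (bv w x k - bv w y k) \<odot>\<^bsub>Q.V.A\<^esub> z \<in> J"
      using Q.V.A.coset_eq_iff[OF Q.I_ideal] k z(1) by simp
  qed
  then have "\<psi> (I +>\<^bsub>Q.W.A\<^esub> u) = J" using z Q.V.A.coset_eq_self_iff[OF Q.I_ideal z(1)] by simp
  then have "I +>\<^bsub>Q.W.A\<^esub> u = I" using inj[OF uc] \<chi>0 by simp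
  then show ?thesis using Q.W.A.coset_eq_self_iff[OF Q.J_ideal u] by simp
qed


section \<open>Reflexions\<close>

context fixed_root_datum
begin

text \<open>
  Both kinds of reflexion have the form \<open>a' y = a y + n y * a x\<close>, \<open>b' y = b y + m y * b x\<close> with
  \<open>n x = m x = - 2\<close>.
\<close>

definition a_coeff :: "'x \<Rightarrow> 'x \<Rightarrow> complex" where
  "a_coeff x y = (if cartan v x x \<noteq> 0 then - (2 * cartan v y x / cartan v x x) else if y = x then - 2
     else if cartan v x y = 0 then 0 else cartan v y x / cartan v x y)"

definition b_coeff :: "'x \<Rightarrow> 'x \<Rightarrow> complex" where
  "b_coeff x y = (if cartan v x x \<noteq> 0 then - (2 * cartan v x y / cartan v x x) else if y = x then - 2
     else if cartan v x y = 0 then 0 else 1)"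

lemma coeff_self: "a_coeff x x = - 2" "b_coeff x x = - 2"
  by (simp_all add: a_coeff_def b_coeff_def)

lemma hsp_reflexion [simp]: "hsp (reflexion X x v) = Hv"
  by (simp add: reflexion_def Let_def)

lemma av_reflexion:
  assumes "x \<in> X" "y \<in> X"
  shows "av (reflexion X x v) y = av v y \<oplus>\<^bsub>Hv\<^esub> a_coeff x y \<odot>\<^bsub>Hv\<^esub> av v x"
proof -
  have 1: "av v y \<ominus>\<^bsub>Hv\<^esub> c \<odot>\<^bsub>Hv\<^esub> av v x = av v y \<oplus>\<^bsub>Hv\<^esub> (- c) \<odot>\<^bsub>Hv\<^esub> av v x" for c
    using assms by (simp add: H.minus_eq H.neg_scale H.scale_scale)
  have 2: "\<ominus>\<^bsub>Hv\<^esub> av v x = av v x \<oplus>\<^bsub>Hv\<^esub> (- 2) \<odot>\<^bsub>Hv\<^esub> av v x"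
    using assms H.scale_add_left[of "av v x" 1 "- 2"] by (simp add: H.neg_scale)
  show ?thesis
    using assms by (auto simp: reflexion_def Let_def a_coeff_def 1 2)
qed

lemma bv_reflexion:
  assumes "y \<in> X" "h \<in> carrier Hv"
  shows "bv (reflexion X x v) y h = bv v y h + b_coeff x y * bv v x h"
  using assms by (auto simp: reflexion_def Let_def b_coeff_def)

lemma pv_reflexion:
  "y \<in> X \<Longrightarrow> pv (reflexion X x v) y
    = (if cartan v x x \<noteq> 0 \<or> y = x \<or> cartan v x y = 0 then pv v y else 1 + pv v y)"
  by (auto simp: reflexion_def Let_def)

lemma reflexion_extensional:
  "av (reflexion X x v) \<in> extensional X" "bv (reflexion X x v) \<in> extensional X"
  "pv (reflexion X x v) \<in> extensional X"
  "y \<in> X \<Longrightarrow> bv (reflexion X x v) y \<in> extensional (carrier Hv)"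
  using pv_extensional by (auto simp: reflexion_def Let_def)

lemma finsum_shift:
  assumes x: "x \<in> X" and "finite Y" "Y \<subseteq> X"
  shows "(\<Oplus>\<^bsub>Hv\<^esub>y\<in>Y. c y \<odot>\<^bsub>Hv\<^esub> (av v y \<oplus>\<^bsub>Hv\<^esub> n y \<odot>\<^bsub>Hv\<^esub> av v x))
    = (\<Oplus>\<^bsub>Hv\<^esub>y\<in>Y. c y \<odot>\<^bsub>Hv\<^esub> av v y) \<oplus>\<^bsub>Hv\<^esub> (\<Sum>y\<in>Y. c y * n y) \<odot>\<^bsub>Hv\<^esub> av v x"
  using assms(2,3)
proof (induction Y rule: finite_induct)
  case (insert z Y)
  have 1: "(\<lambda>y. c y \<odot>\<^bsub>Hv\<^esub> (av v y \<oplus>\<^bsub>Hv\<^esub> n y \<odot>\<^bsub>Hv\<^esub> av v x)) \<in> Y \<rightarrow> carrier Hv"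
    "(\<lambda>y. c y \<odot>\<^bsub>Hv\<^esub> av v y) \<in> Y \<rightarrow> carrier Hv" using insert.prems x by auto
  have c: "(\<Oplus>\<^bsub>Hv\<^esub>y\<in>Y. c y \<odot>\<^bsub>Hv\<^esub> av v y) \<in> carrier Hv" using 1 by simp
  show ?case using insert x 1 c
    by (simp add: H.scale_add_right H.scale_add_left H.scale_scale H.a_ac)
qed (use x in simp)

lemma finsum_at:
  assumes x: "x \<in> X" and "finite Y" "Y \<subseteq> X"
  shows "(\<Oplus>\<^bsub>Hv\<^esub>y\<in>Y. (c y + (if y = x then k else 0)) \<odot>\<^bsub>Hv\<^esub> av v y)
    = (\<Oplus>\<^bsub>Hv\<^esub>y\<in>Y. c y \<odot>\<^bsub>Hv\<^esub> av v y) \<oplus>\<^bsub>Hv\<^esub> (if x \<in> Y then k else 0) \<odot>\<^bsub>Hv\<^esub> av v x"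
  using assms(2,3)
proof (induction Y rule: finite_induct)
  case (insert z Y)
  have 1: "(\<lambda>y. (c y + (if y = x then k else 0)) \<odot>\<^bsub>Hv\<^esub> av v y) \<in> Y \<rightarrow> carrier Hv"
    "(\<lambda>y. c y \<odot>\<^bsub>Hv\<^esub> av v y) \<in> Y \<rightarrow> carrier Hv" using insert.prems x by auto
  have c: "(\<Oplus>\<^bsub>Hv\<^esub>y\<in>Y. c y \<odot>\<^bsub>Hv\<^esub> av v y) \<in> carrier Hv" using 1 by simp
  show ?case
  proof (cases "z = x")
    case True
    then show ?thesis using insert x 1 c by (simp add: H.scale_add_left H.a_ac)
  next
    case False
    then show ?thesis using insert x 1 c by (simp add: H.a_ac)
  qed
qed (use x in simp)

text \<open>By \<open>finsum_shift\<close> and \<open>finsum_at\<close>, a relation among the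
  reflected vectors with coefficients \<open>c\<close> is one among the original vectors whose
  coefficient at \<open>x\<close> is increased by the sum of all \<open>c z * n z\<close>. Hence
  \<open>c\<close> vanishes off \<open>x\<close>, and at \<open>x\<close> the equation reads
  \<open>c x - 2 * c x = 0\<close>.\<close>

lemma reflected_coefficients_vanish:
  assumes x: "x \<in> X" and n: "n x = (- 2 :: complex)"
    and d: "\<And>y. y \<in> X \<Longrightarrow> c y + (if y = x then \<Sum>z\<in>X. c z * n z else 0) = 0"
    and y: "y \<in> X"
  shows "c y = 0"
proof -
  have off: "c z = 0" if "z \<in> X" "z \<noteq> x" for z using d[OF that(1)] that(2) by simp
  have "(\<Sum>z\<in>X. c z * n z) = c x * n x + (\<Sum>z\<in>X - {x}. c z * n z)"
    using fin x by (simp add: sum.remove)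
  also have "(\<Sum>z\<in>X - {x}. c z * n z) = 0" using off by (intro sum.neutral) auto
  finally have "c x = 0" using d[OF x] n by simp
  then show ?thesis using off[OF y] by (cases "y = x") auto
qed

lemma reflexion_root_datum:
  assumes x: "x \<in> X"
  shows "is_root_datum X (reflexion X x v)"
  unfolding is_root_datum_def hsp_reflexion
proof (intro conjI)
  show "vectorspace class_ring Hv" "vectorspace.fin_dim class_ring Hv"
    using root_datum by (simp_all add: is_root_datum_def)
  show "av (reflexion X x v) \<in> X \<rightarrow>\<^sub>E carrier Hv"
    using reflexion_extensional(1) x by (auto simp: PiE_def av_reflexion)
  show "bv (reflexion X x v) \<in> X \<rightarrow>\<^sub>E dual_space Hv"
    using reflexion_extensional(2,4) x
    by (auto simp: PiE_def dual_space_def bv_reflexion bv_add bv_scale algebra_simps)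
  show "pv (reflexion X x v) \<in> extensional X" by (rule reflexion_extensional)
  show "\<forall>c. (\<Oplus>\<^bsub>Hv\<^esub>y\<in>X. c y \<odot>\<^bsub>Hv\<^esub> av (reflexion X x v) y) = \<zero>\<^bsub>Hv\<^esub> \<longrightarrow> (\<forall>x\<in>X. c x = 0)"
  proof (intro allI impI ballI)
    fix c y assume *: "(\<Oplus>\<^bsub>Hv\<^esub>y\<in>X. c y \<odot>\<^bsub>Hv\<^esub> av (reflexion X x v) y) = \<zero>\<^bsub>Hv\<^esub>" and y: "y \<in> X"
    have "(\<Oplus>\<^bsub>Hv\<^esub>y\<in>X. c y \<odot>\<^bsub>Hv\<^esub> av (reflexion X x v) y)
        = (\<Oplus>\<^bsub>Hv\<^esub>y\<in>X. c y \<odot>\<^bsub>Hv\<^esub> (av v y \<oplus>\<^bsub>Hv\<^esub> a_coeff x y \<odot>\<^bsub>Hv\<^esub> av v x))"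
      by (rule H.finsum_cong') (use x in \<open>auto simp: av_reflexion\<close>)
    also have "\<dots> = (\<Oplus>\<^bsub>Hv\<^esub>y\<in>X. (c y + (if y = x then \<Sum>z\<in>X. c z * a_coeff x z else 0)) \<odot>\<^bsub>Hv\<^esub> av v y)"
      by (simp only: finsum_shift[OF x fin subset_refl] finsum_at[OF x fin subset_refl] x if_True)
    finally have "(\<Oplus>\<^bsub>Hv\<^esub>y\<in>X. (c y + (if y = x then \<Sum>z\<in>X. c z * a_coeff x z else 0)) \<odot>\<^bsub>Hv\<^esub> av v y) = \<zero>\<^bsub>Hv\<^esub>"
      using * by (simp only:)
    note 1 = a_independent[OF this]
    show "c y = 0" by (rule reflected_coefficients_vanish[OF x coeff_self(1) 1 y])
  qed
  show "\<forall>c. (\<forall>h\<in>carrier Hv. (\<Sum>y\<in>X. c y * bv (reflexion X x v) y h) = 0) \<longrightarrow> (\<forall>x\<in>X. c x = 0)"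
  proof (intro allI impI ballI)
    fix c y assume *: "\<forall>h\<in>carrier Hv. (\<Sum>y\<in>X. c y * bv (reflexion X x v) y h) = 0" and y: "y \<in> X"
    let ?k = "\<Sum>z\<in>X. c z * b_coeff x z"
    have "(\<Sum>y\<in>X. (c y + (if y = x then ?k else 0)) * bv v y h) = 0" if h: "h \<in> carrier Hv" for h
    proof -
      have "(\<Sum>y\<in>X. (c y + (if y = x then ?k else 0)) * bv v y h)
          = (\<Sum>y\<in>X. c y * bv v y h + (if y = x then ?k * bv v x h else 0))"
        by (intro sum.cong) (auto simp: algebra_simps)
      also have "\<dots> = (\<Sum>y\<in>X. c y * bv v y h) + ?k * bv v x h"
        using fin x by (simp add: sum.distrib)
      also have "\<dots> = (\<Sum>y\<in>X. c y * (bv v y h + b_coeff x y * bv v x h))"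
        by (simp add: sum.distrib sum_distrib_right distrib_left mult.assoc)
      also have "\<dots> = 0" using bspec[OF * h] h by (simp add: bv_reflexion)
      finally show ?thesis .
    qed
    note 1 = b_independent[OF this]
    show "c y = 0" by (rule reflected_coefficients_vanish[OF x coeff_self(2) 1 y])
  qed
qed

lemma cartan_reflexion:
  assumes "x \<in> X" "y \<in> X" "z \<in> X"
  shows "cartan (reflexion X x v) y z = cartan v y z + a_coeff x y * cartan v x z
    + b_coeff x z * (cartan v y x + a_coeff x y * cartan v x x)"
  using assms by (simp add: cartan_def av_reflexion bv_reflexion bv_add bv_scale)

text \<open>Row and column of \<open>x\<close> are kept in the anisotropic case and both negated in
  the isotropic one. All quotients defining the coefficients of the reflexion at \<open>x\<close>
  are therefore unchanged.\<close>

lemma cartan_reflexion_row: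
  assumes "x \<in> X" "y \<in> X"
  shows "cartan (reflexion X x v) x y = (if cartan v x x \<noteq> 0 then cartan v x y else - cartan v x y)"
    "cartan (reflexion X x v) y x = (if cartan v x x \<noteq> 0 then cartan v y x else - cartan v y x)"
  using assms by (auto simp: cartan_reflexion coeff_self) (auto simp: a_coeff_def b_coeff_def field_simps)

end

text \<open>Both reflexions at \<open>x\<close> use the same coefficient \<open>n y\<close>, while
  \<open>a x\<close> has changed sign in between, so the added terms \<open>n y * a x\<close> and
  \<open>- n y * a x\<close> cancel; likewise for \<open>b\<close>. Parities are either kept or
  changed twice.\<close>

lemma reflexion_involution:
  assumes fin: "finite X" and rd: "is_root_datum X v" and r: "reflectable X v x"
  shows "reflectable X (reflexion X x v) x" "reflexion X x (reflexion X x v) = v"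
proof -
  interpret V: fixed_root_datum X v by unfold_locales fact+
  have x: "x \<in> X" using r by (simp add: reflectable_def)
  let ?w = "reflexion X x v"
  interpret W: fixed_root_datum X ?w
    by unfold_locales (use fin V.reflexion_root_datum[OF x] in auto)
  have row: "cartan ?w x y = (if cartan v x x \<noteq> 0 then cartan v x y else - cartan v x y)"
    "cartan ?w y x = (if cartan v x x \<noteq> 0 then cartan v y x else - cartan v y x)" if "y \<in> X" for y
    using V.cartan_reflexion_row[OF x that] by auto
  show "reflectable X ?w x"
    using r x row by (auto simp: reflectable_def V.pv_reflexion)
  have a: "W.a_coeff x y = V.a_coeff x y" and b: "W.b_coeff x y = V.b_coeff x y" if "y \<in> X" for y
    using row[OF that] row[OF x] by (auto simp: W.a_coeff_def V.a_coeff_def W.b_coeff_def V.b_coeff_def)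
  show "reflexion X x ?w = v"
  proof (rule root_datum.equality)
    show "hsp (reflexion X x ?w) = hsp v" using W.hsp_reflexion V.hsp_reflexion by simp
    show "av (reflexion X x ?w) = av v"
    proof (rule extensionalityI[OF W.reflexion_extensional(1) V.av_extensional])
      fix y assume y: "y \<in> X"
      have "av (reflexion X x ?w) y = (av v y \<oplus>\<^bsub>hsp v\<^esub> V.a_coeff x y \<odot>\<^bsub>hsp v\<^esub> av v x)
          \<oplus>\<^bsub>hsp v\<^esub> V.a_coeff x y \<odot>\<^bsub>hsp v\<^esub> (av v x \<oplus>\<^bsub>hsp v\<^esub> (- 2) \<odot>\<^bsub>hsp v\<^esub> av v x)"
        using W.av_reflexion[OF x y] V.av_reflexion[OF x y] V.av_reflexion[OF x x] a[OF y]
        by (simp add: V.coeff_self)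
      also have "av v x \<oplus>\<^bsub>hsp v\<^esub> (- 2) \<odot>\<^bsub>hsp v\<^esub> av v x = (- 1) \<odot>\<^bsub>hsp v\<^esub> av v x"
        using V.H.scale_add_left[of "av v x" 1 "- 2"] x by simp
      also have "(av v y \<oplus>\<^bsub>hsp v\<^esub> V.a_coeff x y \<odot>\<^bsub>hsp v\<^esub> av v x)
          \<oplus>\<^bsub>hsp v\<^esub> V.a_coeff x y \<odot>\<^bsub>hsp v\<^esub> ((- 1) \<odot>\<^bsub>hsp v\<^esub> av v x)
          = av v y \<oplus>\<^bsub>hsp v\<^esub> (V.a_coeff x y + - V.a_coeff x y) \<odot>\<^bsub>hsp v\<^esub> av v x"
        unfolding V.H.scale_add_left[OF V.av_closed[OF x]]
        using x y by (simp add: V.H.scale_scale V.H.a_assoc)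
      also have "\<dots> = av v y" using x y by simp
      finally show "av (reflexion X x ?w) y = av v y" .
    qed
    show "bv (reflexion X x ?w) = bv v"
    proof (rule extensionalityI[OF W.reflexion_extensional(2) V.bv_extensional])
      fix y assume y: "y \<in> X"
      show "bv (reflexion X x ?w) y = bv v y"
      proof (rule extensionalityI[OF _ V.bv_ext[OF y]])
        show "bv (reflexion X x ?w) y \<in> extensional (carrier (hsp v))"
          using W.reflexion_extensional(4)[OF y] by simp
        fix h assume "h \<in> carrier (hsp v)"
        then show "bv (reflexion X x ?w) y h = bv v y h"
          using W.bv_reflexion[OF y, of h x] V.bv_reflexion[OF y, of h x] V.bv_reflexion[OF x, of h x] b[OF y]
          by (simp add: V.coeff_self)
      qed
    qed
    show "pv (reflexion X x ?w) = pv v"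
    proof (rule extensionalityI[OF W.reflexion_extensional(3) V.pv_extensional])
      fix y assume y: "y \<in> X"
      have "1 + (1 + i) = (i :: bit)" for i by (cases i) simp_all
      then show "pv (reflexion X x ?w) y = pv v y"
        using W.pv_reflexion[OF y, of x] V.pv_reflexion[OF y, of x] row[OF x] row[OF y] by auto
    qed
  qed simp
qed


section \<open>Linear isomorphisms and similar root data\<close>

lemma linear_isoD:
  assumes "\<theta> \<in> linear_iso H K"
  shows "vectorspace class_ring H" "vectorspace class_ring K" "bij_betw \<theta> (carrier H) (carrier K)"
    "\<And>h. h \<in> carrier H \<Longrightarrow> \<theta> h \<in> carrier K"
    "\<And>h k. h \<in> carrier H \<Longrightarrow> k \<in> carrier H \<Longrightarrow> \<theta> (h \<oplus>\<^bsub>H\<^esub> k) = \<theta> h \<oplus>\<^bsub>K\<^esub> \<theta> k"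
    "\<And>c h. h \<in> carrier H \<Longrightarrow> \<theta> (c \<odot>\<^bsub>H\<^esub> h) = c \<odot>\<^bsub>K\<^esub> \<theta> h" "\<theta> \<in> extensional (carrier H)"
proof -
  have "linear_map class_ring H K \<theta>" using assms by (simp add: linear_iso_def)
  then interpret linear_map class_ring H K \<theta> .
  show "vectorspace class_ring H" "vectorspace class_ring K" ..
  show "bij_betw \<theta> (carrier H) (carrier K)" "\<theta> \<in> extensional (carrier H)" using assms by (simp_all add: linear_iso_def)
  show "\<And>h. h \<in> carrier H \<Longrightarrow> \<theta> h \<in> carrier K" by simp
  show "\<And>h k. h \<in> carrier H \<Longrightarrow> k \<in> carrier H \<Longrightarrow> \<theta> (h \<oplus>\<^bsub>H\<^esub> k) = \<theta> h \<oplus>\<^bsub>K\<^esub> \<theta> k"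
    and "\<And>c h. h \<in> carrier H \<Longrightarrow> \<theta> (c \<odot>\<^bsub>H\<^esub> h) = c \<odot>\<^bsub>K\<^esub> \<theta> h" by simp_all
qed

lemma linear_isoI:
  assumes "vectorspace class_ring H" "vectorspace class_ring K" "bij_betw \<theta> (carrier H) (carrier K)"
    "\<And>h k. h \<in> carrier H \<Longrightarrow> k \<in> carrier H \<Longrightarrow> \<theta> (h \<oplus>\<^bsub>H\<^esub> k) = \<theta> h \<oplus>\<^bsub>K\<^esub> \<theta> k"
    "\<And>c h. h \<in> carrier H \<Longrightarrow> \<theta> (c \<odot>\<^bsub>H\<^esub> h) = c \<odot>\<^bsub>K\<^esub> \<theta> h" "\<theta> \<in> extensional (carrier H)"
  shows "\<theta> \<in> linear_iso H K"
proof -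
  interpret H: vectorspace class_ring H by fact
  interpret K: vectorspace class_ring K by fact
  have "\<theta> \<in> carrier H \<rightarrow> carrier K" using assms(3) by (auto simp: bij_betw_def)
  then show ?thesis
    using assms H.module_axioms K.module_axioms
    unfolding linear_iso_def linear_map_def mod_hom_def mod_hom_axioms_def module_hom_def by simp
qed

lemma linear_iso_id:
  assumes "vectorspace class_ring H" shows "(\<lambda>h\<in>carrier H. h) \<in> linear_iso H H"
proof -
  interpret H: complex_vs H by (rule complex_vs.intro[OF assms])
  show ?thesis
    by (rule linear_isoI) (use assms in \<open>simp_all add: bij_betw_def inj_on_def\<close>)
qed

lemma linear_iso_compose:
  assumes f: "\<phi> \<in> linear_iso H K" and g: "\<psi> \<in> linear_iso K L"
  shows "compose (carrier H) \<psi> \<phi> \<in> linear_iso H L"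
proof (rule linear_isoI)
  note fD = linear_isoD[OF f] and gD = linear_isoD[OF g]
  interpret H: complex_vs H by (rule complex_vs.intro[OF fD(1)])
  show "vectorspace class_ring H" "vectorspace class_ring L" by (fact fD gD)+
  show "bij_betw (compose (carrier H) \<psi> \<phi>) (carrier H) (carrier L)"
    by (rule bij_betw_compose[OF fD(3) gD(3)])
  show "compose (carrier H) \<psi> \<phi> (h \<oplus>\<^bsub>H\<^esub> k) = compose (carrier H) \<psi> \<phi> h \<oplus>\<^bsub>L\<^esub> compose (carrier H) \<psi> \<phi> k"
    if "h \<in> carrier H" "k \<in> carrier H" for h k
    using that fD(4,5) gD(5) by (simp add: compose_def)
  show "compose (carrier H) \<psi> \<phi> (c \<odot>\<^bsub>H\<^esub> h) = c \<odot>\<^bsub>L\<^esub> compose (carrier H) \<psi> \<phi> h"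
    if "h \<in> carrier H" for h c
    using that fD(4,6) gD(6) by (simp add: compose_def)
qed simp

lemma linear_iso_inv:
  assumes f: "\<phi> \<in> linear_iso H K"
  defines "\<theta> \<equiv> (\<lambda>k\<in>carrier K. inv_into (carrier H) \<phi> k)"
  shows "\<theta> \<in> linear_iso K H" "\<And>h. h \<in> carrier H \<Longrightarrow> \<theta> (\<phi> h) = h"
    "\<And>k. k \<in> carrier K \<Longrightarrow> \<phi> (\<theta> k) = k" "\<And>k. k \<in> carrier K \<Longrightarrow> \<theta> k \<in> carrier H"
proof -
  note fD = linear_isoD[OF f]
  interpret H: complex_vs H by (rule complex_vs.intro[OF fD(1)])
  interpret K: complex_vs K by (rule complex_vs.intro[OF fD(2)])
  show 1: "\<theta> (\<phi> h) = h" if "h \<in> carrier H" for h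
    using that fD(4) bij_betw_inv_into_left[OF fD(3)] by (simp add: \<theta>_def)
  show 2: "\<phi> (\<theta> k) = k" if "k \<in> carrier K" for k
    using that bij_betw_inv_into_right[OF fD(3)] by (simp add: \<theta>_def)
  show 3: "\<theta> k \<in> carrier H" if "k \<in> carrier K" for k
    using that bij_betwE[OF bij_betw_inv_into[OF fD(3)]] by (simp add: \<theta>_def)
  show "\<theta> \<in> linear_iso K H"
  proof (rule linear_isoI)
    show "bij_betw \<theta> (carrier K) (carrier H)"
      by (rule bij_betw_byWitness[where f' = \<phi>]) (use 1 2 3 fD(4) in auto)
    show "\<theta> (h \<oplus>\<^bsub>K\<^esub> k) = \<theta> h \<oplus>\<^bsub>H\<^esub> \<theta> k" if "h \<in> carrier K" "k \<in> carrier K" for h k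
      using 1[of "\<theta> h \<oplus>\<^bsub>H\<^esub> \<theta> k"] fD(5)[OF 3 3, OF that] 2 3 that by simp
    show "\<theta> (c \<odot>\<^bsub>K\<^esub> h) = c \<odot>\<^bsub>H\<^esub> \<theta> h" if "h \<in> carrier K" for h c
      using 1[of "c \<odot>\<^bsub>H\<^esub> \<theta> h"] fD(6)[OF 3[OF that], of c] 2 3 that by simp
  qed (simp_all add: fD(1,2) \<theta>_def)
qed

text \<open>
  Tautological arrows and homotheties are both instances of the following relation, which is
  compatible with reflexions.
\<close>

definition similar_data :: "'x set \<Rightarrow> ('h \<Rightarrow> 'h) \<Rightarrow> ('x \<Rightarrow> complex) \<Rightarrow> ('x, 'h) root_datum
    \<Rightarrow> ('x, 'h) root_datum \<Rightarrow> bool" where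
  "similar_data X \<theta> l v w \<longleftrightarrow> \<theta> \<in> linear_iso (hsp v) (hsp w) \<and> (\<forall>x\<in>X. l x \<noteq> 0)
     \<and> (\<forall>x\<in>X. av w x = \<theta> (l x \<odot>\<^bsub>hsp v\<^esub> av v x)) \<and> (\<forall>x\<in>X. \<forall>h\<in>carrier (hsp v). bv w x (\<theta> h) = bv v x h)
     \<and> (\<forall>x\<in>X. pv w x = pv v x)"

locale similar_pair = V: fixed_root_datum X v + W: fixed_root_datum X w
  for X :: "'x set" and v w :: "('x, 'h) root_datum" +
  fixes \<theta> l
  assumes similar: "similar_data X \<theta> l v w"
begin

lemma \<theta>: "\<theta> \<in> linear_iso (hsp v) (hsp w)" and l: "x \<in> X \<Longrightarrow> l x \<noteq> 0"
  and av: "x \<in> X \<Longrightarrow> av w x = \<theta> (l x \<odot>\<^bsub>hsp v\<^esub> av v x)"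
  and bv: "x \<in> X \<Longrightarrow> h \<in> carrier (hsp v) \<Longrightarrow> bv w x (\<theta> h) = bv v x h"
  and pv: "x \<in> X \<Longrightarrow> pv w x = pv v x"
  using similar by (simp_all add: similar_data_def)

lemma cartan: "x \<in> X \<Longrightarrow> y \<in> X \<Longrightarrow> cartan w x y = l x * cartan v x y"
  by (simp add: cartan_def av bv V.bv_scale)

text \<open>Row \<open>x\<close> of the Cartan matrix is multiplied by \<open>l x\<close>, and
  reflectability involves only the vanishing of its diagonal entry, ratios within the row, and the
  parity.\<close>

lemma reflectable_iff: "reflectable X w x \<longleftrightarrow> reflectable X v x"
proof (cases "x \<in> X")
  case True
  have "2 * cartan w x y / cartan w x x = 2 * cartan v x y / cartan v x x"
    "cartan w x y / cartan w x x = cartan v x y / cartan v x x" if "y \<in> X" for y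
    using True that l[OF True] by (simp_all add: cartan)
  moreover have "cartan w x x = 0 \<longleftrightarrow> cartan v x x = 0" using True l by (simp add: cartan)
  ultimately show ?thesis using True by (auto simp: reflectable_def pv)
qed (simp add: reflectable_def)

text \<open>Off the diagonal the numerator \<open>cartan v y x\<close> stands in row
  \<open>y\<close> and the denominator in row \<open>x\<close>, whence the factor
  \<open>l y / l x\<close>. It is what makes the reflected vectors differ by the same
  \<open>l\<close>.\<close>

lemma a_coeff: "x \<in> X \<Longrightarrow> y \<in> X \<Longrightarrow> W.a_coeff x y * l x = l y * V.a_coeff x y"
  using l by (auto simp: W.a_coeff_def V.a_coeff_def cartan)

lemma b_coeff: "x \<in> X \<Longrightarrow> y \<in> X \<Longrightarrow> W.b_coeff x y = V.b_coeff x y"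
  using l by (auto simp: W.b_coeff_def V.b_coeff_def cartan)

lemma similar_reflexion:
  assumes x: "x \<in> X"
  shows "similar_data X \<theta> l (reflexion X x v) (reflexion X x w)"
  unfolding similar_data_def V.hsp_reflexion W.hsp_reflexion
proof (intro conjI ballI)
  note D = linear_isoD[OF \<theta>]
  show "\<theta> \<in> linear_iso (hsp v) (hsp w)" by (rule \<theta>)
  fix y assume y: "y \<in> X"
  show "l y \<noteq> 0" using l y .
  have "av (reflexion X x w) y = \<theta> (l y \<odot>\<^bsub>hsp v\<^esub> av v y) \<oplus>\<^bsub>hsp w\<^esub> W.a_coeff x y \<odot>\<^bsub>hsp w\<^esub> \<theta> (l x \<odot>\<^bsub>hsp v\<^esub> av v x)"
    using W.av_reflexion[OF x y] av x y by simp
  also have "\<dots> = \<theta> (l y \<odot>\<^bsub>hsp v\<^esub> av v y \<oplus>\<^bsub>hsp v\<^esub> (W.a_coeff x y * l x) \<odot>\<^bsub>hsp v\<^esub> av v x)"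
    using x y by (simp add: D(5,6) flip: V.H.scale_scale)
  also have "\<dots> = \<theta> (l y \<odot>\<^bsub>hsp v\<^esub> (av v y \<oplus>\<^bsub>hsp v\<^esub> V.a_coeff x y \<odot>\<^bsub>hsp v\<^esub> av v x))"
    using x y by (simp add: a_coeff V.H.scale_add_right V.H.scale_scale)
  finally show "av (reflexion X x w) y = \<theta> (l y \<odot>\<^bsub>hsp v\<^esub> av (reflexion X x v) y)"
    using V.av_reflexion[OF x y] by simp
  show "pv (reflexion X x w) y = pv (reflexion X x v) y"
    using x y l by (simp add: W.pv_reflexion V.pv_reflexion cartan pv)
  fix h assume h: "h \<in> carrier (hsp v)"
  show "bv (reflexion X x w) y (\<theta> h) = bv (reflexion X x v) y h"
    using x y h D(4)[OF h] by (simp add: W.bv_reflexion V.bv_reflexion b_coeff bv)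
qed

end

section \<open>Chains of reflexions and invariance of the weights that generate s\<close>

lemma reflexion_connected_refl: "reflexion_connected X v v"
  by (simp add: reflexion_connected_def)

lemma reflexion_connected_step:
  "reflexion_connected X v u \<Longrightarrow> reflectable X u x \<Longrightarrow> reflexion_connected X v (reflexion X x u)"
  unfolding reflexion_connected_def by (auto intro: rtranclp.rtrancl_into_rtrancl)

lemma reflexion_connected_prepend:
  "reflectable X v x \<Longrightarrow> reflexion_connected X (reflexion X x v) u \<Longrightarrow> reflexion_connected X v u"
  unfolding reflexion_connected_def by (rule converse_rtranclp_into_rtranclp) blast+

lemma reflexion_connected_induct [consumes 1, case_names refl step]:
  assumes "reflexion_connected X v u" "P v"
    "\<And>u x. \<lbrakk>reflexion_connected X v u; reflectable X u x; P u\<rbrakk> \<Longrightarrow> P (reflexion X x u)"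
  shows "P u"
  using assms(1) unfolding reflexion_connected_def
  by (induction rule: rtranclp_induct) (use assms in \<open>auto simp: reflexion_connected_def\<close>)

lemma reflectable_in: "reflectable X v x \<Longrightarrow> x \<in> X"
  by (simp add: reflectable_def)

lemma reflexion_connected_datum:
  assumes "reflexion_connected X v u" and fin: "finite X" and rd: "is_root_datum X v"
  shows "is_root_datum X u \<and> hsp u = hsp v"
  using assms(1)
proof (induction rule: reflexion_connected_induct)
  case (step u x)
  then interpret fixed_root_datum X u by unfold_locales (use fin in auto)
  show ?case using reflexion_root_datum[OF reflectable_in[OF step(2)]] step by simp
qed (use rd in simp)

text \<open>Similar data are reflectable at the same elements and stay similar, with unchanged
  \<open>\<theta>\<close> and \<open>l\<close>, after reflecting both. A chain on one side is copied
  step by step to the other.\<close>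

lemma similar_connected:
  assumes fin: "finite X" and v: "is_root_datum X v" and w: "is_root_datum X w"
    and sim: "similar_data X \<theta> l v w"
  shows "reflexion_connected X v v' \<Longrightarrow> \<exists>w'. reflexion_connected X w w' \<and> similar_data X \<theta> l v' w'"
    and "reflexion_connected X w w' \<Longrightarrow> \<exists>v'. reflexion_connected X v v' \<and> similar_data X \<theta> l v' w'"
proof -
  have pair: "similar_pair X v' w' \<theta> l"
    if "reflexion_connected X v v'" "reflexion_connected X w w'" "similar_data X \<theta> l v' w'" for v' w'
  proof -
    have "is_root_datum X v'" "is_root_datum X w'"
      using reflexion_connected_datum[OF that(1) fin v] reflexion_connected_datum[OF that(2) fin w] by auto
    with fin that(3) show ?thesis by unfold_locales
  qed
  show "\<exists>w'. reflexion_connected X w w' \<and> similar_data X \<theta> l v' w'" if "reflexion_connected X v v'"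
    using that
  proof (induction rule: reflexion_connected_induct)
    case (step u x)
    then obtain w' where w': "reflexion_connected X w w'" "similar_data X \<theta> l u w'" by blast
    interpret similar_pair X u w' \<theta> l by (rule pair[OF step(1) w'])
    have "reflectable X w' x" using step(2) reflectable_iff by simp
    then have "reflexion_connected X w (reflexion X x w')" by (rule reflexion_connected_step[OF w'(1)])
    then show ?case using similar_reflexion[OF reflectable_in[OF step(2)]] by blast
  qed (use sim reflexion_connected_refl in blast)
  show "\<exists>v'. reflexion_connected X v v' \<and> similar_data X \<theta> l v' w'" if "reflexion_connected X w w'"
    using that
  proof (induction rule: reflexion_connected_induct)
    case (step u x)
    then obtain v' where v': "reflexion_connected X v v'" "similar_data X \<theta> l v' u" by blast
    interpret similar_pair X v' u \<theta> l by (rule pair[OF v'(1) step(1) v'(2)])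
    have "reflectable X v' x" using step(2) reflectable_iff by simp
    then have "reflexion_connected X v (reflexion X x v')" by (rule reflexion_connected_step[OF v'(1)])
    then show ?case using similar_reflexion[OF reflectable_in[OF step(2)]] by blast
  qed (use sim reflexion_connected_refl in blast)
qed

lemma s_weight_cong:
  "(\<And>h. h \<in> carrier (hsp v) \<Longrightarrow> \<mu> h = \<nu> h) \<Longrightarrow> s_weight X v \<mu> \<longleftrightarrow> s_weight X v \<nu>"
  unfolding s_weight_def by auto

lemma similar_s_weight:
  assumes fin: "finite X" and v: "is_root_datum X v" and w: "is_root_datum X w"
    and sim: "similar_data X \<theta> l v w"
  shows "s_weight X v (\<lambda>h. \<mu> (\<theta> h)) \<longleftrightarrow> s_weight X w \<mu>"
proof -
  have \<theta>: "\<theta> \<in> linear_iso (hsp v) (hsp w)" using sim by (simp add: similar_data_def)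
  note D = linear_isoD[OF \<theta>] and inv = linear_iso_inv[OF \<theta>]
  let ?i = "\<lambda>k\<in>carrier (hsp w). inv_into (carrier (hsp v)) \<theta> k"
  show ?thesis
  proof
    assume "s_weight X v (\<lambda>h. \<mu> (\<theta> h))"
    then obtain v' x y where *: "reflexion_connected X v v'" "x \<in> X" "y \<in> X" "x \<noteq> y"
      "\<And>h. h \<in> carrier (hsp v) \<Longrightarrow> \<mu> (\<theta> h) = bv v' x h - bv v' y h" unfolding s_weight_def by blast
    obtain w' where w': "reflexion_connected X w w'" "similar_data X \<theta> l v' w'"
      using similar_connected(1)[OF fin v w sim *(1)] by blast
    have H: "hsp v' = hsp v" using reflexion_connected_datum[OF *(1) fin v] by simp
    show "s_weight X w \<mu>"
    proof (rule s_weightI[OF w'(1) *(2-4)])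
      fix k assume k: "k \<in> carrier (hsp w)"
      have i: "?i k \<in> carrier (hsp v)" "\<theta> (?i k) = k" using inv(3,4)[OF k] by auto
      have "bv w' z (\<theta> (?i k)) = bv v' z (?i k)" if "z \<in> X" for z
        using w'(2) that i(1) H by (simp add: similar_data_def)
      then show "\<mu> k = bv w' x k - bv w' y k" using *(5)[OF i(1)] *(2,3) unfolding i(2) by simp
    qed
  next
    assume "s_weight X w \<mu>"
    then obtain w' x y where *: "reflexion_connected X w w'" "x \<in> X" "y \<in> X" "x \<noteq> y"
      "\<And>k. k \<in> carrier (hsp w) \<Longrightarrow> \<mu> k = bv w' x k - bv w' y k" unfolding s_weight_def by blast
    obtain v' where v': "reflexion_connected X v v'" "similar_data X \<theta> l v' w'"
      using similar_connected(2)[OF fin v w sim *(1)] by blast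
    have H: "hsp v' = hsp v" using reflexion_connected_datum[OF v'(1) fin v] by simp
    show "s_weight X v (\<lambda>h. \<mu> (\<theta> h))"
    proof (rule s_weightI[OF v'(1) *(2-4)])
      fix h assume h: "h \<in> carrier (hsp v)"
      have "bv w' z (\<theta> h) = bv v' z h" if "z \<in> X" for z
        using v'(2) that h H by (simp add: similar_data_def)
      then show "\<mu> (\<theta> h) = bv v' x h - bv v' y h" using *(5)[OF D(4)[OF h]] *(2,3) by simp
    qed
  qed
qed

text \<open>A tautological arrow presupposes only that its target is a vector space; finite
  dimension comes from the image of a finite spanning set.\<close>

lemma fin_dim_transport:
  assumes \<theta>: "\<theta> \<in> linear_iso H K" and fd: "vectorspace.fin_dim class_ring H"
  shows "vectorspace.fin_dim class_ring K"
proof -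
  note D = linear_isoD[OF \<theta>]
  interpret H: complex_vs H by (rule complex_vs.intro[OF D(1)])
  interpret K: complex_vs K by (rule complex_vs.intro[OF D(2)])
  obtain B where B: "finite B" "B \<subseteq> carrier H" "H.span B = carrier H" using fd unfolding H.fin_dim_def by blast
  have KB: "\<theta> ` B \<subseteq> carrier K" using B(2) D(4) by auto
  have "VectorSpace.subspace class_ring (K.span (\<theta> ` B)) K" by (rule K.span_is_subspace[OF KB])
  note S = K.subspaceD[OF this]
  have "\<theta> \<zero>\<^bsub>H\<^esub> = \<zero>\<^bsub>K\<^esub>" using D(6)[of "\<zero>\<^bsub>H\<^esub>" 0] D(4) by simp
  then have "VectorSpace.subspace class_ring {h \<in> carrier H. \<theta> h \<in> K.span (\<theta> ` B)} H"
    by (intro H.subspaceI) (use S D(5,6) in auto)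
  then have "submodule class_ring {h \<in> carrier H. \<theta> h \<in> K.span (\<theta> ` B)} H" by (rule H.is_module)
  moreover have "B \<subseteq> {h \<in> carrier H. \<theta> h \<in> K.span (\<theta> ` B)}"
    using B(2) K.in_own_span[OF KB] by auto
  ultimately have "H.span B \<subseteq> {h \<in> carrier H. \<theta> h \<in> K.span (\<theta> ` B)}" by (intro H.span_is_subset)
  then have "\<theta> ` carrier H \<subseteq> K.span (\<theta> ` B)" using B(3) by auto
  then have "carrier K \<subseteq> K.span (\<theta> ` B)" using D(3) by (simp add: bij_betw_def)
  then have "K.span (\<theta> ` B) = carrier K" using S(1) by auto
  then show ?thesis unfolding K.fin_dim_def using B(1) KB by blast
qed

lemma similar_root_datum:
  assumes fin: "finite X" and v: "is_root_datum X v" and sim: "similar_data X \<theta> l v w"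
    and ext: "av w \<in> extensional X" "bv w \<in> extensional X" "pv w \<in> extensional X"
      "\<And>x. x \<in> X \<Longrightarrow> bv w x \<in> extensional (carrier (hsp w))"
  shows "is_root_datum X w"
  unfolding is_root_datum_def
proof (intro conjI)
  interpret V: fixed_root_datum X v by unfold_locales fact+
  have \<theta>: "\<theta> \<in> linear_iso (hsp v) (hsp w)" and l: "\<And>x. x \<in> X \<Longrightarrow> l x \<noteq> 0"
    and av: "\<And>x. x \<in> X \<Longrightarrow> av w x = \<theta> (l x \<odot>\<^bsub>hsp v\<^esub> av v x)"
    and bv: "\<And>x h. x \<in> X \<Longrightarrow> h \<in> carrier (hsp v) \<Longrightarrow> bv w x (\<theta> h) = bv v x h"
    using sim by (simp_all add: similar_data_def)
  note D = linear_isoD[OF \<theta>] and inv = linear_iso_inv[OF \<theta>]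
  interpret K: complex_vs "hsp w" by (rule complex_vs.intro[OF D(2)])
  show "vectorspace class_ring (hsp w)" by (rule D(2))
  show "vectorspace.fin_dim class_ring (hsp w)"
    using fin_dim_transport[OF \<theta>] v by (simp add: is_root_datum_def)
  show "av w \<in> X \<rightarrow>\<^sub>E carrier (hsp w)" using ext(1) av D(4) by (auto simp: PiE_def)
  have surj: "\<exists>h\<in>carrier (hsp v). k = \<theta> h" if "k \<in> carrier (hsp w)" for k
    using inv(3,4)[OF that] by metis
  have "bv w x \<in> dual_space (hsp w)" if x: "x \<in> X" for x
    unfolding dual_space_def mem_Collect_eq
  proof (intro conjI ballI allI)
    show "bv w x \<in> extensional (carrier (hsp w))" by (rule ext(4)[OF x])
    fix k assume "k \<in> carrier (hsp w)"
    then obtain h where h: "h \<in> carrier (hsp v)" "k = \<theta> h" using surj by blast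
    show "bv w x (c \<odot>\<^bsub>hsp w\<^esub> k) = c * bv w x k" for c
    proof -
      have "c \<odot>\<^bsub>hsp w\<^esub> k = \<theta> (c \<odot>\<^bsub>hsp v\<^esub> h)" using h D(6) by simp
      then show ?thesis using bv[OF x] h V.bv_scale[OF x] by simp
    qed
    fix k' assume "k' \<in> carrier (hsp w)"
    then obtain h' where h': "h' \<in> carrier (hsp v)" "k' = \<theta> h'" using surj by blast
    have "k \<oplus>\<^bsub>hsp w\<^esub> k' = \<theta> (h \<oplus>\<^bsub>hsp v\<^esub> h')" using h h' D(5) by simp
    then show "bv w x (k \<oplus>\<^bsub>hsp w\<^esub> k') = bv w x k + bv w x k'" using bv[OF x] h h' V.bv_add[OF x] by simp
  qed
  then show "bv w \<in> X \<rightarrow>\<^sub>E dual_space (hsp w)" using ext(2) by (auto simp: PiE_def)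
  show "pv w \<in> extensional X" by (rule ext(3))
  have \<theta>0: "\<theta> \<zero>\<^bsub>hsp v\<^esub> = \<zero>\<^bsub>hsp w\<^esub>" using D(6)[of "\<zero>\<^bsub>hsp v\<^esub>" 0] D(4) by simp
  show "\<forall>c. (\<Oplus>\<^bsub>hsp w\<^esub>x\<in>X. c x \<odot>\<^bsub>hsp w\<^esub> av w x) = \<zero>\<^bsub>hsp w\<^esub> \<longrightarrow> (\<forall>x\<in>X. c x = 0)"
  proof (intro allI impI ballI)
    fix c x assume 0: "(\<Oplus>\<^bsub>hsp w\<^esub>x\<in>X. c x \<odot>\<^bsub>hsp w\<^esub> av w x) = \<zero>\<^bsub>hsp w\<^esub>" and x: "x \<in> X"
    have sum: "Y \<subseteq> X \<Longrightarrow> (\<Oplus>\<^bsub>hsp w\<^esub>x\<in>Y. c x \<odot>\<^bsub>hsp w\<^esub> av w x) = \<theta> (\<Oplus>\<^bsub>hsp v\<^esub>x\<in>Y. (c x * l x) \<odot>\<^bsub>hsp v\<^esub> av v x)"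
      if "finite Y" for Y
      using that
    proof (induction Y rule: finite_induct)
      case (insert z Y)
      have 1: "(\<lambda>x. c x \<odot>\<^bsub>hsp w\<^esub> av w x) \<in> Y \<rightarrow> carrier (hsp w)"
        "(\<lambda>x. (c x * l x) \<odot>\<^bsub>hsp v\<^esub> av v x) \<in> Y \<rightarrow> carrier (hsp v)" using insert.prems av D(4) by auto
      have z: "z \<in> X" using insert.prems by simp
      have 2: "c z \<odot>\<^bsub>hsp w\<^esub> av w z = \<theta> ((c z * l z) \<odot>\<^bsub>hsp v\<^esub> av v z)"
        using z by (simp add: av D(6) flip: V.H.scale_scale)
      have 3: "(\<Oplus>\<^bsub>hsp v\<^esub>x\<in>Y. (c x * l x) \<odot>\<^bsub>hsp v\<^esub> av v x) \<in> carrier (hsp v)" using 1(2) by simp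
      show ?case using insert z 1 2 3 D(4,5) by simp
    qed (simp add: \<theta>0)
    have S: "(\<Oplus>\<^bsub>hsp v\<^esub>x\<in>X. (c x * l x) \<odot>\<^bsub>hsp v\<^esub> av v x) \<in> carrier (hsp v)"
      by (rule V.H.finsum_closed) auto
    have "\<theta> (\<Oplus>\<^bsub>hsp v\<^esub>x\<in>X. (c x * l x) \<odot>\<^bsub>hsp v\<^esub> av v x) = \<theta> \<zero>\<^bsub>hsp v\<^esub>"
      using sum[OF fin subset_refl] 0 \<theta>0 by simp
    then have "(\<Oplus>\<^bsub>hsp v\<^esub>x\<in>X. (c x * l x) \<odot>\<^bsub>hsp v\<^esub> av v x) = \<zero>\<^bsub>hsp v\<^esub>"
      using inj_onD[OF bij_betw_imp_inj_on[OF D(3)] _ S V.H.zero_closed] by blast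
    from V.a_independent[OF this x] show "c x = 0" using l[OF x] by simp
  qed
  show "\<forall>c. (\<forall>k\<in>carrier (hsp w). (\<Sum>x\<in>X. c x * bv w x k) = 0) \<longrightarrow> (\<forall>x\<in>X. c x = 0)"
  proof (intro allI impI ballI)
    fix c x assume 0: "\<forall>k\<in>carrier (hsp w). (\<Sum>x\<in>X. c x * bv w x k) = 0" and x: "x \<in> X"
    have "(\<Sum>x\<in>X. c x * bv v x h) = 0" if h: "h \<in> carrier (hsp v)" for h
    proof -
      have "(\<Sum>x\<in>X. c x * bv v x h) = (\<Sum>x\<in>X. c x * bv w x (\<theta> h))"
        using bv h by (intro sum.cong) auto
      then show ?thesis using bspec[OF 0 D(4)[OF h]] by simp
    qed
    from V.b_independent[OF this x] show "c x = 0" .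
  qed
qed

lemma similar_tautological:
  assumes fin: "finite X" and v: "is_root_datum X v" and \<theta>: "\<theta> \<in> linear_iso (hsp v) K"
  shows "similar_data X \<theta> (\<lambda>_. 1) v (tautological X \<theta> K v)" "is_root_datum X (tautological X \<theta> K v)"
proof -
  interpret V: fixed_root_datum X v by unfold_locales fact+
  note D = linear_isoD[OF \<theta>]
  show sim: "similar_data X \<theta> (\<lambda>_. 1) v (tautological X \<theta> K v)"
    using \<theta> D(4) bij_betw_inv_into_left[OF D(3)] by (simp add: similar_data_def tautological_def)
  show "is_root_datum X (tautological X \<theta> K v)"
    by (rule similar_root_datum[OF fin v sim]) (use V.pv_extensional in \<open>simp_all add: tautological_def\<close>)
qed

lemma similar_homothety:
  assumes fin: "finite X" and v: "is_root_datum X v" and l: "\<And>x. x \<in> X \<Longrightarrow> l x \<noteq> 0"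
  shows "similar_data X (\<lambda>h\<in>carrier (hsp v). h) l v (homothety X l v)" "is_root_datum X (homothety X l v)"
proof -
  interpret V: fixed_root_datum X v by unfold_locales fact+
  show sim: "similar_data X (\<lambda>h\<in>carrier (hsp v). h) l v (homothety X l v)"
    using linear_iso_id[OF V.H.vectorspace_axioms] l by (simp add: similar_data_def homothety_def)
  show "is_root_datum X (homothety X l v)"
    by (rule similar_root_datum[OF fin v sim])
      (use V.pv_extensional V.bv_extensional V.bv_ext in \<open>simp_all add: homothety_def\<close>)
qed

text \<open>\<open>reflexion_connected\<close> is directed by definition, but the step from
  \<open>v\<close> to its reflexion can be undone, so both reach the same data.\<close>

lemma s_weight_reflexion:
  assumes fin: "finite X" and v: "is_root_datum X v" and r: "reflectable X v x"
  shows "s_weight X (reflexion X x v) \<mu> \<longleftrightarrow> s_weight X v \<mu>"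
proof -
  interpret fixed_root_datum X v by unfold_locales fact+
  note inv = reflexion_involution[OF fin v r]
  have "reflexion_connected X (reflexion X x v) u \<longleftrightarrow> reflexion_connected X v u" for u
    using reflexion_connected_prepend[OF r, of u] reflexion_connected_prepend[OF inv(1), of u] inv(2) by auto
  then show ?thesis by (simp add: s_weight_def)
qed

text \<open>Induction over the generation of arrows. Matching the weights by an equivalence rather
  than an implication is what makes the case of inverse arrows go through.\<close>

lemma root_arrow_props:
  assumes "root_arrow X v \<phi> w" and fin: "finite X"
  shows "is_root_datum X v \<and> is_root_datum X w \<and> \<phi> \<in> linear_iso (hsp v) (hsp w)
    \<and> (\<forall>\<mu>. s_weight X v (\<lambda>h. \<mu> (\<phi> h)) \<longleftrightarrow> s_weight X w \<mu>)"
  using assms(1)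
proof (induction rule: root_arrow.induct)
  case (reflexion v x)
  then interpret fixed_root_datum X v by unfold_locales (use fin in auto)
  have "s_weight X v (\<lambda>h. \<mu> ((\<lambda>h\<in>carrier Hv. h) h)) \<longleftrightarrow> s_weight X (reflexion X x v) \<mu>" for \<mu>
    using s_weight_reflexion[OF fin reflexion] s_weight_cong[of v "\<lambda>h. \<mu> ((\<lambda>h\<in>carrier Hv. h) h)" \<mu>] by simp
  then show ?case
    using reflexion reflexion_root_datum[OF reflectable_in[OF reflexion(2)]]
      linear_iso_id[OF H.vectorspace_axioms] unfolding hsp_reflexion by blast
next
  case (tautological v H' \<theta>)
  note S = similar_tautological[OF fin tautological(1,3)]
  have hsp: "hsp (tautological X \<theta> H' v) = H'" by (simp add: tautological_def)
  show ?case
    unfolding hsp using tautological S(2) similar_s_weight[OF fin tautological(1) S(2,1)] by blast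
next
  case (homothety v l)
  note S = similar_homothety[where l = l, OF fin homothety]
  have vs: "vectorspace class_ring (hsp v)" using homothety(1) by (simp add: is_root_datum_def)
  have hsp: "hsp (homothety X l v) = hsp v" by (simp add: homothety_def)
  show ?case
    unfolding hsp using homothety(1) S(2) similar_s_weight[OF fin homothety(1) S(2,1)] linear_iso_id[OF vs]
    by blast
next
  case (ident v)
  have "vectorspace class_ring (hsp v)" using ident by (simp add: is_root_datum_def)
  moreover have "s_weight X v (\<lambda>h. \<mu> ((\<lambda>h\<in>carrier (hsp v). h) h)) \<longleftrightarrow> s_weight X v \<mu>" for \<mu>
    by (rule s_weight_cong) simp
  ultimately show ?case using ident linear_iso_id by blast
next
  case (comp v \<phi> v' \<psi> v'')
  have "s_weight X v (\<lambda>h. \<mu> (compose (carrier (hsp v)) \<psi> \<phi> h)) \<longleftrightarrow> s_weight X v'' \<mu>" for \<mu>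
  proof -
    have "s_weight X v (\<lambda>h. \<mu> (compose (carrier (hsp v)) \<psi> \<phi> h)) \<longleftrightarrow> s_weight X v (\<lambda>h. \<mu> (\<psi> (\<phi> h)))"
      by (rule s_weight_cong) (simp add: compose_def)
    also have "\<dots> \<longleftrightarrow> s_weight X v' (\<lambda>h. \<mu> (\<psi> h))" using comp.IH(1) by auto
    also have "\<dots> \<longleftrightarrow> s_weight X v'' \<mu>" using comp.IH(2) by auto
    finally show ?thesis .
  qed
  then show ?case using comp.IH linear_iso_compose by blast
next
  case (inv v \<phi> w)
  then have \<phi>: "\<phi> \<in> linear_iso (hsp v) (hsp w)" by simp
  note I = linear_iso_inv[OF \<phi>]
  let ?\<theta> = "\<lambda>k\<in>carrier (hsp w). inv_into (carrier (hsp v)) \<phi> k"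
  have "s_weight X w (\<lambda>k. \<mu> (?\<theta> k)) \<longleftrightarrow> s_weight X v \<mu>" for \<mu>
  proof -
    have "\<And>\<mu>. s_weight X v (\<lambda>h. \<mu> (\<phi> h)) \<longleftrightarrow> s_weight X w \<mu>" using inv by blast
    from this[of "\<lambda>k. \<mu> (?\<theta> k)"] have "s_weight X w (\<lambda>k. \<mu> (?\<theta> k)) \<longleftrightarrow> s_weight X v (\<lambda>h. \<mu> (?\<theta> (\<phi> h)))" by simp
    also have "\<dots> \<longleftrightarrow> s_weight X v \<mu>" by (rule s_weight_cong) (use I(2) in simp)
    finally show ?thesis .
  qed
  then show ?case using inv.IH I(1) by blast
qed

text \<open>Chains of reflexions stay inside the component and keep the space \<open>hsp v\<close>.
  The induced map is described pointwise because each composition wraps it in another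
  restriction.\<close>

lemma reflexion_connected_arrow:
  assumes "reflexion_connected X v w" and fin: "finite X" and v: "is_root_datum X v"
  shows "\<exists>\<phi>. root_arrow X v \<phi> w \<and> (\<forall>h\<in>carrier (hsp v). \<phi> h = h)"
  using assms(1)
proof (induction rule: reflexion_connected_induct)
  case refl
  show ?case by (intro exI conjI, rule root_arrow.ident[OF v]) simp
next
  case (step u x)
  then obtain \<phi> where \<phi>: "root_arrow X v \<phi> u" "\<forall>h\<in>carrier (hsp v). \<phi> h = h" by blast
  have u: "is_root_datum X u" "hsp u = hsp v" using reflexion_connected_datum[OF step(1) fin v] by auto
  let ?\<psi> = "compose (carrier (hsp v)) (\<lambda>h\<in>carrier (hsp u). h) \<phi>"
  have "root_arrow X v ?\<psi> (reflexion X x u)"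
    by (rule root_arrow.comp[OF \<phi>(1) root_arrow.reflexion[OF u(1) step(2)]])
  moreover have "\<forall>h\<in>carrier (hsp v). ?\<psi> h = h" using \<phi>(2) u(2) by (simp add: compose_def)
  ultimately show ?case by blast
qed


section \<open>Initial and terminal root Lie superalgebras\<close>

text \<open>The family \<open>I\<close> is any root Lie superalgebra on the component, so the locale
  can be entered with the witness of admissibility and also with each \<open>J\<close> against which
  initiality and terminality are tested.\<close>

locale admissible_component =
  fixes X :: "'x set" and R0 :: "('x, 'h) root_datum set" and I
  assumes fin: "finite X" and component: "is_component X R0" and root_lie: "root_lie X R0 I"
begin

lemma arrow_closed: "v \<in> R0 \<Longrightarrow> root_arrow X v \<phi> w \<Longrightarrow> w \<in> R0"
  using component root_arrow.comp unfolding is_component_def by blast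

lemma object_datum: "v \<in> R0 \<Longrightarrow> is_root_datum X v"
  using component root_arrow_props[OF _ fin] unfolding is_component_def by blast

lemma object_alg: "v \<in> R0 \<Longrightarrow> half_baked_alg X v"
  using fin object_datum by unfold_locales

lemma cartan_free: "v \<in> R0 \<Longrightarrow> cartan_free_ideal X v (I v)"
  using root_lie by (simp add: root_lie_def)

text \<open>\<open>root_lie\<close> yields some isomorphism for each arrow, with no coherence
  between an arrow and its inverse. Hence \<open>\<chi>\<close> is taken as the set-theoretic
  inverse of \<open>\<psi>\<close> instead of an isomorphism belonging to the inverse arrow.\<close>

lemma arrow_pair:
  assumes v: "v \<in> R0" and w: "w \<in> R0" and arrow: "root_arrow X v \<phi> w"
  obtains \<chi> \<psi> \<theta> where "half_baked_pair X v w (I v) (I w) \<chi> \<phi> \<theta>" "half_baked_pair X w v (I w) (I v) \<psi> \<theta> \<phi>"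
    "\<And>q. q \<in> carrier (lie_quot (half_baked X v) (I v)) \<Longrightarrow> \<chi> (\<psi> q) = q"
    "\<And>q. q \<in> carrier (lie_quot (half_baked X w) (I w)) \<Longrightarrow> \<psi> (\<chi> q) = q"
    "\<And>\<mu>. s_weight X v (\<lambda>h. \<mu> (\<phi> h)) \<longleftrightarrow> s_weight X w \<mu>"
    "\<And>\<mu>. s_weight X w (\<lambda>k. \<mu> (\<theta> k)) \<longleftrightarrow> s_weight X v \<mu>"
    "\<And>h. h \<in> carrier (hsp v) \<Longrightarrow> \<theta> (\<phi> h) = h"
proof -
  interpret V: half_baked_alg X v by (rule object_alg[OF v])
  interpret W: half_baked_alg X w by (rule object_alg[OF w])
  have \<phi>: "\<phi> \<in> linear_iso (hsp v) (hsp w)" and s: "\<And>\<mu>. s_weight X v (\<lambda>h. \<mu> (\<phi> h)) \<longleftrightarrow> s_weight X w \<mu>"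
    using root_arrow_props[OF arrow fin] by blast+
  define \<theta> where "\<theta> = (\<lambda>k\<in>carrier (hsp w). inv_into (carrier (hsp v)) \<phi> k)"
  note inv = linear_iso_inv[OF \<phi>, folded \<theta>_def]
  note \<phi>D = linear_isoD[OF \<phi>] and \<theta>D = linear_isoD[OF inv(1)]
  obtain \<psi> where \<psi>: "\<psi> \<in> lie_iso (lie_quot V.A (I v)) (lie_quot W.A (I w))"
    and \<psi>_cart: "\<And>h. h \<in> V.H \<Longrightarrow> \<psi> (I v +>\<^bsub>V.A\<^esub> V.ct h) = I w +>\<^bsub>W.A\<^esub> W.ct (\<phi> h)"
    using root_lie v w arrow unfolding root_lie_def by blast
  define \<chi> where "\<chi> = inv_into (carrier (lie_quot V.A (I v))) \<psi>"
  have \<psi>_hom: "\<psi> \<in> lie_hom (lie_quot V.A (I v)) (lie_quot W.A (I w))"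
    and bij: "bij_betw \<psi> (carrier (lie_quot V.A (I v))) (carrier (lie_quot W.A (I w)))"
    using \<psi> by (simp_all add: lie_iso_def)
  have \<chi>_hom: "\<chi> \<in> lie_hom (lie_quot W.A (I w)) (lie_quot V.A (I v))"
    using lie_iso_inv[OF \<psi>] by (simp add: \<chi>_def lie_iso_def)
  have \<chi>\<psi>: "\<chi> (\<psi> q) = q" if "q \<in> carrier (lie_quot V.A (I v))" for q
    unfolding \<chi>_def by (rule bij_betw_inv_into_left[OF bij that])
  have \<psi>\<chi>: "\<psi> (\<chi> q) = q" if "q \<in> carrier (lie_quot W.A (I w))" for q
    unfolding \<chi>_def by (rule bij_betw_inv_into_right[OF bij that])
  have \<chi>_cart: "\<chi> (I w +>\<^bsub>W.A\<^esub> W.ct k) = I v +>\<^bsub>V.A\<^esub> V.ct (\<theta> k)" if k: "k \<in> W.H" for k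
  proof -
    have "I v +>\<^bsub>V.A\<^esub> V.ct (\<theta> k) \<in> carrier (lie_quot V.A (I v))"
      using V.ct_carrier[OF inv(4)[OF k]] V.A.quot_carrier by blast
    from \<chi>\<psi>[OF this] show ?thesis using \<psi>_cart[OF inv(4)[OF k]] inv(3)[OF k] by simp
  qed
  have P: "half_baked_pair X v w (I v) (I w) \<chi> \<phi> \<theta>"
    by unfold_locales (fact cartan_free[OF v] cartan_free[OF w] \<chi>_hom | rule \<chi>_cart \<phi>D(4) inv(2-4) \<theta>D(5,6); assumption)+
  have Q: "half_baked_pair X w v (I w) (I v) \<psi> \<theta> \<phi>"
    by unfold_locales (fact cartan_free[OF v] cartan_free[OF w] \<psi>_hom | rule \<psi>_cart \<phi>D(4-6) inv(2-4); assumption)+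
  have s': "s_weight X w (\<lambda>k. \<mu> (\<theta> k)) \<longleftrightarrow> s_weight X v \<mu>" for \<mu>
  proof -
    have "s_weight X w (\<lambda>k. \<mu> (\<theta> k)) \<longleftrightarrow> s_weight X v (\<lambda>h. \<mu> (\<theta> (\<phi> h)))"
      using s[of "\<lambda>k. \<mu> (\<theta> k)"] by simp
    also have "\<dots> \<longleftrightarrow> s_weight X v \<mu>" by (rule s_weight_cong) (simp add: inv(2))
    finally show ?thesis .
  qed
  show ?thesis by (rule that[OF P Q \<chi>\<psi> \<psi>\<chi> s s' inv(2)])
qed

text \<open>The chain of reflexions producing a generating weight of \<open>s\<close> is an arrow of
  the component, so \<open>I\<close> identifies the quotients at its ends. The inclusion serves
  twice: for one \<open>I\<close> it keeps \<open>s\<close> off the Cartan subalgebra, and for every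
  \<open>J\<close> it gives the morphism from the initial object.\<close>

lemma s_ideal_subset:
  assumes v: "v \<in> R0"
  shows "s_ideal X v \<subseteq> I v"
proof -
  interpret V: half_baked_alg X v by (rule object_alg[OF v])
  have ideal: "lie_ideal (I v) V.A" using cartan_free[OF v] by (simp add: cartan_free_ideal_def)
  show ?thesis
  proof (rule V.s_ideal_least[OF ideal])
    fix \<mu> u assume \<mu>: "s_weight X v \<mu>" and u: "u \<in> carrier V.A"
      and wt: "\<And>h. h \<in> V.H \<Longrightarrow> brk V.A (V.ct h) u = \<mu> h \<odot>\<^bsub>V.A\<^esub> u"
    obtain w x y where *: "reflexion_connected X v w" "x \<in> X" "y \<in> X" "x \<noteq> y"
      "\<And>h. h \<in> V.H \<Longrightarrow> \<mu> h = bv w x h - bv w y h" using \<mu> unfolding s_weight_def by blast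
    obtain \<phi> where \<phi>: "root_arrow X v \<phi> w" "\<And>h. h \<in> V.H \<Longrightarrow> \<phi> h = h"
      using reflexion_connected_arrow[OF *(1) fin object_datum[OF v]] by blast
    have w: "w \<in> R0" by (rule arrow_closed[OF v \<phi>(1)])
    obtain \<chi> \<psi> \<theta> where pq: "half_baked_pair X v w (I v) (I w) \<chi> \<phi> \<theta>" "half_baked_pair X w v (I w) (I v) \<psi> \<theta> \<phi>"
      and inv: "\<And>q. q \<in> carrier (lie_quot V.A (I v)) \<Longrightarrow> \<chi> (\<psi> q) = q"
      by (rule arrow_pair[OF v w \<phi>(1)]) blast
    have "\<chi> (I w) = I v"
      using lie_homD(8)[OF half_baked_pair.\<chi>[OF pq(1)]] by (simp add: lie_quot_zero)
    from weight_difference_in_ideal[where \<chi> = \<chi>, OF pq(2) inv this *(2-4) u]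
    show "u \<in> I v" using wt *(5) \<phi>(2) by simp
  qed
qed

lemma s_cartan_free:
  assumes v: "v \<in> R0" shows "cartan_free_ideal X v (s_ideal X v)"
proof -
  interpret V: half_baked_alg X v by (rule object_alg[OF v])
  have "I v \<inter> V.ct ` V.H = {\<zero>\<^bsub>V.A\<^esub>}" using cartan_free[OF v] by (simp add: cartan_free_ideal_def)
  moreover have "\<zero>\<^bsub>V.A\<^esub> \<in> s_ideal X v" by (rule V.A.idealD(3)[OF V.s_ideal_is_ideal])
  ultimately have "s_ideal X v \<inter> V.ct ` V.H = {\<zero>\<^bsub>V.A\<^esub>}" using s_ideal_subset[OF v] by blast
  then show ?thesis using V.s_ideal_is_ideal by (simp add: cartan_free_ideal_def)
qed

lemma root_lie_s: "root_lie X R0 (s_ideal X)"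
  unfolding root_lie_def
proof (intro conjI ballI allI impI)
  show "cartan_free_ideal X v (s_ideal X v)" if "v \<in> R0" for v by (rule s_cartan_free[OF that])
  fix v w \<phi> assume v: "v \<in> R0" and w: "w \<in> R0" and arrow: "root_arrow X v \<phi> w"
  obtain \<chi> \<psi> \<theta> where *: "half_baked_pair X v w (I v) (I w) \<chi> \<phi> \<theta>" "half_baked_pair X w v (I w) (I v) \<psi> \<theta> \<phi>"
    and inv: "\<And>q. q \<in> carrier (lie_quot (half_baked X v) (I v)) \<Longrightarrow> \<chi> (\<psi> q) = q"
      "\<And>q. q \<in> carrier (lie_quot (half_baked X w) (I w)) \<Longrightarrow> \<psi> (\<chi> q) = q"
    and s: "\<And>\<mu>. s_weight X v (\<lambda>h. \<mu> (\<phi> h)) \<longleftrightarrow> s_weight X w \<mu>"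
      "\<And>\<mu>. s_weight X w (\<lambda>k. \<mu> (\<theta> k)) \<longleftrightarrow> s_weight X v \<mu>"
    by (rule arrow_pair[OF v w arrow]) blast
  have P: "half_baked_pair_s X v w (I v) (I w) \<chi> \<phi> \<theta>"
    by (intro half_baked_pair_s.intro half_baked_pair_s_axioms.intro *(1) s_ideal_subset[OF v]) (simp add: s(1))
  have Q: "half_baked_pair_s X w v (I w) (I v) \<psi> \<theta> \<phi>"
    by (intro half_baked_pair_s.intro half_baked_pair_s_axioms.intro *(2) s_ideal_subset[OF w]) (simp add: s(2))
  show "\<exists>\<psi>\<in>lie_iso (lie_quot (half_baked X v) (s_ideal X v)) (lie_quot (half_baked X w) (s_ideal X w)).
      \<forall>h\<in>carrier (hsp v). \<psi> (s_ideal X v +>\<^bsub>half_baked X v\<^esub> hb_cart X v h)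
        = s_ideal X w +>\<^bsub>half_baked X w\<^esub> hb_cart X w (\<phi> h)"
    by (rule s_quotient_iso[OF P Q inv])
qed

lemma root_lie_r: "root_lie X R0 (r_ideal X)"
  unfolding root_lie_def
proof (intro conjI ballI allI impI)
  show "cartan_free_ideal X v (r_ideal X v)" if "v \<in> R0" for v
    by (rule half_baked_alg.r_ideal(1)[OF object_alg[OF that]])
  fix v w \<phi> assume v: "v \<in> R0" and w: "w \<in> R0" and arrow: "root_arrow X v \<phi> w"
  obtain \<chi> \<psi> \<theta> where *: "half_baked_pair X v w (I v) (I w) \<chi> \<phi> \<theta>" "half_baked_pair X w v (I w) (I v) \<psi> \<theta> \<phi>"
    and inv: "\<And>q. q \<in> carrier (lie_quot (half_baked X v) (I v)) \<Longrightarrow> \<chi> (\<psi> q) = q"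
      "\<And>q. q \<in> carrier (lie_quot (half_baked X w) (I w)) \<Longrightarrow> \<psi> (\<chi> q) = q"
    by (rule arrow_pair[OF v w arrow]) blast
  show "\<exists>\<psi>\<in>lie_iso (lie_quot (half_baked X v) (r_ideal X v)) (lie_quot (half_baked X w) (r_ideal X w)).
      \<forall>h\<in>carrier (hsp v). \<psi> (r_ideal X v +>\<^bsub>half_baked X v\<^esub> hb_cart X v h)
        = r_ideal X w +>\<^bsub>half_baked X w\<^esub> hb_cart X w (\<phi> h)"
    by (rule r_quotient_iso[OF * inv])
qed

end

text \<open>Inclusion of ideals lets the projections factor, and surjectivity of the projections
  fixes the values on all classes. Extensionality at both levels, on \<open>R0\<close> and on each
  quotient, turns agreement of values into equality of functions.\<close>

lemma unique_root_lie_mor: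
  assumes alg: "\<And>v. v \<in> R0 \<Longrightarrow> half_baked_alg X v"
    and I: "\<And>v. v \<in> R0 \<Longrightarrow> lie_ideal (I v) (half_baked X v)"
    and J: "\<And>v. v \<in> R0 \<Longrightarrow> lie_ideal (J v) (half_baked X v)"
    and IJ: "\<And>v. v \<in> R0 \<Longrightarrow> I v \<subseteq> J v"
  shows "\<exists>!f. f \<in> root_lie_mor X R0 I J"
proof (rule ex1I)
  let ?f = "\<lambda>v\<in>R0. quot_lift (half_baked X v) (\<lambda>u. J v +>\<^bsub>half_baked X v\<^esub> u) (I v)"
  show "?f \<in> root_lie_mor X R0 I J"
    unfolding root_lie_mor_def mem_Collect_eq
  proof (intro conjI ballI)
    show "?f \<in> extensional R0" by simp
    fix v assume v: "v \<in> R0"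
    interpret half_baked_alg X v by (rule alg[OF v])
    have ker: "J v +>\<^bsub>A\<^esub> u = \<zero>\<^bsub>lie_quot A (J v)\<^esub>" if "u \<in> I v" for u
      using that IJ[OF v] A.idealD(2)[OF I[OF v]] A.coset_eq_self_iff[OF J[OF v]] by (auto simp: lie_quot_zero)
    note pr = lie_quot(2)[OF A_superalgebra J[OF v]]
    show "?f v \<in> extensional (carrier (lie_quot A (I v)))" using v by (simp add: quot_lift_def)
    have "quot_lift A (\<lambda>u. J v +>\<^bsub>A\<^esub> u) (I v) \<in> lie_hom (lie_quot A (I v)) (lie_quot A (J v))"
      by (rule quot_lift(2)[OF I[OF v] pr ker])
    then show "?f v \<in> lie_hom (lie_quot A (I v)) (lie_quot A (J v))" using v by simp
    fix u assume u: "u \<in> carrier A"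
    have "quot_lift A (\<lambda>u. J v +>\<^bsub>A\<^esub> u) (I v) (I v +>\<^bsub>A\<^esub> u) = J v +>\<^bsub>A\<^esub> u"
      by (rule quot_lift(1)[OF I[OF v] pr ker u])
    then show "?f v (I v +>\<^bsub>A\<^esub> u) = J v +>\<^bsub>A\<^esub> u" using v by simp
  qed
  then have f: "?f \<in> root_lie_mor X R0 I J" .
  fix g assume g: "g \<in> root_lie_mor X R0 I J"
  show "g = ?f"
  proof (rule extensionalityI)
    show "g \<in> extensional R0" "?f \<in> extensional R0" using f g by (simp_all add: root_lie_mor_def)
    fix v assume v: "v \<in> R0"
    interpret half_baked_alg X v by (rule alg[OF v])
    show "g v = ?f v"
    proof (rule extensionalityI)
      show "g v \<in> extensional (carrier (lie_quot A (I v)))" "?f v \<in> extensional (carrier (lie_quot A (I v)))"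
        using f g v unfolding root_lie_mor_def by blast+
      fix q assume "q \<in> carrier (lie_quot A (I v))"
      then obtain u where u: "u \<in> carrier A" "q = I v +>\<^bsub>A\<^esub> u" unfolding A.quot_carrier by blast
      have "g v (I v +>\<^bsub>A\<^esub> u) = J v +>\<^bsub>A\<^esub> u" "?f v (I v +>\<^bsub>A\<^esub> u) = J v +>\<^bsub>A\<^esub> u"
        using f g v u(1) unfolding root_lie_mor_def by blast+
      then show "g v q = ?f v q" using u(2) by simp
    qed
  qed
qed

theorem mainTheorem2:
  fixes X :: "'x set" and R0 :: "('x, 'h) root_datum set"
  assumes "finite X"
    and "is_component X R0"
    and "admissible X R0"
  shows "root_lie X R0 (s_ideal X) \<and> root_lie X R0 (r_ideal X)
    \<and> initial_root_lie X R0 (s_ideal X) \<and> terminal_root_lie X R0 (r_ideal X)"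
proof -
  have loc: "admissible_component X R0 I" if "root_lie X R0 I" for I
    using assms(1,2) that by unfold_locales
  obtain I where I: "root_lie X R0 I" using assms(3) unfolding admissible_def by blast
  interpret admissible_component X R0 I by (rule loc[OF I])
  have ideal: "lie_ideal (J v) (half_baked X v)" if "root_lie X R0 J" "v \<in> R0" for J v
    using that by (simp add: root_lie_def cartan_free_ideal_def)
  have "\<exists>!f. f \<in> root_lie_mor X R0 (s_ideal X) J" if J: "root_lie X R0 J" for J
    by (rule unique_root_lie_mor[OF object_alg ideal[OF root_lie_s] ideal[OF J]
          admissible_component.s_ideal_subset[OF loc[OF J]]])
  moreover have "\<exists>!f. f \<in> root_lie_mor X R0 J (r_ideal X)" if J: "root_lie X R0 J" for J
    by (rule unique_root_lie_mor[OF object_alg ideal[OF J] ideal[OF root_lie_r]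
          half_baked_alg.r_ideal(2)[OF object_alg admissible_component.cartan_free[OF loc[OF J]]]])
  ultimately show ?thesis
    using root_lie_s root_lie_r by (simp add: initial_root_lie_def terminal_root_lie_def)
qed

end
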